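(* Let $(\vartheta_0,D)$ be one of the pairs $(0.729,2)$, $(0.616,6)$, $(0.554,8)$, $(0.515,12)$, and suppose some $\vartheta>\vartheta_0$ satisfies both conditions (A) and (B) below. Then there exists an integer $d$ with $0<|d|\le D$ such that $\lambda(p+d)=-1$ for infinitely many primes $p$.
   Context: $\Omega(n)$ is the number of prime factors of $n$ counted with multiplicity and $\lambda(n)=(-1)^{\Omega(n)}$. Condition (A): for every $\varepsilon>0$, $A>0$, $\sum_{q\le N^{\vartheta-\varepsilon}}\max_{a:(a,q)=1}\bigl|\sum_{p\le N,\,p\equiv a\ (\mathrm{mod}\ q)}\log p-\frac{N}{\varphi(q)}\bigr|\ll_{\varepsilon,A}\frac{N}{(\log N)^A}$ ($p$ over primes). Condition (B): for every $\varepsilon>0$, $A>0$, $\sum_{q\le N^{\vartheta-\varepsilon}}\max_{y\le N}\max_a\bigl|\sum_{n\le y,\,n\equiv a\ (\mathrm{mod}\ q)}\lambda(n)\bigr|\ll_{\varepsilon,A}\frac{N}{(\log N)^A}$. *)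

theory Defs
  imports Complex_Main "HOL-Computational_Algebra.Primes" "HOL-Number_Theory.Totient"
begin

definition bigOmega :: "nat \<Rightarrow> nat" where
  "bigOmega n = size (prime_factorization n)"

definition liouville :: "nat \<Rightarrow> int" where
  "liouville n = (-1) ^ bigOmega n"

definition condA :: "real \<Rightarrow> bool" where
  "condA \<theta> \<longleftrightarrow> (\<forall>\<epsilon>>0. \<forall>A>0. \<exists>C. \<forall>N::nat. N \<ge> 2 \<longrightarrow>
     (\<Sum>q\<in>{q::nat. 1 \<le> q \<and> real q \<le> real N powr (\<theta> - \<epsilon>)}.
        Max {\<bar>(\<Sum>p\<in>{p::nat. prime p \<and> p \<le> N \<and> [p = a] (mod q)}. ln (real p))
                - real N / real (totient q)\<bar> | a. a < q \<and> coprime a q})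
     \<le> C * real N / ln (real N) powr A)"

definition condB :: "real \<Rightarrow> bool" where
  "condB \<theta> \<longleftrightarrow> (\<forall>\<epsilon>>0. \<forall>A>0. \<exists>C. \<forall>N::nat. N \<ge> 2 \<longrightarrow>
     (\<Sum>q\<in>{q::nat. 1 \<le> q \<and> real q \<le> real N powr (\<theta> - \<epsilon>)}.
        Max {\<bar>real_of_int (\<Sum>n\<in>{n::nat. 1 \<le> n \<and> n \<le> y \<and> [n = a] (mod q)}. liouville n)\<bar>
              | y a. y \<le> N \<and> a < q})
     \<le> C * real N / ln (real N) powr A)"

end

theory Submission
  imports Defs "HOL-Analysis.Analysis" "HOL-Number_Theory.Number_Theory" "HOL-Real_Asymp.Real_Asymp"
begin

text \<open>
  Let \<open>H\<close> be an initial segment of \<open>0, 2, 6, 8, 12\<close> with \<open>k\<close> elements and largest element \<open>D\<close>. If the claim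
  fails, then for all large \<open>n\<close> at most one \<open>n + h\<close> with \<open>h \<in> H\<close> is prime (a second one would be a value
  with \<open>\<lambda> = -1\<close>), and if one is prime then \<open>\<lambda>(n + 1) = 1\<close>. Hence the number of primes among the \<open>n + h\<close>
  is at most \<open>(1 + \<lambda>(n + 1)) / 2\<close>. Average this over \<open>N < n \<le> 2N\<close> with a Selberg weight of level
  \<open>R = N powr (\<eta> / 2)\<close>, \<open>\<eta> < \<theta>\<close>, sieving \<open>\<Prod>h\<in>H. n + h\<close>. By (B) the sum with \<open>\<lambda>\<close> is negligible, so the
  right-hand side averages to \<open>1/2\<close>; by (A) the left-hand side averages to at least \<open>\<eta> k J / (2 I)\<close>.

  In Selberg's diagonal variables \<open>y\<close> both quadratic forms are sums of squares with positive coefficients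
  and, for \<open>y d = ln R + c * ln (R / d)\<close>, they are polynomials in logarithms summed over rough integers.
  So an upper bound for the form counting integers and a lower bound for the one counting primes suffice, and both follow from
  elementary estimates of \<open>\<Sum>1/n\<close>; they give
  \<open>I = 1/k! + 2c/(k+1)! + 2c\<^sup>2/(k+2)!\<close> and \<open>J = 2/(k+1)! + 6c/(k+2)! + 6c\<^sup>2/(k+3)!\<close>. For suitable \<open>c\<close> one has
  \<open>\<eta> k J > I\<close> as soon as \<open>\<eta> > \<theta>0\<close>, a contradiction.
\<close>

section \<open>Sets of primes beyond a bound\<close>

text \<open>Bounding by \<open>(1 + \<lambda>) / 2\<close> instead of by 1 halves the demand on the
  sieve: under (B) an average above 1/2 prime per tuple already contradicts the assumption. Since
  (B) allows every residue class, \<open>n + 1\<close> needs no coprimality to the moduli. The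
  constant weight (c = 0) would need a level above (k + 1) / (2k), that is 0.75, 0.667, 0.625, 0.6
  for k = 2, ..., 5. This exceeds \<open>\<theta>0\<close> in all four cases, hence the linear term
  in \<open>y\<close>. Small primes are disposed of by fixing \<open>n\<close> modulo
  \<open>fact z\<close> and sieving only by primes beyond \<open>z\<close>. Such a prime separates
  the shifts, and the density \<open>rdensity z\<close> occurs to the same total power on both sides
  and cancels. What remains is a factor \<open>exp (2 * k / z) ^ k\<close>, close to 1. So
  \<open>z\<close> is fixed first, using the room in the strict inequality, and only then does N
  grow: additive errors of size \<open>fact z\<close> merely shift \<open>ln R\<close> by a
  constant. The lower bounds carry no error term at all, so they can be iterated over the dimension.
  Powers of logarithms come from integrating an inequality between counting functions, which
  replaces partial summation.\<close>

declare of_nat_prod [simp del]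

definition rough :: "nat \<Rightarrow> nat set" where
  "rough z = {p. prime p \<and> z < p}"

text \<open>A squarefree integer all of whose prime factors exceed \<open>z\<close> is represented by the set of its
  prime factors: coprimality becomes disjointness and the lcm becomes the union.\<close>

definition rsets :: "nat \<Rightarrow> real \<Rightarrow> nat set set" where
  "rsets z x = {A. finite A \<and> A \<subseteq> rough z \<and> real (\<Prod>A) \<le> x}"

text \<open>The density of the integers without prime factor up to \<open>z\<close>. The totient
  form is what counting residue classes modulo \<open>fact z\<close> produces;
  \<open>rdensity_eq\<close> gives the Euler product.\<close>

definition rdensity :: "nat \<Rightarrow> real" where
  "rdensity z = real (totient (fact z)) / fact z"

lemma rough_prime: "p \<in> rough z \<Longrightarrow> prime p"
  and rough_gt: "p \<in> rough z \<Longrightarrow> z < p"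
  by (auto simp: rough_def)

lemma prod_rough_pos: "A \<subseteq> rough z \<Longrightarrow> 0 < \<Prod>A"
  by (intro prod_pos) (auto simp: rough_def prime_gt_0_nat)

lemma rsetsD:
  assumes "A \<in> rsets z x"
  shows "finite A" "A \<subseteq> rough z" "real (\<Prod>A) \<le> x" "1 \<le> \<Prod>A" "1 \<le> x"
proof -
  show a: "finite A" "A \<subseteq> rough z" "real (\<Prod>A) \<le> x"
    using assms by (auto simp: rsets_def)
  show b: "1 \<le> \<Prod>A" using prod_rough_pos[OF a(2)] by linarith
  show "1 \<le> x" using a(3) b by linarith
qed

lemma rsets_member_le:
  assumes "A \<in> rsets z x" "p \<in> A"
  shows "real p \<le> x"
proof -
  have "p dvd \<Prod>A" using assms rsetsD(1) by auto
  then have "p \<le> \<Prod>A" using rsetsD(4)[OF assms(1)] by (intro dvd_imp_le) auto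
  then show ?thesis using rsetsD(3)[OF assms(1)] by linarith
qed

lemma finite_rsets [simp]: "finite (rsets z x)"
proof (rule finite_subset)
  show "rsets z x \<subseteq> Pow {..nat \<lfloor>x\<rfloor>}"
  proof
    fix A assume A: "A \<in> rsets z x"
    have "p \<le> nat \<lfloor>x\<rfloor>" if "p \<in> A" for p
      using rsets_member_le[OF A that] by (simp add: le_nat_floor)
    then show "A \<in> Pow {..nat \<lfloor>x\<rfloor>}" by auto
  qed
qed auto

lemma empty_in_rsets [simp]: "{} \<in> rsets z x \<longleftrightarrow> 1 \<le> x"
  by (auto simp: rsets_def)

lemma rsets_subset:
  assumes "A \<in> rsets z x" "B \<subseteq> A"
  shows "B \<in> rsets z x"
proof -
  have "\<Prod>B dvd \<Prod>A"
    using rsetsD[OF assms(1)] assms(2) by (intro prod_dvd_prod_subset) auto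
  then have "\<Prod>B \<le> \<Prod>A" using rsetsD(4)[OF assms(1)] by (intro dvd_imp_le) auto
  then show ?thesis using rsetsD[OF assms(1)] assms(2)
    by (auto simp: rsets_def intro: finite_subset)
qed

lemma rsets_mono: "x \<le> y \<Longrightarrow> rsets z x \<subseteq> rsets z y"
  by (auto simp: rsets_def)

lemma rsets_disjoint_union:
  assumes "B \<in> rsets z y" "A \<inter> B = {}" "A \<in> rsets z x"
  shows "A \<union> B \<in> rsets z (x * y)" "\<Prod>(A \<union> B) = \<Prod>A * \<Prod>B"
proof -
  show *: "\<Prod>(A \<union> B) = \<Prod>A * \<Prod>B"
    using assms rsetsD(1) by (intro prod.union_disjoint) auto
  show "A \<union> B \<in> rsets z (x * y)"
    unfolding rsets_def using rsetsD[OF assms(1)] rsetsD[OF assms(3)] by (auto simp: * intro!: mult_mono)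
qed

lemma rsets_union:
  assumes "A \<in> rsets z x" "B \<in> rsets z y"
  shows "A \<union> B \<in> rsets z (x * y)"
proof -
  have "A \<union> B = A \<union> (B - A)" by auto
  moreover have "B - A \<in> rsets z y" using assms(2) by (rule rsets_subset) auto
  ultimately show ?thesis using rsets_disjoint_union(1)[of "B - A" z y A x] assms by auto
qed

text \<open>Dirichlet convolution of squarefree integers: a set and a subset of it are the same data
  as two disjoint sets with bounded product. Every induction on the sieve dimension goes through
  this identity.\<close>

lemma rsets_split:
  fixes \<phi> :: "nat set \<Rightarrow> nat set \<Rightarrow> real"
  shows "(\<Sum>A\<in>rsets z x. \<Sum>B\<in>Pow A. \<phi> B (A - B)) =
    (\<Sum>B\<in>rsets z x. \<Sum>D\<in>{D \<in> rsets z (x / real (\<Prod>B)). D \<inter> B = {}}. \<phi> B D)"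
proof -
  have fin: "finite (Pow A)" if "A \<in> rsets z x" for A using rsetsD(1)[OF that] by auto
  have "(\<Sum>A\<in>rsets z x. \<Sum>B\<in>Pow A. \<phi> B (A - B)) =
     (\<Sum>(A, B)\<in>Sigma (rsets z x) Pow. \<phi> B (A - B))"
    using fin by (subst sum.Sigma) auto
  also have "\<dots> = (\<Sum>(B, D)\<in>Sigma (rsets z x) (\<lambda>B. {D \<in> rsets z (x / real (\<Prod>B)). D \<inter> B = {}}). \<phi> B D)"
  proof (rule sum.reindex_bij_witness[where j = "\<lambda>(A, B). (B, A - B)" and i = "\<lambda>(B, D). (B \<union> D, B)"], goal_cases)
    case (1 a) then show ?case by auto
  next
    case (2 a)
    then obtain A B where a: "a = (A, B)" "A \<in> rsets z x" "B \<subseteq> A" by auto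
    have B: "B \<in> rsets z x" and D: "A - B \<in> rsets z x"
      using rsets_subset[OF a(2)] a(3) by auto
    have "\<Prod>A = \<Prod>(A - B) * \<Prod>B"
      using prod.subset_diff[OF a(3) rsetsD(1)[OF a(2)], of "\<lambda>x. x"] by simp
    then have "real (\<Prod>(A - B)) * real (\<Prod>B) \<le> x"
      using rsetsD(3)[OF a(2)] by (metis of_nat_mult)
    then have "real (\<Prod>(A - B)) \<le> x / real (\<Prod>B)"
      using rsetsD(4)[OF B] by (simp add: field_simps)
    then show ?case using a B D by (auto simp: rsets_def)
  next
    case (3 b) then show ?case by auto
  next
    case (4 b)
    then obtain B D where b: "b = (B, D)" "B \<in> rsets z x" "D \<in> rsets z (x / real (\<Prod>B))" "D \<inter> B = {}"
      by auto
    have "D \<union> B \<in> rsets z (x / real (\<Prod>B) * real (\<Prod>B))"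
      using b rsetsD[OF b(2)] by (intro rsets_disjoint_union(1)) (auto simp: rsets_def)
    moreover have "x / real (\<Prod>B) * real (\<Prod>B) = x" using rsetsD(4)[OF b(2)] by simp
    ultimately show ?case using b by (auto simp: Un_commute)
  next
    case (5 a) then show ?case by auto
  qed
  also have "\<dots> = (\<Sum>B\<in>rsets z x. \<Sum>D\<in>{D \<in> rsets z (x / real (\<Prod>B)). D \<inter> B = {}}. \<phi> B D)"
    by (subst sum.Sigma) auto
  finally show ?thesis .
qed

lemma prime_dvd_prod_rough:
  assumes "finite A" "A \<subseteq> rough z" "prime p"
  shows "p dvd \<Prod>A \<longleftrightarrow> p \<in> A"
proof
  assume "p dvd \<Prod>A"
  then obtain a where "a \<in> A" "p dvd a"
    using assms by (auto simp: prime_dvd_prod_iff)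
  then show "p \<in> A" using assms primes_dvd_imp_eq rough_prime by blast
qed (use assms in auto)

lemma inj_on_prod_rough: "inj_on Prod {A. finite A \<and> A \<subseteq> rough z}"
proof (rule inj_onI)
  fix A B assume *: "A \<in> {A. finite A \<and> A \<subseteq> rough z}" "B \<in> {A. finite A \<and> A \<subseteq> rough z}" "\<Prod>A = \<Prod>B"
  have "p \<in> A \<longleftrightarrow> p \<in> B" for p
    using * prime_dvd_prod_rough[of A z p] prime_dvd_prod_rough[of B z p] rough_prime
    by (metis (no_types, lifting) mem_Collect_eq subsetD)
  then show "A = B" by auto
qed

lemma coprime_prod_rough_fact:
  assumes "finite A" "A \<subseteq> rough z"
  shows "coprime (\<Prod>A) (fact z :: nat)"
proof -
  have "coprime p (fact z :: nat)" if "p \<in> A" for p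
    using that assms rough_prime[of p z] rough_gt[of p z] prime_dvd_fact_iff[of p z]
    by (metis leD prime_imp_coprime subsetD)
  then show ?thesis by (intro prod_coprime_left) auto
qed

lemma rdensity_pos: "0 < rdensity z" and rdensity_le_1: "rdensity z \<le> 1"
proof -
  show "0 < rdensity z" by (auto simp: rdensity_def)
  have "totient (fact z) \<le> (fact z :: nat)" by (rule totient_le)
  then have "real (totient (fact z)) \<le> real (fact z)" by (rule of_nat_mono)
  then show "rdensity z \<le> 1" by (auto simp: rdensity_def)
qed

lemma rdensity_eq: "rdensity z = (\<Prod>p | prime p \<and> p \<le> z. 1 - 1 / real p)"
proof -
  have "prime_factors (fact z :: nat) = {p. prime p \<and> p \<le> z}"
    by (auto simp: in_prime_factors_iff prime_dvd_fact_iff)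
  then show ?thesis using totient_formula2[of "fact z"] by (simp add: rdensity_def)
qed

section \<open>Reciprocal sums over rough integers\<close>

text \<open>A truncated Euler product of the factors 1 / (1 - 1/p). Prime powers are allowed, unlike
  in \<open>rsets\<close>, so that for large \<open>Z\<close> it contains the whole harmonic
  sum.\<close>

definition smooth_sum :: "nat set \<Rightarrow> real \<Rightarrow> real" where
  "smooth_sum Z x = (\<Sum>n | 0 < n \<and> real n \<le> x \<and> prime_factors n \<subseteq> Z. 1 / real n)"

lemma finite_nat_real_le [simp]: "finite {n::nat. real n \<le> x}"
proof (rule finite_subset)
  show "{n::nat. real n \<le> x} \<subseteq> {..nat \<lfloor>x\<rfloor>}" by (auto simp: le_nat_floor)
qed auto

lemma finite_smooth [simp]: "finite {n::nat. 0 < n \<and> real n \<le> x \<and> P n}"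
  by (rule finite_subset[OF _ finite_nat_real_le[of x]]) auto

lemma sum_split_pred:
  assumes "finite S"
  shows "sum f S = sum f {x \<in> S. \<not> P x} + sum f {x \<in> S. P x}"
proof -
  have "sum f ({x \<in> S. \<not> P x} \<union> {x \<in> S. P x}) = sum f {x \<in> S. \<not> P x} + sum f {x \<in> S. P x}"
    using assms by (intro sum.union_disjoint) auto
  moreover have "{x \<in> S. \<not> P x} \<union> {x \<in> S. P x} = S" by auto
  ultimately show ?thesis by simp
qed

lemma smooth_sum_mono: "x \<le> y \<Longrightarrow> smooth_sum Z x \<le> smooth_sum Z y"
  unfolding smooth_sum_def by (intro sum_mono2) auto

text \<open>Split by divisibility by \<open>q\<close>. The multiples are \<open>q * m\<close> with
  \<open>m\<close> again free to contain \<open>q\<close>, so the enlarged set reappears on the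
  right with a smaller cutoff.\<close>

lemma smooth_sum_insert:
  assumes q: "prime q" "q \<notin> Z"
  shows "smooth_sum (insert q Z) x = smooth_sum Z x + 1 / real q * smooth_sum (insert q Z) (x / real q)"
proof -
  have q0: "q > 0" using q by (simp add: prime_gt_0_nat)
  let ?S = "{n. 0 < n \<and> real n \<le> x \<and> prime_factors n \<subseteq> insert q Z}"
  have "smooth_sum (insert q Z) x =
      (\<Sum>n\<in>{n \<in> ?S. \<not> q dvd n}. 1 / real n) + (\<Sum>n\<in>{n \<in> ?S. q dvd n}. 1 / real n)"
    unfolding smooth_sum_def by (rule sum_split_pred) simp
  moreover have "{n \<in> ?S. \<not> q dvd n} = {n. 0 < n \<and> real n \<le> x \<and> prime_factors n \<subseteq> Z}"
    using q by (auto simp: in_prime_factors_iff)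
  moreover have "(\<Sum>n\<in>{n \<in> ?S. q dvd n}. 1 / real n) =
     (\<Sum>m | 0 < m \<and> real m \<le> x / real q \<and> prime_factors m \<subseteq> insert q Z. 1 / real q * (1 / real m))"
  proof (rule sum.reindex_bij_witness[where i = "\<lambda>m. q * m" and j = "\<lambda>n. n div q"], goal_cases)
    case (2 a)
    then obtain m where m: "a = q * m" by auto
    show ?case using 2 q q0 unfolding m
      by (auto simp: prime_factors_product field_simps)
  next
    case (4 b)
    then show ?case using q q0
      by (auto simp: prime_factors_product prime_prime_factors field_simps)
  qed (use q0 in auto)
  ultimately show ?thesis unfolding smooth_sum_def by (simp add: sum_distrib_left)
qed

text \<open>Enlarging the cutoff \<open>x / q\<close> back to \<open>x\<close> turns the recursion
  into a linear inequality, which is solved for the sum.\<close>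

lemma smooth_sum_insert_le_mult:
  assumes q: "prime q" "q \<notin> Z"
  shows "smooth_sum (insert q Z) x \<le> real q / (real q - 1) * smooth_sum Z x"
proof (cases "0 \<le> x")
  case True
  have q1: "real q > 1" using q prime_gt_1_nat by (metis of_nat_1 of_nat_less_iff)
  have "x / real q \<le> x / 1" using q1 True by (intro divide_left_mono) auto
  then have "smooth_sum (insert q Z) (x / real q) \<le> smooth_sum (insert q Z) x"
    by (intro smooth_sum_mono) auto
  then have "1 / real q * smooth_sum (insert q Z) (x / real q) \<le> 1 / real q * smooth_sum (insert q Z) x"
    using q1 by (intro mult_left_mono) auto
  then have "smooth_sum (insert q Z) x \<le> smooth_sum Z x + 1 / real q * smooth_sum (insert q Z) x"
    using smooth_sum_insert[OF q, of x] by linarith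
  then show ?thesis using q1 by (simp add: field_simps)
next
  case False
  then have "smooth_sum Z x = 0" for Z unfolding smooth_sum_def by (intro sum.neutral) auto
  then show ?thesis by simp
qed

text \<open>Here the previous bound is applied only after the cutoff has dropped to
  \<open>x / q\<close>. This keeps the condition on the size of the radical, which the squarefree
  sum needs.\<close>

lemma smooth_sum_insert_le_add:
  assumes q: "prime q" "q \<notin> Z"
  shows "smooth_sum (insert q Z) x \<le> smooth_sum Z x + 1 / (real q - 1) * smooth_sum Z (x / real q)"
proof -
  have q1: "real q > 1" using q prime_gt_1_nat by (metis of_nat_1 of_nat_less_iff)
  have "1 / real q * smooth_sum (insert q Z) (x / real q)
     \<le> 1 / real q * (real q / (real q - 1) * smooth_sum Z (x / real q))"
    using q1 by (intro mult_left_mono smooth_sum_insert_le_mult q) auto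
  also have "\<dots> = 1 / (real q - 1) * smooth_sum Z (x / real q)" using q1 by (simp add: field_simps)
  finally show ?thesis using smooth_sum_insert[OF q, of x] by linarith
qed

lemma smooth_sum_le_union:
  assumes "finite Z0" "\<And>p. p \<in> Z0 \<Longrightarrow> prime p" "Z0 \<inter> Z1 = {}"
  shows "smooth_sum (Z0 \<union> Z1) x \<le> (\<Prod>p\<in>Z0. real p / (real p - 1)) * smooth_sum Z1 x"
  using assms
proof (induction Z0 rule: finite_induct)
  case (insert q F)
  have q1: "real q > 1" using insert.prems(1)[of q] prime_gt_1_nat by (metis insertI1 of_nat_1 of_nat_less_iff)
  have "smooth_sum (insert q F \<union> Z1) x \<le> real q / (real q - 1) * smooth_sum (F \<union> Z1) x"
    using insert smooth_sum_insert_le_mult[of q "F \<union> Z1" x] by auto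
  also have "\<dots> \<le> real q / (real q - 1) * ((\<Prod>p\<in>F. real p / (real p - 1)) * smooth_sum Z1 x)"
    using insert q1 by (intro mult_left_mono) auto
  finally show ?case using insert by (simp add: mult.assoc)
qed simp

text \<open>Group integers by their radical: all n with radical \<open>\<Prod>D\<close> together
  contribute the product of 1/(p - 1), and n \<le> x forces \<open>\<Prod>D \<le> x\<close>. The
  induction peels off one prime at a time.\<close>

lemma smooth_sum_le_subsets:
  assumes "finite Z" "\<And>p. p \<in> Z \<Longrightarrow> prime p"
  shows "smooth_sum Z x \<le> (\<Sum>D | D \<subseteq> Z \<and> real (\<Prod>D) \<le> x. \<Prod>p\<in>D. 1 / (real p - 1))"
  using assms
proof (induction Z arbitrary: x rule: finite_induct)
  case empty
  have *: "{n::nat. 0 < n \<and> real n \<le> x \<and> prime_factors n \<subseteq> {}} = (if 1 \<le> x then {1} else {})"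
    by (auto simp: prime_factorization_empty_iff)
  have "{D. D \<subseteq> {} \<and> real (\<Prod>D) \<le> x} = (if 1 \<le> x then {{}} else {})" by auto
  then show ?case unfolding smooth_sum_def * by simp
next
  case (insert q Z)
  have q: "prime q" using insert by auto
  have q1: "real q > 1" using q prime_gt_1_nat by (metis of_nat_1 of_nat_less_iff)
  let ?c = "\<lambda>D. \<Prod>p\<in>D. 1 / (real p - 1)"
  let ?X = "{D. D \<subseteq> insert q Z \<and> real (\<Prod>D) \<le> x}"
  have fin: "finite {D. D \<subseteq> Y \<and> P D}" if "finite Y" for Y :: "nat set" and P
    using that by (auto intro: finite_subset[of _ "Pow Y"])
  have "(\<Sum>D\<in>?X. ?c D) = (\<Sum>D\<in>{D \<in> ?X. q \<notin> D}. ?c D) + (\<Sum>D\<in>{D \<in> ?X. q \<in> D}. ?c D)"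
    using insert(1) by (intro sum_split_pred fin) auto
  moreover have "{D \<in> ?X. q \<notin> D} = {D. D \<subseteq> Z \<and> real (\<Prod>D) \<le> x}" using insert(2) by auto
  moreover have "(\<Sum>D\<in>{D \<in> ?X. q \<in> D}. ?c D) =
     (\<Sum>D | D \<subseteq> Z \<and> real (\<Prod>D) \<le> x / real q. 1 / (real q - 1) * ?c D)"
  proof (rule sum.reindex_bij_witness[where i = "\<lambda>D. insert q D" and j = "\<lambda>D. D - {q}"], goal_cases)
    case (2 D)
    then have D: "finite D" "q \<in> D" using insert(1) by (auto intro: finite_subset)
    have "\<Prod>D = q * \<Prod>(D - {q})" using D by (simp add: prod.remove)
    then show ?case using 2 q1 by (auto simp: field_simps)
  next
    case (4 D)
    then have D: "finite D" "q \<notin> D" using insert by (auto intro: finite_subset)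
    then show ?case using 4 q1 by (auto simp: field_simps)
  next
    case (5 D)
    then have D: "finite D" "q \<in> D" using insert(1) by (auto intro: finite_subset)
    show ?case using prod.remove[OF D, of "\<lambda>p. 1 / (real p - 1)"] by simp
  qed (use insert in auto)
  moreover have "smooth_sum (insert q Z) x \<le> smooth_sum Z x + 1 / (real q - 1) * smooth_sum Z (x / real q)"
    using insert q by (intro smooth_sum_insert_le_add) auto
  moreover have "1 / (real q - 1) * smooth_sum Z (x / real q) \<le>
     1 / (real q - 1) * (\<Sum>D | D \<subseteq> Z \<and> real (\<Prod>D) \<le> x / real q. ?c D)"
    using insert q1 by (intro mult_left_mono) auto
  moreover have "smooth_sum Z x \<le> (\<Sum>D | D \<subseteq> Z \<and> real (\<Prod>D) \<le> x. ?c D)"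
    using insert by auto
  ultimately show ?case by (simp add: sum_distrib_left)
qed

lemma ln_le_smooth_sum:
  assumes "1 \<le> x" "{p. prime p \<and> real p \<le> x} \<subseteq> Z"
  shows "ln x \<le> smooth_sum Z x"
proof -
  have "ln x \<le> ln (real (nat \<lfloor>x\<rfloor>) + 1)" using assms(1) by (intro ln_mono) linarith+
  also have "\<dots> \<le> harm (nat \<lfloor>x\<rfloor>)" by (rule ln_le_harm)
  also have "\<dots> \<le> smooth_sum Z x"
    unfolding harm_def smooth_sum_def
  proof (subst inverse_eq_divide, intro sum_mono2)
    show "{1..nat \<lfloor>x\<rfloor>} \<subseteq> {n. 0 < n \<and> real n \<le> x \<and> prime_factors n \<subseteq> Z}"
    proof
      fix n assume n: "n \<in> {1..nat \<lfloor>x\<rfloor>}"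
      then have nx: "real n \<le> x" using assms(1) by (auto simp: le_nat_iff le_floor_iff)
      have "p \<in> Z" if "p \<in> prime_factors n" for p
      proof -
        have "p \<le> n" using that n by (auto intro: dvd_imp_le simp: in_prime_factors_iff)
        then have "real p \<le> x" using nx by linarith
        then show ?thesis using that assms(2) by (auto simp: in_prime_factors_iff)
      qed
      then show "n \<in> {n. 0 < n \<and> real n \<le> x \<and> prime_factors n \<subseteq> Z}" using n nx by auto
    qed
  qed auto
  finally show ?thesis .
qed

text \<open>Start from the full harmonic sum, at least \<open>ln x\<close>. Removing the primes up
  to \<open>z\<close> and those of \<open>C\<close> costs their Euler factors, whose inverses are
  the two densities on the left; the remaining primes are collapsed to radicals. No error term
  arises.\<close>

lemma rough_sum_ge:
  assumes C: "finite C" "C \<subseteq> rough z" and x: "1 \<le> x"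
  shows "rdensity z * (\<Prod>p\<in>C. 1 - 1 / real p) * ln x
    \<le> (\<Sum>D\<in>{D \<in> rsets z x. D \<inter> C = {}}. \<Prod>p\<in>D. 1 / (real p - 1))"
proof -
  define Z0 where "Z0 = {p. prime p \<and> p \<le> z} \<union> C"
  define Z1 where "Z1 = {p. prime p \<and> z < p \<and> real p \<le> x} - C"
  have fin: "finite Z0" "finite Z1" using C(1) unfolding Z0_def Z1_def
    by (auto intro!: finite_subset[OF _ finite_nat_real_le[of x]])
  have pr: "prime p" if "p \<in> Z0 \<union> Z1" for p using that C rough_prime[of p z] unfolding Z0_def Z1_def by auto
  have dj: "Z0 \<inter> Z1 = {}" by (auto simp: Z0_def Z1_def)
  have gt1: "real p > 1" if "p \<in> Z0" for p
    using pr[of p] that prime_gt_1_nat[of p] by simp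
  have "ln x \<le> smooth_sum (Z0 \<union> Z1) x"
    using x by (intro ln_le_smooth_sum) (auto simp: Z0_def Z1_def)
  also have "\<dots> \<le> (\<Prod>p\<in>Z0. real p / (real p - 1)) * smooth_sum Z1 x"
    by (rule smooth_sum_le_union[OF fin(1) _ dj]) (simp add: pr)
  also have "\<dots> \<le> (\<Prod>p\<in>Z0. real p / (real p - 1)) *
       (\<Sum>D | D \<subseteq> Z1 \<and> real (\<Prod>D) \<le> x. \<Prod>p\<in>D. 1 / (real p - 1))"
  proof (rule mult_left_mono)
    show "smooth_sum Z1 x \<le> (\<Sum>D | D \<subseteq> Z1 \<and> real (\<Prod>D) \<le> x. \<Prod>p\<in>D. 1 / (real p - 1))"
      by (rule smooth_sum_le_subsets[OF fin(2)]) (simp add: pr)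
    show "0 \<le> (\<Prod>p\<in>Z0. real p / (real p - 1))"
      by (intro prod_nonneg) (auto dest!: gt1)
  qed
  \<comment> \<open>Cutting \<open>Z1\<close> off at \<open>x\<close> only makes it finite: a prime
    above \<open>x\<close> cannot occur in a set with product at most \<open>x\<close>.\<close>
  also have "{D. D \<subseteq> Z1 \<and> real (\<Prod>D) \<le> x} = {D \<in> rsets z x. D \<inter> C = {}}"
  proof (intro Set.set_eqI iffI)
    fix D assume "D \<in> {D. D \<subseteq> Z1 \<and> real (\<Prod>D) \<le> x}"
    then show "D \<in> {D \<in> rsets z x. D \<inter> C = {}}"
      using fin by (auto simp: rsets_def rough_def Z1_def intro: finite_subset)
  next
    fix D assume D: "D \<in> {D \<in> rsets z x. D \<inter> C = {}}"
    then show "D \<in> {D. D \<subseteq> Z1 \<and> real (\<Prod>D) \<le> x}"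
      using rsets_member_le[of D z x] rsetsD[of D z x] by (auto simp: Z1_def rough_def)
  qed
  finally have *: "ln x \<le> (\<Prod>p\<in>Z0. real p / (real p - 1)) *
    (\<Sum>D\<in>{D \<in> rsets z x. D \<inter> C = {}}. \<Prod>p\<in>D. 1 / (real p - 1))" .
  have "rdensity z * (\<Prod>p\<in>C. 1 - 1 / real p) = (\<Prod>p\<in>Z0. 1 - 1 / real p)"
    unfolding rdensity_eq Z0_def using C by (subst prod.union_disjoint) (auto simp: rough_def)
  moreover have "(\<Prod>p\<in>Z0. 1 - 1 / real p) * (\<Prod>p\<in>Z0. real p / (real p - 1)) = 1"
    unfolding prod.distrib[symmetric]
  proof (rule prod.neutral, rule ballI)
    fix p assume "p \<in> Z0"
    then have "real p > 1" by (rule gt1)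
    then show "(1 - 1 / real p) * (real p / (real p - 1)) = 1" by (simp add: field_simps)
  qed
  moreover have "0 \<le> (\<Prod>p\<in>Z0. 1 - 1 / real p)"
  proof (intro prod_nonneg)
    fix p assume "p \<in> Z0"
    then have "real p > 1" by (rule gt1)
    then show "0 \<le> 1 - 1 / real p" by (simp add: field_simps)
  qed
  ultimately show ?thesis using mult_left_mono[OF *, of "\<Prod>p\<in>Z0. 1 - 1 / real p"]
    by (simp add: mult.assoc[symmetric])
qed

section \<open>Upper bound for rough reciprocal sums by residue classes\<close>

lemma harm_le_ln_add_1:
  assumes "n \<ge> 1"
  shows "harm n \<le> ln (real n) + (1::real)"
  using assms
proof (induction n rule: dec_induct)
  case base then show ?case by (simp add: harm_def)
next
  case (step n)
  have n: "real n > 0" using step by simp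
  have "ln (real n / real (Suc n)) \<le> real n / real (Suc n) - 1"
    using n by (intro ln_le_minus_one) auto
  also have "\<dots> = - inverse (real (Suc n))" using n by (simp add: field_simps)
  finally have "inverse (real (Suc n)) \<le> ln (real (Suc n)) - ln (real n)"
    using n by (simp add: ln_div)
  then show ?case using step by (simp add: harm_Suc)
qed

text \<open>Write n = W i + s with \<open>s\<close> a totative. In each class the term i = 0 is at
  most 1 and the others are at most 1 / (W i), a harmonic sum divided by W.\<close>

lemma coprime_reciprocal_sum_le:
  assumes W: "0 < (W::nat)" and x: "1 \<le> x"
  shows "(\<Sum>n | 0 < n \<and> real n \<le> x \<and> coprime n W. 1 / real n)
     \<le> real (totient W) / real W * (ln x + real W + 1)"
proof -
  define M where "M = nat \<lfloor>x\<rfloor> div W"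
  have inner: "(\<Sum>i\<in>{0..M}. 1 / (real W * real i + real s)) \<le> (ln x + real W + 1) / real W"
    if s: "s \<in> totatives W" for s
  proof -
    have s1: "real s \<ge> 1" using s totatives_def by auto
    have "(\<Sum>i\<in>{0..M}. 1 / (real W * real i + real s)) =
       1 / real s + (\<Sum>i\<in>{1..M}. 1 / (real W * real i + real s))"
      by (simp add: sum.atLeast_Suc_atMost)
    also have "(\<Sum>i\<in>{1..M}. 1 / (real W * real i + real s)) \<le> (\<Sum>i\<in>{1..M}. 1 / (real W * real i))"
      using s1 W by (intro sum_mono divide_left_mono) (auto intro!: add_pos_nonneg mult_pos_pos)
    also have "\<dots> = harm M / real W"
      by (simp add: harm_def sum_divide_distrib field_simps)
    also have "harm M \<le> ln x + 1"
    proof (cases "M \<ge> 1")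
      case True
      have "M \<le> nat \<lfloor>x\<rfloor>" unfolding M_def by simp
      then have "real M \<le> x" using x True by (auto simp: le_nat_iff le_floor_iff)
      then have "ln (real M) \<le> ln x" using True by (intro ln_mono) auto
      then show ?thesis using harm_le_ln_add_1[OF True] by linarith
    next
      case False
      then show ?thesis using x by (auto simp: harm_def not_le)
    qed
    also have "1 / real s \<le> 1" using s1 by simp
    finally have "(\<Sum>i\<in>{0..M}. 1 / (real W * real i + real s)) \<le> 1 + (ln x + 1) / real W"
      using W by (simp add: divide_right_mono)
    then show ?thesis using W by (simp add: field_simps)
  qed
  have "(\<Sum>n | 0 < n \<and> real n \<le> x \<and> coprime n W. 1 / real n)
     \<le> (\<Sum>(s, i)\<in>totatives W \<times> {0..M}. 1 / (real W * real i + real s))"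
  proof (rule sum_le_included[where i = "\<lambda>(s, i). W * i + s"])
    show "\<forall>n\<in>{n. 0 < n \<and> real n \<le> x \<and> coprime n W}. \<exists>y\<in>totatives W \<times> {0..M}.
       (case y of (s, i) \<Rightarrow> W * i + s) = n \<and> 1 / real n \<le> (case y of (s, i) \<Rightarrow> 1 / (real W * real i + real s))"
    proof
      fix n assume n: "n \<in> {n. 0 < n \<and> real n \<le> x \<and> coprime n W}"
      \<comment> \<open>Representatives run through 1..W rather than 0..W-1. This matches
        \<open>totatives\<close>, and \<open>s \<ge> 1\<close> is what bounds the term i =
        0.\<close>
      define s i where "s = (n - 1) mod W + 1" and "i = (n - 1) div W"
      have e: "W * i + s = n" using n unfolding s_def i_def by simp
      have "n \<le> nat \<lfloor>x\<rfloor>" using n by (auto simp: le_nat_floor)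
      then have "i \<le> M" unfolding i_def M_def by (intro div_le_mono) auto
      moreover have "s \<in> totatives W"
      proof -
        have "(n - 1) mod W < W" using W by simp
        moreover have "coprime s W"
          using n e by (metis (no_types, lifting) coprime_iff_gcd_eq_1 gcd.commute gcd_add_mult mem_Collect_eq mult.commute add.commute)
        ultimately show ?thesis unfolding totatives_def s_def by auto
      qed
      ultimately show "\<exists>y\<in>totatives W \<times> {0..M}.
       (case y of (s, i) \<Rightarrow> W * i + s) = n \<and> 1 / real n \<le> (case y of (s, i) \<Rightarrow> 1 / (real W * real i + real s))"
        using e by (intro bexI[of _ "(s, i)"]) (auto simp flip: of_nat_mult of_nat_add)
    qed
  qed auto
  also have "\<dots> = (\<Sum>s\<in>totatives W. \<Sum>i\<in>{0..M}. 1 / (real W * real i + real s))"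
    by (subst sum.cartesian_product) auto
  also have "\<dots> \<le> (\<Sum>s\<in>totatives W. (ln x + real W + 1) / real W)"
    using inner by (intro sum_mono) auto
  also have "\<dots> = real (totient W) / real W * (ln x + real W + 1)" by (simp add: totient_def)
  finally show ?thesis .
qed

lemma rsets_reciprocal_sum_le:
  assumes x: "1 \<le> x"
  shows "(\<Sum>A\<in>rsets z x. 1 / real (\<Prod>A)) \<le> rdensity z * (ln x + fact z + 1)"
proof -
  have "(\<Sum>A\<in>rsets z x. 1 / real (\<Prod>A)) = (\<Sum>n\<in>Prod ` rsets z x. 1 / real n)"
  proof (subst sum.reindex)
    show "inj_on Prod (rsets z x)"
      by (rule inj_on_subset[OF inj_on_prod_rough[of z]]) (auto simp: rsets_def)
  qed simp
  also have "\<dots> \<le> (\<Sum>n | 0 < n \<and> real n \<le> x \<and> coprime n (fact z). 1 / real n)"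
  proof (rule sum_mono2)
    show "Prod ` rsets z x \<subseteq> {n. 0 < n \<and> real n \<le> x \<and> coprime n (fact z)}"
    proof (rule image_subsetI)
      fix A assume A: "A \<in> rsets z x"
      show "\<Prod>A \<in> {n. 0 < n \<and> real n \<le> x \<and> coprime n (fact z)}"
        using coprime_prod_rough_fact[OF rsetsD(1,2)[OF A]] rsetsD(3,4)[OF A] by simp
    qed
  qed auto
  also have "\<dots> \<le> rdensity z * (ln x + fact z + 1)"
    using coprime_reciprocal_sum_le[of "fact z" x] x by (simp add: rdensity_def)
  finally show ?thesis .
qed

section \<open>Iterated logarithmic sums\<close>

text \<open>Divided power of the positive part, normalised so that integration raises the index by
  one. As 0^0 = 1, index 0 is the indicator of t \<ge> 0, so
  \<open>ppow 0 (s - ln (real (\<Prod>A)))\<close> encodes the cutoff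
  \<open>\<Prod>A \<le> exp s\<close>.\<close>

definition ppow :: "nat \<Rightarrow> real \<Rightarrow> real" where
  "ppow i t = (if t < 0 then 0 else t ^ i / fact i)"

lemma ppow_nonneg [simp]: "0 \<le> ppow i t"
  by (simp add: ppow_def)

lemma ppow_mono: "s \<le> t \<Longrightarrow> ppow i s \<le> ppow i t"
  by (auto simp: ppow_def intro!: divide_right_mono power_mono)

lemma ppow_integral_shift:
  fixes t X :: real
  assumes "0 \<le> t" "t \<le> X"
  shows "((\<lambda>s. (s - t) ^ i / fact i) has_integral (X - t) ^ Suc i / fact (Suc i)) {t..X}"
proof -
  have "((\<lambda>s. (s - t) ^ i / fact i) has_integral
     ((X - t) ^ Suc i / fact (Suc i) - (t - t) ^ Suc i / fact (Suc i))) {t..X}"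
  proof (rule fundamental_theorem_of_calculus[where f = "\<lambda>s. (s - t) ^ Suc i / fact (Suc i)"])
    fix s assume "s \<in> {t..X}"
    have "((\<lambda>s. (s - t) ^ Suc i / fact (Suc i)) has_real_derivative (s - t) ^ i / fact i) (at s within {t..X})"
      by (rule derivative_eq_intros refl | simp add: field_simps del: of_nat_Suc)+
    then show "((\<lambda>s. (s - t) ^ Suc i / fact (Suc i)) has_vector_derivative (s - t) ^ i / fact i) (at s within {t..X})"
      by (simp add: has_real_derivative_iff_has_vector_derivative)
  qed (use assms in auto)
  then show ?thesis by simp
qed

lemma ppow_has_integral:
  assumes "0 \<le> t"
  shows "((\<lambda>s. ppow i (s - t)) has_integral ppow (Suc i) (X - t)) {0..X}"
proof (cases "X < t")
  case True
  have "((\<lambda>s. ppow i (s - t)) has_integral 0) {0..X}"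
    using True by (intro has_integral_is_0) (auto simp: ppow_def)
  then show ?thesis using True by (simp add: ppow_def)
next
  case False
  have "((\<lambda>s. if s \<in> {t..X} then (s - t) ^ i / fact i else 0) has_integral
     (X - t) ^ Suc i / fact (Suc i)) {0..X}"
    using False assms by (subst has_integral_restrict) (auto intro!: ppow_integral_shift simp del: fact_Suc power_Suc)
  then have "((\<lambda>s. ppow i (s - t)) has_integral (X - t) ^ Suc i / fact (Suc i)) {0..X}"
    by (rule has_integral_eq[rotated]) (auto simp: ppow_def)
  then show ?thesis using False by (simp add: ppow_def)
qed

lemma ppow_integral_offset:
  assumes "0 \<le> C" "0 \<le> X"
  shows "((\<lambda>s. ppow i (s + C)) has_integral (ppow (Suc i) (X + C) - ppow (Suc i) C)) {0..X}"
proof -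
  have "((\<lambda>s. (s + C) ^ i / fact i) has_integral
     ((X + C) ^ Suc i / fact (Suc i) - (0 + C) ^ Suc i / fact (Suc i))) {0..X}"
  proof (rule fundamental_theorem_of_calculus)
    fix s assume "s \<in> {0..X}"
    have "((\<lambda>s. (s + C) ^ Suc i / fact (Suc i)) has_real_derivative (s + C) ^ i / fact i) (at s within {0..X})"
      by (rule derivative_eq_intros refl | simp add: field_simps del: of_nat_Suc)+
    then show "((\<lambda>s. (s + C) ^ Suc i / fact (Suc i)) has_vector_derivative (s + C) ^ i / fact i) (at s within {0..X})"
      by (simp add: has_real_derivative_iff_has_vector_derivative)
  qed (use assms in auto)
  then have "((\<lambda>s. ppow i (s + C)) has_integral
     ((X + C) ^ Suc i / fact (Suc i) - (0 + C) ^ Suc i / fact (Suc i))) {0..X}"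
    by (rule has_integral_eq[rotated]) (use assms in \<open>auto simp: ppow_def\<close>)
  then show ?thesis using assms by (simp add: ppow_def)
qed

lemma ppow_sum_integral:
  assumes "finite V" "\<And>v. v \<in> V \<Longrightarrow> 0 \<le> t v"
  shows "((\<lambda>s. \<Sum>v\<in>V. a v * ppow i (s - t v)) has_integral (\<Sum>v\<in>V. a v * ppow (Suc i) (X - t v))) {0..X}"
  using assms by (intro has_integral_sum has_integral_mult_right ppow_has_integral) auto

text \<open>Integrate the inequality in \<open>s\<close> from 0, \<open>i\<close> times. Each
  integration raises every index on both sides by one, so a bound for a counting sum becomes one for
  the sum weighted by powers of logarithms.\<close>

lemma ppow_sum_lower:
  assumes "finite V" "\<And>v. v \<in> V \<Longrightarrow> 0 \<le> t v"
    and "\<And>s. 0 \<le> s \<Longrightarrow> s \<le> X \<Longrightarrow> c * ppow j s \<le> (\<Sum>v\<in>V. a v * ppow 0 (s - t v))"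
    and "0 \<le> s" "s \<le> X"
  shows "c * ppow (j + i) s \<le> (\<Sum>v\<in>V. a v * ppow i (s - t v))"
  using assms(4,5)
proof (induction i arbitrary: s)
  case 0 then show ?case using assms(3) by simp
next
  case (Suc i)
  have "((\<lambda>u. c * ppow (j + i) (u - 0)) has_integral c * ppow (Suc (j + i)) (s - 0)) {0..s}"
    by (intro has_integral_mult_right ppow_has_integral) auto
  moreover have "((\<lambda>s. \<Sum>v\<in>V. a v * ppow i (s - t v)) has_integral (\<Sum>v\<in>V. a v * ppow (Suc i) (s - t v))) {0..s}"
    using assms(1,2) by (rule ppow_sum_integral)
  ultimately have "c * ppow (Suc (j + i)) (s - 0) \<le> (\<Sum>v\<in>V. a v * ppow (Suc i) (s - t v))"
    by (rule has_integral_le) (use Suc in auto)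
  then show ?case by simp
qed

text \<open>Same integration; the offset \<open>C\<close> produces a boundary term at 0, which has
  the favourable sign and is dropped.\<close>

lemma ppow_sum_upper:
  assumes "finite V" "\<And>v. v \<in> V \<Longrightarrow> 0 \<le> t v" "0 \<le> C" "0 \<le> c"
    and "\<And>s. 0 \<le> s \<Longrightarrow> s \<le> X \<Longrightarrow> (\<Sum>v\<in>V. a v * ppow 0 (s - t v)) \<le> c * ppow j (s + C)"
    and "0 \<le> s" "s \<le> X"
  shows "(\<Sum>v\<in>V. a v * ppow i (s - t v)) \<le> c * ppow (j + i) (s + C)"
  using assms(6,7)
proof (induction i arbitrary: s)
  case 0 then show ?case using assms(5) by simp
next
  case (Suc i)
  have "((\<lambda>u. c * ppow (j + i) (u + C)) has_integral c * (ppow (Suc (j + i)) (s + C) - ppow (Suc (j + i)) C)) {0..s}"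
    using assms Suc by (intro has_integral_mult_right ppow_integral_offset) auto
  moreover have "((\<lambda>s. \<Sum>v\<in>V. a v * ppow i (s - t v)) has_integral (\<Sum>v\<in>V. a v * ppow (Suc i) (s - t v))) {0..s}"
    using assms(1,2) by (rule ppow_sum_integral)
  ultimately have "(\<Sum>v\<in>V. a v * ppow (Suc i) (s - t v)) \<le> c * (ppow (Suc (j + i)) (s + C) - ppow (Suc (j + i)) C)"
    by (elim has_integral_le) (use Suc in auto)
  also have "\<dots> \<le> c * ppow (Suc (j + i)) (s + C)" using assms(4) by (intro mult_left_mono) auto
  finally show ?case by simp
qed

lemma rsets_ppow_0:
  assumes "0 \<le> s" "s \<le> ln x" "1 \<le> x"
  shows "(\<Sum>A\<in>{A \<in> rsets z x. Q A}. a A * ppow 0 (s - ln (real (\<Prod>A)))) = (\<Sum>A\<in>{A \<in> rsets z (exp s). Q A}. a A)"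
proof -
  have x: "exp s \<le> x" using assms by (metis exp_le_cancel_iff exp_ln less_le_trans zero_less_one)
  have le: "ln (real (\<Prod>A)) \<le> s \<longleftrightarrow> real (\<Prod>A) \<le> exp s" if "A \<in> rsets z x" for A
    using rsetsD(4)[OF that] by (metis exp_le_cancel_iff exp_ln less_le_trans of_nat_0_less_iff zero_less_one)
  have "(\<Sum>A\<in>{A \<in> rsets z x. Q A}. a A * ppow 0 (s - ln (real (\<Prod>A)))) =
     (\<Sum>A\<in>{A \<in> rsets z x. Q A}. if real (\<Prod>A) \<le> exp s then a A else 0)"
    by (intro sum.cong) (auto simp: ppow_def not_less le[symmetric])
  also have "\<dots> = (\<Sum>A\<in>{A \<in> {A \<in> rsets z x. Q A}. real (\<Prod>A) \<le> exp s}. a A)"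
    by (rule sum.inter_filter[symmetric]) auto
  also have "{A \<in> {A \<in> rsets z x. Q A}. real (\<Prod>A) \<le> exp s} = {A \<in> rsets z (exp s). Q A}"
    using x by (auto simp: rsets_def)
  finally show ?thesis .
qed

text \<open>An empty product of zeros is 1, so the weight is the indicator of the empty set. This is
  dimension 0, the base of the inductions below.\<close>

lemma rsets_sum_prod_zero:
  assumes "1 \<le> x"
  shows "(\<Sum>A\<in>rsets z x. (\<Prod>p\<in>A. 0) * F A) = (F {} :: real)"
proof -
  have "(\<Sum>A\<in>rsets z x. (\<Prod>p\<in>A. 0) * F A) = (\<Sum>A\<in>rsets z x. if A = {} then F A else 0)"
    by (intro sum.cong) (auto dest: rsetsD(1))
  then show ?thesis using assms by (simp)
qed

lemma ln_rsets: "A \<in> rsets z x \<Longrightarrow> 0 \<le> ln (real (\<Prod>A))" "A \<in> rsets z x \<Longrightarrow> ln (real (\<Prod>A)) \<le> ln x"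
  using rsetsD(3,4)[of A z x] by auto

lemma rsets_lower:
  assumes "1 \<le> x" "\<And>y. 1 \<le> y \<Longrightarrow> y \<le> x \<Longrightarrow> c * ppow j (ln y) \<le> (\<Sum>A\<in>{A \<in> rsets z y. Q A}. a A)"
  shows "c * ppow (j + i) (ln x) \<le> (\<Sum>A\<in>{A \<in> rsets z x. Q A}. a A * ppow i (ln x - ln (real (\<Prod>A))))"
proof (rule ppow_sum_lower[where X = "ln x"])
  fix s assume s: "0 \<le> s" "s \<le> ln x"
  have "exp s \<le> x" using s assms(1) by (metis exp_le_cancel_iff exp_ln less_le_trans zero_less_one)
  then show "c * ppow j s \<le> (\<Sum>A\<in>{A \<in> rsets z x. Q A}. a A * ppow 0 (s - ln (real (\<Prod>A))))"
    using assms(2)[of "exp s"] s assms(1) by (simp add: rsets_ppow_0)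
qed (use assms ln_rsets in auto)

lemma rsets_upper:
  assumes "1 \<le> x" "0 \<le> C" "0 \<le> c"
    "\<And>y. 1 \<le> y \<Longrightarrow> y \<le> x \<Longrightarrow> (\<Sum>A\<in>rsets z y. a A) \<le> c * ppow j (ln y + C)"
  shows "(\<Sum>A\<in>rsets z x. a A * ppow i (ln x - ln (real (\<Prod>A)))) \<le> c * ppow (j + i) (ln x + C)"
proof (rule ppow_sum_upper[where X = "ln x"])
  fix s assume s: "0 \<le> s" "s \<le> ln x"
  have "exp s \<le> x" using s assms(1) by (metis exp_le_cancel_iff exp_ln less_le_trans zero_less_one)
  then show "(\<Sum>A\<in>rsets z x. a A * ppow 0 (s - ln (real (\<Prod>A)))) \<le> c * ppow j (s + C)"
    using assms(4)[of "exp s"] s assms(1) rsets_ppow_0[where z = z and x = x and s = s and a = a and Q = "\<lambda>_. True"] by simp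
qed (use assms ln_rsets in auto)

section \<open>Sums of higher dimension by repeated convolution\<close>

lemma ln_quotient_rsets:
  assumes "B \<in> rsets z x"
  shows "1 \<le> x / real (\<Prod>B)" "ln (x / real (\<Prod>B)) = ln x - ln (real (\<Prod>B))"
  using rsetsD(3-5)[OF assms] by (auto simp: ln_div)

text \<open>\<open>ppow j\<close> is increasing, so its integral over an interval of length
  \<open>C\<close> starting at \<open>Y\<close> is at least \<open>C * ppow j Y\<close>. It absorbs
  an additive error into a shift of the argument.\<close>

lemma ppow_Suc_ge:
  assumes "0 \<le> C" "0 \<le> Y"
  shows "ppow (Suc j) Y + C * ppow j Y \<le> ppow (Suc j) (Y + C)"
proof -
  have "((\<lambda>s. ppow j (s + Y)) has_integral (ppow (Suc j) (C + Y) - ppow (Suc j) Y)) {0..C}"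
    using assms by (intro ppow_integral_offset) auto
  moreover have "((\<lambda>s. ppow j Y) has_integral C * ppow j Y) {0..C}"
    using has_integral_const_real[of "ppow j Y" 0 C] assms by simp
  ultimately have "C * ppow j Y \<le> ppow (Suc j) (C + Y) - ppow (Suc j) Y"
    by (elim has_integral_le) (auto intro: ppow_mono)
  then show ?thesis by (simp add: add.commute)
qed

text \<open>Expanding (j + 1) u = j u + u over the primes of \<open>A\<close> makes the left side a
  convolution of the j-dimensional with the one-dimensional sum. For an upper bound disjointness of
  the two parts may be dropped, and each convolution adds one \<open>C\<close> to the shift.\<close>

lemma rsets_power_sum_le:
  fixes u :: "nat \<Rightarrow> real"
  assumes u: "\<And>p. p \<in> rough z \<Longrightarrow> 0 \<le> u p" and "0 \<le> K" "0 \<le> C"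
    and base: "\<And>x. 1 \<le> x \<Longrightarrow> (\<Sum>A\<in>rsets z x. \<Prod>p\<in>A. u p) \<le> K * (ln x + C)"
    and x: "1 \<le> x"
  shows "(\<Sum>A\<in>rsets z x. \<Prod>p\<in>A. real j * u p) \<le> K ^ j * ppow j (ln x + real j * C)"
  using x
proof (induction j arbitrary: x)
  case 0
  then show ?case using rsets_sum_prod_zero[where x = x and z = z and F = "\<lambda>_. 1"] by (simp add: ppow_def)
next
  case (Suc j)
  let ?c = "\<lambda>A. \<Prod>p\<in>A. real j * u p"
  let ?Y = "ln x + real j * C"
  have nn: "0 \<le> (\<Prod>p\<in>B. a * u p)" if "B \<in> rsets z y" "0 \<le> a" for B y a
    using rsetsD(2)[OF that(1)] u that(2) by (intro prod_nonneg) auto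
  have "(\<Sum>A\<in>rsets z x. \<Prod>p\<in>A. real (Suc j) * u p) = (\<Sum>A\<in>rsets z x. \<Sum>B\<in>Pow A. ?c B * (\<Prod>p\<in>A - B. u p))"
  proof (rule sum.cong)
    fix A assume "A \<in> rsets z x"
    then show "(\<Prod>p\<in>A. real (Suc j) * u p) = (\<Sum>B\<in>Pow A. ?c B * (\<Prod>p\<in>A - B. u p))"
      using prod_add[of A "\<lambda>p. real j * u p" u] rsetsD(1)[of A z x] by (simp add: algebra_simps)
  qed auto
  also have "\<dots> = (\<Sum>B\<in>rsets z x. \<Sum>D\<in>{D \<in> rsets z (x / real (\<Prod>B)). D \<inter> B = {}}. ?c B * (\<Prod>p\<in>D. u p))"
    by (rule rsets_split)
  also have "\<dots> \<le> (\<Sum>B\<in>rsets z x. ?c B * (K * (ln x - ln (real (\<Prod>B)) + C)))"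
  proof (rule sum_mono)
    fix B assume B: "B \<in> rsets z x"
    have "(\<Sum>D\<in>{D \<in> rsets z (x / real (\<Prod>B)). D \<inter> B = {}}. \<Prod>p\<in>D. u p) \<le> (\<Sum>D\<in>rsets z (x / real (\<Prod>B)). \<Prod>p\<in>D. u p)"
      using nn[of _ _ 1] by (intro sum_mono2) auto
    also have "\<dots> \<le> K * (ln x - ln (real (\<Prod>B)) + C)"
      using base[of "x / real (\<Prod>B)"] ln_quotient_rsets[OF B] by simp
    finally show "(\<Sum>D\<in>{D \<in> rsets z (x / real (\<Prod>B)). D \<inter> B = {}}. ?c B * (\<Prod>p\<in>D. u p)) \<le> ?c B * (K * (ln x - ln (real (\<Prod>B)) + C))"
      unfolding sum_distrib_left[symmetric] using nn[OF B, of "real j"] by (intro mult_left_mono) auto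
  qed
  \<comment> \<open>The logarithm of \<open>x / \<Prod>B\<close> is a \<open>ppow 1\<close>, so the
    first sum is the integrated induction hypothesis and the second the hypothesis itself.\<close>
  also have "\<dots> = K * ((\<Sum>B\<in>rsets z x. ?c B * ppow 1 (ln x - ln (real (\<Prod>B)))) + C * (\<Sum>B\<in>rsets z x. ?c B))"
    unfolding sum_distrib_left sum.distrib[symmetric]
    by (intro sum.cong) (auto simp: ppow_def algebra_simps dest!: ln_rsets(2))
  also have "\<dots> \<le> K * (K ^ j * ppow (j + 1) ?Y + C * (K ^ j * ppow j ?Y))"
  proof (intro mult_left_mono add_mono)
    show "(\<Sum>B\<in>rsets z x. ?c B * ppow 1 (ln x - ln (real (\<Prod>B)))) \<le> K ^ j * ppow (j + 1) ?Y"
      using assms Suc by (intro rsets_upper) auto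
    show "(\<Sum>B\<in>rsets z x. ?c B) \<le> K ^ j * ppow j ?Y" using Suc by auto
  qed (use assms in auto)
  also have "\<dots> = K ^ Suc j * (ppow (Suc j) ?Y + C * ppow j ?Y)" by (simp add: algebra_simps)
  also have "\<dots> \<le> K ^ Suc j * ppow (Suc j) (?Y + C)"
    using assms Suc by (intro mult_left_mono ppow_Suc_ge) auto
  finally show ?case by (simp add: algebra_simps)
qed

lemma rough_sum_ppow_ge:
  assumes C: "finite C" "C \<subseteq> rough z" and x: "1 \<le> x"
  shows "rdensity z * (\<Prod>p\<in>C. 1 - 1 / real p) * ppow (Suc m) (ln x)
    \<le> (\<Sum>D\<in>{D \<in> rsets z x. D \<inter> C = {}}. (\<Prod>p\<in>D. 1 / (real p - 1)) * ppow m (ln x - ln (real (\<Prod>D))))"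
proof -
  have "rdensity z * (\<Prod>p\<in>C. 1 - 1 / real p) * ppow (1 + m) (ln x)
    \<le> (\<Sum>D\<in>{D \<in> rsets z x. D \<inter> C = {}}. (\<Prod>p\<in>D. 1 / (real p - 1)) * ppow m (ln x - ln (real (\<Prod>D))))"
    using rough_sum_ge[OF C] x by (intro rsets_lower) (auto simp: ppow_def)
  then show ?thesis by simp
qed

text \<open>The denominators \<open>p - j - 1\<close> are the ones that occur in the sieve, and with them the induction on \<open>j\<close>
  loses nothing: coprimality costs a factor \<open>1 - 1/p\<close> at each \<open>p\<close>, and
  \<open>(1 - 1/p) / (p - j - 2) \<ge> 1 / (p - j - 1)\<close>.\<close>

lemma rsets_power_sum_ge:
  assumes "j < z" "1 \<le> x"
  shows "rdensity z ^ j * ppow (m + j) (ln x) \<le>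
    (\<Sum>A\<in>rsets z x. (\<Prod>p\<in>A. real j / (real p - real j - 1)) * ppow m (ln x - ln (real (\<Prod>A))))"
  using assms
proof (induction j arbitrary: m)
  case 0
  then show ?case using rsets_sum_prod_zero[where x = x and z = z and F = "\<lambda>A. ppow m (ln x - ln (real (\<Prod>A)))"] by simp
next
  case (Suc j)
  let ?a = "\<lambda>B. \<Prod>p\<in>B. real j / (real p - real j - 2)"
  let ?b = "\<lambda>D. \<Prod>p\<in>D. 1 / (real p - real j - 2)"
  have big: "real p - real j - 2 > 0" if "p \<in> rough z" for p
    using rough_gt[OF that] Suc.prems(1) by linarith
  have "rdensity z ^ Suc j * ppow (m + Suc j) (ln x) = rdensity z * (rdensity z ^ j * ppow (Suc m + j) (ln x))"
    by simp
  \<comment> \<open>The hypothesis is used with index \<open>Suc m\<close>; the additional power of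
    the logarithm is then traded for a sum over the new variable \<open>D\<close>.\<close>
  also have "\<dots> \<le> rdensity z * (\<Sum>A\<in>rsets z x. (\<Prod>p\<in>A. real j / (real p - real j - 1)) * ppow (Suc m) (ln x - ln (real (\<Prod>A))))"
    using Suc rdensity_pos[of z] by (intro mult_left_mono Suc.IH) auto
  also have "\<dots> = (\<Sum>A\<in>rsets z x. (\<Prod>p\<in>A. real j / (real p - real j - 1)) * (rdensity z * ppow (Suc m) (ln x - ln (real (\<Prod>A)))))"
    by (simp add: sum_distrib_left algebra_simps)
  also have "\<dots> \<le> (\<Sum>B\<in>rsets z x. ?a B * (rdensity z * (\<Prod>p\<in>B. 1 - 1 / real p) * ppow (Suc m) (ln x - ln (real (\<Prod>B)))))"
  proof (rule sum_mono)
    fix B assume B: "B \<in> rsets z x"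
    have "(\<Prod>p\<in>B. real j / (real p - real j - 1)) \<le> (\<Prod>p\<in>B. real j / (real p - real j - 2) * (1 - 1 / real p))"
    proof (rule prod_mono)
      fix p assume "p \<in> B"
      then have p: "real p - real j - 2 > 0" using big rsetsD(2)[OF B] by auto
      define P J where "P = real p" and "J = real j"
      have *: "P - J - 2 > 0" "J \<ge> 0" using p by (auto simp: P_def J_def)
      have "1 / (P - J - 1) \<le> (P - 1) / ((P - J - 2) * P)"
        using * by (simp add: divide_simps) (simp add: algebra_simps)
      then have "J * (1 / (P - J - 1)) \<le> J * ((P - 1) / ((P - J - 2) * P))"
        using * by (intro mult_left_mono) auto
      also have "\<dots> = J / (P - J - 2) * (1 - 1 / P)" using * by (simp add: field_simps)
      finally show "0 \<le> real j / (real p - real j - 1) \<and>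
         real j / (real p - real j - 1) \<le> real j / (real p - real j - 2) * (1 - 1 / real p)"
        using p by (simp add: P_def J_def)
    qed
    then have "(\<Prod>p\<in>B. real j / (real p - real j - 1)) \<le> ?a B * (\<Prod>p\<in>B. 1 - 1 / real p)"
      by (simp only: prod.distrib)
    from mult_right_mono[OF this, of "rdensity z * ppow (Suc m) (ln x - ln (real (\<Prod>B)))"]
    show "(\<Prod>p\<in>B. real j / (real p - real j - 1)) * (rdensity z * ppow (Suc m) (ln x - ln (real (\<Prod>B)))) \<le>
       ?a B * (rdensity z * (\<Prod>p\<in>B. 1 - 1 / real p) * ppow (Suc m) (ln x - ln (real (\<Prod>B))))"
      using rdensity_pos[of z] by (simp add: mult.assoc mult.left_commute)
  qed
  \<comment> \<open>The bracket is exactly the lower bound of \<open>rough_sum_ppow_ge\<close> for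
    sums over \<open>D\<close> disjoint from \<open>B\<close>. Weakening 1/(p - 1) to 1/(p - j - 2)
    gives both parts the same denominator, so that they add up to (j + 1)/(p - j - 2).\<close>
  also have "\<dots> \<le> (\<Sum>B\<in>rsets z x. ?a B * (\<Sum>D\<in>{D \<in> rsets z (x / real (\<Prod>B)). D \<inter> B = {}}.
        ?b D * ppow m (ln x - ln (real (\<Prod>B)) - ln (real (\<Prod>D)))))"
  proof (intro sum_mono mult_left_mono)
    fix B assume B: "B \<in> rsets z x"
    show "0 \<le> ?a B" using big rsetsD(2)[OF B] by (intro prod_nonneg) (force simp: less_imp_le)
    have "rdensity z * (\<Prod>p\<in>B. 1 - 1 / real p) * ppow (Suc m) (ln x - ln (real (\<Prod>B))) \<le>
       (\<Sum>D\<in>{D \<in> rsets z (x / real (\<Prod>B)). D \<inter> B = {}}. (\<Prod>p\<in>D. 1 / (real p - 1)) * ppow m (ln x - ln (real (\<Prod>B)) - ln (real (\<Prod>D))))"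
      using rough_sum_ppow_ge[OF rsetsD(1,2)[OF B] ln_quotient_rsets(1)[OF B], of m] ln_quotient_rsets(2)[OF B] by simp
    also have "\<dots> \<le> (\<Sum>D\<in>{D \<in> rsets z (x / real (\<Prod>B)). D \<inter> B = {}}.
        ?b D * ppow m (ln x - ln (real (\<Prod>B)) - ln (real (\<Prod>D))))"
    proof (intro sum_mono mult_right_mono prod_mono)
      fix D p assume "D \<in> {D \<in> rsets z (x / real (\<Prod>B)). D \<inter> B = {}}" "p \<in> D"
      then have "real p - real j - 2 > 0" using big rsetsD(2)[of D] by auto
      then show "0 \<le> 1 / (real p - 1) \<and> 1 / (real p - 1) \<le> 1 / (real p - real j - 2)"
        by (auto intro!: divide_left_mono)
    qed auto
    finally show "rdensity z * (\<Prod>p\<in>B. 1 - 1 / real p) * ppow (Suc m) (ln x - ln (real (\<Prod>B))) \<le> \<dots>" .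
  qed
  also have "\<dots> = (\<Sum>A\<in>rsets z x. \<Sum>B\<in>Pow A. ?a B * (?b (A - B) * ppow m (ln x - ln (real (\<Prod>B)) - ln (real (\<Prod>(A - B))))))"
    by (subst rsets_split) (simp add: sum_distrib_left)
  also have "\<dots> = (\<Sum>A\<in>rsets z x. (\<Prod>p\<in>A. real (Suc j) / (real p - real (Suc j) - 1)) * ppow m (ln x - ln (real (\<Prod>A))))"
  proof (rule sum.cong)
    fix A assume A: "A \<in> rsets z x"
    have "ln (real (\<Prod>B)) + ln (real (\<Prod>(A - B))) = ln (real (\<Prod>A))" if "B \<subseteq> A" for B
    proof -
      have "B \<in> rsets z x" "A - B \<in> rsets z x" using rsets_subset[OF A] that by auto
      then have "real (\<Prod>B) > 0" "real (\<Prod>(A - B)) > 0" using rsetsD(4) by force+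
      moreover have "\<Prod>A = \<Prod>B * \<Prod>(A - B)"
        using prod.subset_diff[OF that rsetsD(1)[OF A], of "\<lambda>x. x"] by simp
      ultimately show ?thesis by (simp add: ln_mult)
    qed
    then have "(\<Sum>B\<in>Pow A. ?a B * (?b (A - B) * ppow m (ln x - ln (real (\<Prod>B)) - ln (real (\<Prod>(A - B)))))) =
       (\<Sum>B\<in>Pow A. ?a B * ?b (A - B)) * ppow m (ln x - ln (real (\<Prod>A)))"
      unfolding sum_distrib_right by (intro sum.cong) (auto simp: diff_diff_eq mult.assoc)
    also have "(\<Sum>B\<in>Pow A. ?a B * ?b (A - B)) = (\<Prod>p\<in>A. real j / (real p - real j - 2) + 1 / (real p - real j - 2))"
      by (rule prod_add[OF rsetsD(1)[OF A], symmetric])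
    also have "\<dots> = (\<Prod>p\<in>A. real (Suc j) / (real p - real (Suc j) - 1))"
      by (intro prod.cong) (auto simp: add_divide_distrib[symmetric] algebra_simps)
    finally show "(\<Sum>B\<in>Pow A. ?a B * (?b (A - B) * ppow m (ln x - ln (real (\<Prod>B)) - ln (real (\<Prod>(A - B)))))) =
       (\<Prod>p\<in>A. real (Suc j) / (real p - real (Suc j) - 1)) * ppow m (ln x - ln (real (\<Prod>A)))" .
  qed auto
  finally show ?case .
qed

section \<open>Selberg diagonalisation\<close>

lemma sum_inverse_squares_le:
  assumes "1 \<le> z" "z \<le> M"
  shows "(\<Sum>n\<in>{z<..M}. 1 / (real n)\<^sup>2) \<le> 1 / real z - 1 / real M"
  using assms(2)
proof (induction M rule: dec_induct)
  case base then show ?case by simp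
next
  case (step M)
  have M: "real M > 0" using step assms by simp
  have "{z<..Suc M} = insert (Suc M) {z<..M}" using step by auto
  then have "(\<Sum>n\<in>{z<..Suc M}. 1 / (real n)\<^sup>2) = 1 / (real (Suc M))\<^sup>2 + (\<Sum>n\<in>{z<..M}. 1 / (real n)\<^sup>2)"
    by simp
  moreover have "1 / (real (Suc M))\<^sup>2 \<le> 1 / real M - 1 / real (Suc M)"
    using M by (simp add: divide_simps power2_eq_square)
  ultimately show ?case using step by linarith
qed

text \<open>The weight 1/(p - k) is 1/p plus a term of size k/p^2. Convolving with that perturbation
  costs at most the exponential of its sum over primes beyond \<open>z\<close>, which is the factor
  \<open>exp (2 * real k / real z)\<close> that tends to 1 with growing \<open>z\<close>.\<close>

lemma rsets_shifted_sum_le: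
  assumes k: "2 * k \<le> z" "1 \<le> z" and x: "1 \<le> x"
  shows "(\<Sum>A\<in>rsets z x. \<Prod>p\<in>A. 1 / (real p - real k)) \<le>
     exp (2 * real k / real z) * rdensity z * (ln x + (fact z + 1))"
proof -
  define h where "h = (\<lambda>p::nat. real k / (real p * (real p - real k)))"
  have big: "real p - real k > 0" "real p / 2 \<le> real p - real k" "real p > 0" if "p \<in> rough z" for p
    using rough_gt[OF that] k by linarith+
  have h0: "0 \<le> h p" if "p \<in> rough z" for p using big[OF that] by (simp add: h_def)
  have h_le: "h p \<le> 2 * real k * (1 / (real p)\<^sup>2)" if "p \<in> rough z" for p
  proof -
    have "h p \<le> real k / (real p * (real p / 2))"
      unfolding h_def using big[OF that] by (intro divide_left_mono mult_left_mono) auto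
    then show ?thesis by (simp add: power2_eq_square mult.commute)
  qed
  have nnh: "0 \<le> (\<Prod>p\<in>B. h p)" if "B \<subseteq> rough z" for B using that h0 by (intro prod_nonneg) auto
  \<comment> \<open>The added \<open>z\<close> keeps the upper end at least \<open>z\<close>, as the
    telescoping bound for inverse squares requires.\<close>
  define Z where "Z = {p \<in> rough z. p \<le> nat \<lfloor>x\<rfloor> + z}"
  have finZ: "finite Z" unfolding Z_def by auto
  have sub: "rsets z x \<subseteq> Pow Z"
  proof
    fix A assume A: "A \<in> rsets z x"
    have "p \<le> nat \<lfloor>x\<rfloor>" if "p \<in> A" for p
      using rsets_member_le[OF A that] by (simp add: le_nat_floor)
    then show "A \<in> Pow Z" using rsetsD(2)[OF A] by (force simp: Z_def)
  qed
  have "(\<Sum>B\<in>rsets z x. \<Prod>p\<in>B. h p) \<le> (\<Sum>B\<in>Pow Z. \<Prod>p\<in>B. h p)"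
    using finZ sub nnh by (intro sum_mono2) (auto simp: Z_def)
  also have "\<dots> = (\<Prod>p\<in>Z. h p + 1)"
    using prod_add[OF finZ, of h "\<lambda>_. 1"] by simp
  also have "\<dots> \<le> (\<Prod>p\<in>Z. exp (h p))"
    using h0 by (intro prod_mono) (auto simp: Z_def add.commute intro: exp_ge_add_one_self)
  also have "\<dots> = exp (\<Sum>p\<in>Z. h p)" using finZ by (simp add: exp_sum)
  also have "(\<Sum>p\<in>Z. h p) \<le> (\<Sum>p\<in>Z. 2 * real k * (1 / (real p)\<^sup>2))"
    using h_le by (intro sum_mono) (auto simp: Z_def)
  also have "\<dots> \<le> (\<Sum>n\<in>{z<..nat \<lfloor>x\<rfloor> + z}. 2 * real k * (1 / (real n)\<^sup>2))"
    by (intro sum_mono2) (auto simp: Z_def rough_def)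
  also have "\<dots> \<le> 2 * real k * (1 / real z)"
  proof -
    have "(\<Sum>n\<in>{z<..nat \<lfloor>x\<rfloor> + z}. 1 / (real n)\<^sup>2) \<le> 1 / real z - 1 / real (nat \<lfloor>x\<rfloor> + z)"
      using k by (intro sum_inverse_squares_le) auto
    also have "\<dots> \<le> 1 / real z" by simp
    finally show ?thesis unfolding sum_distrib_left[symmetric] by (intro mult_left_mono) auto
  qed
  finally have H: "(\<Sum>B\<in>rsets z x. \<Prod>p\<in>B. h p) \<le> exp (2 * real k / real z)" by simp
  have "(\<Sum>A\<in>rsets z x. \<Prod>p\<in>A. 1 / (real p - real k)) =
     (\<Sum>A\<in>rsets z x. \<Sum>B\<in>Pow A. (\<Prod>p\<in>B. h p) * (\<Prod>p\<in>A - B. 1 / real p))"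
  proof (rule sum.cong)
    fix A assume A: "A \<in> rsets z x"
    have "(\<Prod>p\<in>A. 1 / (real p - real k)) = (\<Prod>p\<in>A. h p + 1 / real p)"
    proof (rule prod.cong)
      fix p assume "p \<in> A"
      then have "real p - real k > 0" "real p > 0" using big rsetsD(2)[OF A] by auto
      then show "1 / (real p - real k) = h p + 1 / real p" by (simp add: h_def field_simps)
    qed auto
    then show "(\<Prod>p\<in>A. 1 / (real p - real k)) = (\<Sum>B\<in>Pow A. (\<Prod>p\<in>B. h p) * (\<Prod>p\<in>A - B. 1 / real p))"
      using prod_add[OF rsetsD(1)[OF A], of h "\<lambda>p. 1 / real p"] by simp
  qed auto
  also have "\<dots> = (\<Sum>B\<in>rsets z x. \<Sum>D\<in>{D \<in> rsets z (x / real (\<Prod>B)). D \<inter> B = {}}. (\<Prod>p\<in>B. h p) * (\<Prod>p\<in>D. 1 / real p))"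
    by (rule rsets_split)
  also have "\<dots> \<le> (\<Sum>B\<in>rsets z x. (\<Prod>p\<in>B. h p) * (\<Sum>D\<in>rsets z x. \<Prod>p\<in>D. 1 / real p))"
  proof (rule sum_mono)
    fix B assume B: "B \<in> rsets z x"
    have "x / real (\<Prod>B) \<le> x / 1" using rsetsD(4,5)[OF B] by (intro divide_left_mono) auto
    then have "rsets z (x / real (\<Prod>B)) \<subseteq> rsets z x" by (intro rsets_mono) simp
    then have "(\<Sum>D\<in>{D \<in> rsets z (x / real (\<Prod>B)). D \<inter> B = {}}. \<Prod>p\<in>D. 1 / real p) \<le> (\<Sum>D\<in>rsets z x. \<Prod>p\<in>D. 1 / real p)"
      by (intro sum_mono2) (auto intro: prod_nonneg)
    then show "(\<Sum>D\<in>{D \<in> rsets z (x / real (\<Prod>B)). D \<inter> B = {}}. (\<Prod>p\<in>B. h p) * (\<Prod>p\<in>D. 1 / real p)) \<le>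
       (\<Prod>p\<in>B. h p) * (\<Sum>D\<in>rsets z x. \<Prod>p\<in>D. 1 / real p)"
      unfolding sum_distrib_left[symmetric] using nnh rsetsD(2)[OF B] by (intro mult_left_mono) auto
  qed
  also have "\<dots> = (\<Sum>B\<in>rsets z x. \<Prod>p\<in>B. h p) * (\<Sum>D\<in>rsets z x. 1 / real (\<Prod>D))"
    by (simp add: sum_distrib_right prod_dividef of_nat_prod)
  also have "\<dots> \<le> exp (2 * real k / real z) * (rdensity z * (ln x + fact z + 1))"
    using H rsets_reciprocal_sum_le[OF x] by (intro mult_mono) (auto intro!: sum_nonneg)
  finally show ?thesis by (simp add: algebra_simps)
qed

text \<open>Selberg's inversion: the coefficients are prescribed through the variables \<open>y\<close> in which the
  quadratic form counting integers is diagonal.\<close>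

definition scoeff :: "nat \<Rightarrow> nat \<Rightarrow> real \<Rightarrow> (nat set \<Rightarrow> real) \<Rightarrow> nat set \<Rightarrow> real" where
  "scoeff z k R y A = (-1) ^ card A * (\<Prod>p\<in>A. real p / real k) *
     (\<Sum>B\<in>{B \<in> rsets z R. A \<subseteq> B}. (\<Prod>p\<in>B. real k / (real p - real k)) * y B)"

section \<open>Diagonal form for a general multiplicative density\<close>

lemma sum_interval_subsets:
  fixes f :: "'a \<Rightarrow> real"
  assumes "finite B" "C \<subseteq> B"
  shows "(\<Sum>A\<in>{A. C \<subseteq> A \<and> A \<subseteq> B}. \<Prod>p\<in>A. - f p) = (-1) ^ card C * (\<Prod>p\<in>C. f p) * (\<Prod>p\<in>B - C. 1 - f p)"
proof -
  have fin: "finite C" "finite (B - C)" using assms finite_subset by auto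
  have "(\<Sum>A\<in>{A. C \<subseteq> A \<and> A \<subseteq> B}. \<Prod>p\<in>A. - f p) = (\<Sum>D\<in>Pow (B - C). (\<Prod>p\<in>C. - f p) * (\<Prod>p\<in>D. - f p))"
  proof (rule sum.reindex_bij_witness[where i = "\<lambda>D. C \<union> D" and j = "\<lambda>A. A - C"], goal_cases)
    case (5 A)
    then have "finite A" "C \<subseteq> A" using assms finite_subset by auto
    then show ?case using prod.subset_diff[of C A "\<lambda>p. - f p"] by (simp add: mult.commute)
  qed (use assms in auto)
  also have "\<dots> = (\<Prod>p\<in>C. - f p) * (\<Prod>p\<in>B - C. 1 - f p)"
    using prod_add[OF fin(2), of "\<lambda>p. - f p" "\<lambda>_. 1"] by (simp add: sum_distrib_left)
  also have "(\<Prod>p\<in>C. - f p) = (-1) ^ card C * (\<Prod>p\<in>C. f p)"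
    using prod.distrib[of "\<lambda>_. -1" f C] by simp
  finally show ?thesis .
qed

text \<open>These are the linear forms that diagonalise the quadratic form with local density
  \<open>t\<close>. After exchanging sums, the alternating sum over \<open>A\<close> between
  \<open>C\<close> and \<open>B\<close> factorises; the local quantity t p / k compares
  \<open>t\<close> with the density k / p for which \<open>y\<close> was designed.\<close>

lemma scoeff_transform:
  assumes C: "C \<in> rsets z R"
  shows "(\<Sum>A\<in>{A \<in> rsets z R. C \<subseteq> A}. scoeff z k R y A * (\<Prod>p\<in>A. t p)) =
    (-1) ^ card C * (\<Sum>B\<in>{B \<in> rsets z R. C \<subseteq> B}. (\<Prod>p\<in>B. real k / (real p - real k)) * y B *
      (\<Prod>p\<in>C. t p * real p / real k) * (\<Prod>p\<in>B - C. 1 - t p * real p / real k))"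
proof -
  let ?g = "\<lambda>B. (\<Prod>p\<in>B. real k / (real p - real k)) * y B"
  let ?c = "\<lambda>p. t p * real p / real k"
  have "(\<Sum>A\<in>{A \<in> rsets z R. C \<subseteq> A}. scoeff z k R y A * (\<Prod>p\<in>A. t p)) =
    (\<Sum>A\<in>{A \<in> rsets z R. C \<subseteq> A}. \<Sum>B\<in>{B \<in> rsets z R. A \<subseteq> B}. (\<Prod>p\<in>A. - ?c p) * ?g B)"
  proof (rule sum.cong)
    fix A
    have "(\<Prod>p\<in>A. - ?c p) = (\<Prod>p\<in>A. -1) * (\<Prod>p\<in>A. real p / real k) * (\<Prod>p\<in>A. t p)"
      unfolding prod.distrib[symmetric] by (intro prod.cong) auto
    then show "scoeff z k R y A * (\<Prod>p\<in>A. t p) = (\<Sum>B\<in>{B \<in> rsets z R. A \<subseteq> B}. (\<Prod>p\<in>A. - ?c p) * ?g B)"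
      unfolding scoeff_def sum_distrib_left[symmetric] by simp
  qed auto
  also have "\<dots> = (\<Sum>(A, B)\<in>Sigma {A \<in> rsets z R. C \<subseteq> A} (\<lambda>A. {B \<in> rsets z R. A \<subseteq> B}). (\<Prod>p\<in>A. - ?c p) * ?g B)"
    by (subst sum.Sigma) auto
  also have "\<dots> = (\<Sum>(B, A)\<in>Sigma {B \<in> rsets z R. C \<subseteq> B} (\<lambda>B. {A. C \<subseteq> A \<and> A \<subseteq> B}). (\<Prod>p\<in>A. - ?c p) * ?g B)"
    by (rule sum.reindex_bij_witness[where i = "\<lambda>(A, B). (B, A)" and j = "\<lambda>(A, B). (B, A)"])
      (auto intro: rsets_subset)
  also have "\<dots> = (\<Sum>B\<in>{B \<in> rsets z R. C \<subseteq> B}. \<Sum>A\<in>{A. C \<subseteq> A \<and> A \<subseteq> B}. (\<Prod>p\<in>A. - ?c p) * ?g B)"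
    by (subst sum.Sigma) (auto dest: rsetsD(1) intro: finite_subset[OF _ finite_Pow_iff[THEN iffD2]])
  also have "\<dots> = (\<Sum>B\<in>{B \<in> rsets z R. C \<subseteq> B}. (-1) ^ card C * (\<Prod>p\<in>C. ?c p) * (\<Prod>p\<in>B - C. 1 - ?c p) * ?g B)"
    unfolding sum_distrib_right[symmetric] by (intro sum.cong) (auto simp: sum_interval_subsets dest: rsetsD(1))
  finally show ?thesis by (simp add: sum_distrib_left mult_ac)
qed

text \<open>Multiplicativity gives t(A \<union> B) = t(A) t(B) / t(A \<inter> B), and 1 / t(A
  \<inter> B) is the sum over C \<subseteq> A \<inter> B of the products of 1/t(p) - 1. Summing over
  \<open>A\<close> and \<open>B\<close> first leaves squares, with positive coefficients as soon as
  t < 1.\<close>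

lemma scoeff_quadratic_form:
  assumes t: "\<And>p. p \<in> rough z \<Longrightarrow> t p \<noteq> 0"
  shows "(\<Sum>A\<in>rsets z R. \<Sum>B\<in>rsets z R. scoeff z k R y A * scoeff z k R y B * (\<Prod>p\<in>A \<union> B. t p)) =
    (\<Sum>C\<in>rsets z R. (\<Prod>p\<in>C. 1 / t p - 1) *
      (\<Sum>B\<in>{B \<in> rsets z R. C \<subseteq> B}. (\<Prod>p\<in>B. real k / (real p - real k)) * y B *
        (\<Prod>p\<in>C. t p * real p / real k) * (\<Prod>p\<in>B - C. 1 - t p * real p / real k))\<^sup>2)"
proof -
  let ?l = "scoeff z k R y" and ?j = "\<lambda>C. \<Prod>p\<in>C. 1 / t p - 1" and ?t = "\<lambda>A. \<Prod>p\<in>A. t p"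
  have union: "?t (A \<union> B) = (\<Sum>C\<in>rsets z R. if C \<subseteq> A \<and> C \<subseteq> B then ?j C * ?t A * ?t B else 0)"
    if A: "A \<in> rsets z R" and B: "B \<in> rsets z R" for A B
  proof -
    have fin: "finite A" "finite B" using rsetsD A B by auto
    have nz: "?t (A \<inter> B) \<noteq> 0" using t rsetsD(2)[OF A] fin by (subst prod_zero_iff) auto
    have "?t (A \<union> B) * ?t (A \<inter> B) = ?t A * ?t B" using fin by (rule prod.union_inter)
    then have "?t (A \<union> B) = (1 / ?t (A \<inter> B)) * (?t A * ?t B)" using nz by (simp add: field_simps)
    also have "1 / ?t (A \<inter> B) = (\<Prod>p\<in>A \<inter> B. (1 / t p - 1) + 1)" by (simp add: prod_dividef)
    also have "\<dots> = (\<Sum>C\<in>Pow (A \<inter> B). ?j C)" using prod_add[of "A \<inter> B" "\<lambda>p. 1 / t p - 1" "\<lambda>_. 1"] fin by simp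
    also have "Pow (A \<inter> B) = {C \<in> rsets z R. C \<subseteq> A \<and> C \<subseteq> B}" using rsets_subset[OF A] by auto
    finally have "?t (A \<union> B) = (\<Sum>C\<in>{C \<in> rsets z R. C \<subseteq> A \<and> C \<subseteq> B}. ?j C * ?t A * ?t B)"
      by (simp add: sum_distrib_right mult.assoc)
    then show ?thesis by (simp add: sum.inter_filter)
  qed
  have "(\<Sum>A\<in>rsets z R. \<Sum>B\<in>rsets z R. ?l A * ?l B * ?t (A \<union> B)) =
     (\<Sum>A\<in>rsets z R. \<Sum>B\<in>rsets z R. \<Sum>C\<in>rsets z R. if C \<subseteq> A \<and> C \<subseteq> B then ?j C * (?l A * ?t A) * (?l B * ?t B) else 0)"
    by (intro sum.cong refl) (auto simp: union sum_distrib_left intro!: sum.cong)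
  also have "\<dots> = (\<Sum>A\<in>rsets z R. \<Sum>C\<in>rsets z R. \<Sum>B\<in>rsets z R. if C \<subseteq> A \<and> C \<subseteq> B then ?j C * (?l A * ?t A) * (?l B * ?t B) else 0)"
    by (intro sum.cong refl sum.swap)
  also have "\<dots> = (\<Sum>C\<in>rsets z R. \<Sum>A\<in>rsets z R. \<Sum>B\<in>rsets z R. if C \<subseteq> A \<and> C \<subseteq> B then ?j C * (?l A * ?t A) * (?l B * ?t B) else 0)"
    by (rule sum.swap)
  also have "\<dots> = (\<Sum>C\<in>rsets z R. ?j C * (\<Sum>A\<in>{A \<in> rsets z R. C \<subseteq> A}. ?l A * ?t A)\<^sup>2)"
  proof (intro sum.cong refl)
    fix C
    have "(\<Sum>A\<in>rsets z R. \<Sum>B\<in>rsets z R. if C \<subseteq> A \<and> C \<subseteq> B then ?j C * (?l A * ?t A) * (?l B * ?t B) else 0) =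
      (\<Sum>A\<in>rsets z R. \<Sum>B\<in>rsets z R. ?j C * ((if C \<subseteq> A then ?l A * ?t A else 0) * (if C \<subseteq> B then ?l B * ?t B else 0)))"
      by (intro sum.cong) auto
    also have "\<dots> = ?j C * (\<Sum>A\<in>rsets z R. if C \<subseteq> A then ?l A * ?t A else 0)\<^sup>2"
      by (simp add: sum_distrib_left[symmetric] sum_distrib_right[symmetric] power2_eq_square)
    finally show "(\<Sum>A\<in>rsets z R. \<Sum>B\<in>rsets z R. if C \<subseteq> A \<and> C \<subseteq> B then ?j C * (?l A * ?t A) * (?l B * ?t B) else 0) =
       ?j C * (\<Sum>A\<in>{A \<in> rsets z R. C \<subseteq> A}. ?l A * ?t A)\<^sup>2"
      by (simp add: sum.inter_filter)
  qed
  also have "\<dots> = (\<Sum>C\<in>rsets z R. ?j C * (\<Sum>B\<in>{B \<in> rsets z R. C \<subseteq> B}. (\<Prod>p\<in>B. real k / (real p - real k)) * y B *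
        (\<Prod>p\<in>C. t p * real p / real k) * (\<Prod>p\<in>B - C. 1 - t p * real p / real k))\<^sup>2)"
    by (intro sum.cong refl) (simp add: scoeff_transform power_mult_distrib flip: power_mult)
  finally show ?thesis .
qed

text \<open>For t = k/p each factor 1 - t p / k vanishes, so only B = C survives in the inner
  sum.\<close>

lemma scoeff_form_integers:
  assumes k: "1 \<le> k" "k \<le> z"
  shows "(\<Sum>A\<in>rsets z R. \<Sum>B\<in>rsets z R. scoeff z k R y A * scoeff z k R y B * (\<Prod>p\<in>A \<union> B. real k / real p)) =
    (\<Sum>C\<in>rsets z R. (\<Prod>p\<in>C. real k / (real p - real k)) * (y C)\<^sup>2)"
proof -
  have big: "real p - real k > 0" "real p > 0" if "p \<in> rough z" for p
    using rough_gt[OF that] k by linarith+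
  show ?thesis
  proof (subst scoeff_quadratic_form, goal_cases)
    case (1 p) then show ?case using big[of p] k by simp
  next
    case 2
    show ?case
    proof (rule sum.cong[OF refl])
      fix C assume C: "C \<in> rsets z R"
      let ?g = "\<lambda>B. \<Prod>p\<in>B. real k / (real p - real k)"
      have one: "real k / real p * real p / real k = 1" if "p \<in> rough z" for p using big[OF that] k by simp
      have "(\<Sum>B\<in>{B \<in> rsets z R. C \<subseteq> B}. ?g B * y B * (\<Prod>p\<in>C. real k / real p * real p / real k) *
           (\<Prod>p\<in>B - C. 1 - real k / real p * real p / real k)) =
         (\<Sum>B\<in>{B \<in> rsets z R. C \<subseteq> B}. if B = C then ?g B * y B else 0)"
      proof (rule sum.cong[OF refl])
        fix B assume B: "B \<in> {B \<in> rsets z R. C \<subseteq> B}"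
        have a: "(\<Prod>p\<in>C. real k / real p * real p / real k) = 1"
          using rsetsD(2)[OF C] one by (intro prod.neutral) blast
        have b: "(\<Prod>p\<in>B - C. 1 - real k / real p * real p / real k) = 0" if ne: "B \<noteq> C"
        proof -
          obtain q where "q \<in> B - C" using ne B by blast
          then show ?thesis using B one[of q] rsetsD(1,2)[of B z R] by (intro prod_zero bexI[of _ q]) auto
        qed
        show "?g B * y B * (\<Prod>p\<in>C. real k / real p * real p / real k) *
           (\<Prod>p\<in>B - C. 1 - real k / real p * real p / real k) = (if B = C then ?g B * y B else 0)"
        proof (cases "B = C")
          case True then show ?thesis unfolding a by simp
        next
          case False then show ?thesis using b by simp
        qed
      qed
      also have "\<dots> = ?g C * y C" using C by simp
      finally have *: "(\<Sum>B\<in>{B \<in> rsets z R. C \<subseteq> B}. ?g B * y B * (\<Prod>p\<in>C. real k / real p * real p / real k) *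
           (\<Prod>p\<in>B - C. 1 - real k / real p * real p / real k)) = ?g C * y C" .
      have "(\<Prod>p\<in>C. 1 / (real k / real p) - 1) * ?g C = 1"
        unfolding prod.distrib[symmetric]
      proof (intro prod.neutral ballI)
        fix p assume "p \<in> C"
        then have "real p - real k > 0" "real p > 0" using big rsetsD(2)[OF C] by auto
        then show "(1 / (real k / real p) - 1) * (real k / (real p - real k)) = 1"
          using k by (simp add: field_simps)
      qed
      then have "(\<Prod>p\<in>C. 1 / (real k / real p) - 1) * (?g C * y C)\<^sup>2 = ?g C * (y C)\<^sup>2"
        by (simp add: power2_eq_square)
      then show "(\<Prod>p\<in>C. 1 / (real k / real p) - 1) * (\<Sum>B\<in>{B \<in> rsets z R. C \<subseteq> B}. ?g B * y B * (\<Prod>p\<in>C. real k / real p * real p / real k) *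
           (\<Prod>p\<in>B - C. 1 - real k / real p * real p / real k))\<^sup>2 = ?g C * (y C)\<^sup>2"
        unfolding * .
    qed
  qed
qed

lemma rsets_superset_sum:
  fixes F :: "nat set \<Rightarrow> real"
  assumes C: "C \<in> rsets z x"
  shows "(\<Sum>B\<in>{B \<in> rsets z x. C \<subseteq> B}. F B) = (\<Sum>D\<in>{D \<in> rsets z (x / real (\<Prod>C)). D \<inter> C = {}}. F (C \<union> D))"
proof (rule sum.reindex_bij_witness[where i = "\<lambda>D. C \<union> D" and j = "\<lambda>B. B - C"], goal_cases)
  case (2 B)
  then have B: "B \<in> rsets z x" "C \<subseteq> B" by auto
  have D: "B - C \<in> rsets z x" using rsets_subset[OF B(1)] by auto
  have "\<Prod>B = \<Prod>(B - C) * \<Prod>C"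
    using prod.subset_diff[OF B(2) rsetsD(1)[OF B(1)], of "\<lambda>x. x"] by simp
  then have "real (\<Prod>(B - C)) * real (\<Prod>C) \<le> x"
    using rsetsD(3)[OF B(1)] by (metis of_nat_mult)
  then have "real (\<Prod>(B - C)) \<le> x / real (\<Prod>C)"
    using rsetsD(4)[OF C] by (simp add: field_simps)
  then show ?case using D by (auto simp: rsets_def)
next
  case (4 D)
  then have D: "D \<in> rsets z (x / real (\<Prod>C))" "D \<inter> C = {}" by auto
  have "D \<union> C \<in> rsets z (x / real (\<Prod>C) * real (\<Prod>C))"
    using C D rsetsD[OF C] by (intro rsets_disjoint_union(1)) (auto simp: rsets_def)
  moreover have "x / real (\<Prod>C) * real (\<Prod>C) = x" using rsetsD(4)[OF C] by simp
  ultimately show ?case by (auto simp: Un_commute)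
next
  case (5 B)
  then have "C \<union> (B - C) = B" by auto
  then show ?case by simp
qed auto

text \<open>Once \<open>n + h\<close> is prime, k - 1 of the p - 1 reduced classes are sieved,
  whence the density (k - 1)/(p - 1). Now supersets of \<open>C\<close> do contribute, with weight
  1/(p - 1) at each further prime: one more logarithmic summation, to be bounded below.\<close>

lemma scoeff_form_primes:
  assumes k: "2 \<le> k" "k \<le> z"
  shows "(\<Sum>A\<in>rsets z R. \<Sum>B\<in>rsets z R. scoeff z k R y A * scoeff z k R y B * (\<Prod>p\<in>A \<union> B. real (k - 1) / (real p - 1))) =
    (\<Sum>C\<in>rsets z R. (\<Prod>p\<in>C. (real k - 1) / (real p - real k)) *
      ((\<Prod>p\<in>C. real p / (real p - 1)) *
        (\<Sum>D\<in>{D \<in> rsets z (R / real (\<Prod>C)). D \<inter> C = {}}. (\<Prod>p\<in>D. 1 / (real p - 1)) * y (C \<union> D)))\<^sup>2)"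
proof -
  have big: "real p - real k > 0" "real p - 1 > 0" "real p > 0" if "p \<in> rough z" for p
    using rough_gt[OF that] k by linarith+
  have k1: "real (k - 1) = real k - 1" "real k - 1 > 0" using k by auto
  show ?thesis
  proof (subst scoeff_quadratic_form, goal_cases)
    case (1 p) then show ?case using big[of p] k1 by simp
  next
    case 2
    show ?case
    proof (rule sum.cong[OF refl])
      fix C assume C: "C \<in> rsets z R"
      let ?g = "\<lambda>B. \<Prod>p\<in>B. real k / (real p - real k)"
      let ?c = "\<lambda>p. real (k - 1) / (real p - 1) * real p / real k"
      let ?G = "\<lambda>C. \<Prod>p\<in>C. (real k - 1) / (real p - real k)"
      let ?r = "\<Prod>p\<in>C. real p / (real p - 1)"
      let ?S = "\<Sum>D\<in>{D \<in> rsets z (R / real (\<Prod>C)). D \<inter> C = {}}. (\<Prod>p\<in>D. 1 / (real p - 1)) * y (C \<union> D)"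
      have "(\<Sum>B\<in>{B \<in> rsets z R. C \<subseteq> B}. ?g B * y B * (\<Prod>p\<in>C. ?c p) * (\<Prod>p\<in>B - C. 1 - ?c p)) =
        (\<Sum>D\<in>{D \<in> rsets z (R / real (\<Prod>C)). D \<inter> C = {}}. ?G C * ?r * ((\<Prod>p\<in>D. 1 / (real p - 1)) * y (C \<union> D)))"
        unfolding rsets_superset_sum[OF C]
      proof (rule sum.cong[OF refl])
        fix D assume D: "D \<in> {D \<in> rsets z (R / real (\<Prod>C)). D \<inter> C = {}}"
        have d: "C \<union> D - C = D" using D by auto
        have g: "?g (C \<union> D) = ?g C * ?g D"
          using D rsetsD(1)[OF C] rsetsD(1)[of D] by (intro prod.union_disjoint) auto
        have 1: "?g C * (\<Prod>p\<in>C. ?c p) = ?G C * ?r"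
          unfolding prod.distrib[symmetric]
        proof (rule prod.cong[OF refl])
          fix p assume "p \<in> C"
          then have "real p - real k > 0" "real p - 1 > 0" using big rsetsD(2)[OF C] by auto
          then show "real k / (real p - real k) * ?c p = (real k - 1) / (real p - real k) * (real p / (real p - 1))"
            unfolding k1 using k by simp
        qed
        have 2: "?g D * (\<Prod>p\<in>D. 1 - ?c p) = (\<Prod>p\<in>D. 1 / (real p - 1))"
          unfolding prod.distrib[symmetric]
        proof (rule prod.cong[OF refl])
          fix p assume "p \<in> D"
          then have "p \<in> rough z" using D rsetsD(2)[of D z "R / real (\<Prod>C)"] by blast
          then have "real p - real k > 0" "real p - 1 > 0" using big by auto
          \<comment> \<open>The numerator cancels the denominator p - k of \<open>?g\<close>, which
            leaves the clean weight 1/(p - 1).\<close>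
          moreover have "1 - ?c p = (real p - real k) / (real k * (real p - 1))"
            using k1 k calculation by (simp add: field_simps)
          ultimately show "real k / (real p - real k) * (1 - ?c p) = 1 / (real p - 1)"
            using k by simp
        qed
        have "?g (C \<union> D) * y (C \<union> D) * (\<Prod>p\<in>C. ?c p) * (\<Prod>p\<in>C \<union> D - C. 1 - ?c p) =
          (?g C * (\<Prod>p\<in>C. ?c p)) * ((?g D * (\<Prod>p\<in>D. 1 - ?c p)) * y (C \<union> D))"
          unfolding d g by (simp only: mult_ac)
        then show "?g (C \<union> D) * y (C \<union> D) * (\<Prod>p\<in>C. ?c p) * (\<Prod>p\<in>C \<union> D - C. 1 - ?c p) =
          ?G C * ?r * ((\<Prod>p\<in>D. 1 / (real p - 1)) * y (C \<union> D))"
          unfolding 1 2 .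
      qed
      also have "\<dots> = ?G C * (?r * ?S)" by (simp add: sum_distrib_left mult.assoc)
      finally have *: "(\<Sum>B\<in>{B \<in> rsets z R. C \<subseteq> B}. ?g B * y B * (\<Prod>p\<in>C. ?c p) * (\<Prod>p\<in>B - C. 1 - ?c p)) = ?G C * (?r * ?S)" .
      have "(\<Prod>p\<in>C. 1 / (real (k - 1) / (real p - 1)) - 1) * ?G C = 1"
        unfolding prod.distrib[symmetric]
      proof (intro prod.neutral ballI)
        fix p assume "p \<in> C"
        then have "real p - real k > 0" "real p - 1 > 0" using big rsetsD(2)[OF C] by auto
        moreover have "1 / (real (k - 1) / (real p - 1)) - 1 = (real p - real k) / (real k - 1)"
          using k1 by (simp add: field_simps)
        ultimately show "(1 / (real (k - 1) / (real p - 1)) - 1) * ((real k - 1) / (real p - real k)) = 1"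
          using k1 by simp
      qed
      then have "(\<Prod>p\<in>C. 1 / (real (k - 1) / (real p - 1)) - 1) * (?G C * (?r * ?S))\<^sup>2 = ?G C * (?r * ?S)\<^sup>2"
        by (simp add: power2_eq_square)
      then show "(\<Prod>p\<in>C. 1 / (real (k - 1) / (real p - 1)) - 1) *
         (\<Sum>B\<in>{B \<in> rsets z R. C \<subseteq> B}. ?g B * y B * (\<Prod>p\<in>C. ?c p) * (\<Prod>p\<in>B - C. 1 - ?c p))\<^sup>2 = ?G C * (?r * ?S)\<^sup>2"
        unfolding * .
    qed
  qed
qed

section \<open>Evaluation of both forms for the linear weight\<close>

lemma ppow_small:
  assumes "0 \<le> l"
  shows "ppow 0 l = 1" "ppow 1 l = l" "ppow 2 l = l\<^sup>2 / 2" "ppow 3 l = l ^ 3 / 6" "ppow 4 l = l ^ 4 / 24"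
  using assms by (simp_all add: ppow_def fact_numeral)

lemma linear_weight_square:
  assumes "0 \<le> l"
  shows "(L + c * l)\<^sup>2 = L\<^sup>2 * ppow 0 l + 2 * c * L * ppow 1 l + 2 * c\<^sup>2 * ppow 2 l"
  unfolding ppow_small[OF assms] by (simp add: power2_eq_square algebra_simps)

text \<open>L l + c l^2 / 2 is the integral of the weight L + c l. Rewriting l^2, l^3, l^4 as
  divided powers produces the coefficients 2, 6, 6 of \<open>J\<close>.\<close>

lemma integrated_weight_square:
  assumes "0 \<le> l"
  shows "(d * (L * l + c * l\<^sup>2 / 2))\<^sup>2 = d\<^sup>2 * (2 * L\<^sup>2 * ppow 2 l + 6 * c * L * ppow 3 l + 6 * c\<^sup>2 * ppow 4 l)"
  unfolding ppow_small[OF assms] by (simp add: power2_eq_square power3_eq_cube power4_eq_xxxx field_simps)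

text \<open>A polynomial of degree one in ln(R/d) / ln R, multiplied by ln R to stay free of
  division.\<close>

definition sweight :: "real \<Rightarrow> real \<Rightarrow> nat set \<Rightarrow> real" where
  "sweight R c B = ln R + c * (ln R - ln (real (\<Prod>B)))"

text \<open>The three terms of the squared weight call for the k-dimensional sum integrated 0, 1 and
  2 times. The shift in \<open>X\<close> is the error accumulated over k convolutions.\<close>

lemma form_integers_le:
  assumes k: "1 \<le> k" "2 * k \<le> z" and c: "0 \<le> c" and R: "1 \<le> R"
  defines "X \<equiv> ln R + real k * (fact z + 1)"
  shows "(\<Sum>C\<in>rsets z R. (\<Prod>p\<in>C. real k / (real p - real k)) * (sweight R c C)\<^sup>2) \<le>
    (exp (2 * real k / real z) * rdensity z) ^ k *
      ((ln R)\<^sup>2 * ppow k X + 2 * c * ln R * ppow (k + 1) X + 2 * c\<^sup>2 * ppow (k + 2) X)"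
proof -
  let ?g = "\<lambda>C. \<Prod>p\<in>C. real k / (real p - real k)"
  let ?K = "exp (2 * real k / real z) * rdensity z"
  let ?l = "\<lambda>C. ln R - ln (real (\<Prod>C))"
  have big: "real p - real k > 0" if "p \<in> rough z" for p
    using rough_gt[OF that] k by linarith
  have base: "(\<Sum>A\<in>rsets z y. ?g A) \<le> ?K ^ k * ppow k (ln y + real k * (fact z + 1))" if "1 \<le> y" for y
  proof -
    have "(\<Sum>A\<in>rsets z y. \<Prod>p\<in>A. real k * (1 / (real p - real k))) \<le> ?K ^ k * ppow k (ln y + real k * (fact z + 1))"
    proof (rule rsets_power_sum_le)
      show "0 \<le> 1 / (real p - real k)" if "p \<in> rough z" for p using big[OF that] by simp
      show "(\<Sum>A\<in>rsets z x. \<Prod>p\<in>A. 1 / (real p - real k)) \<le> ?K * (ln x + (fact z + 1))" if "1 \<le> x" for x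
        using rsets_shifted_sum_le[of k z x] k that by (simp add: mult.assoc)
    qed (use that rdensity_pos[of z] in auto)
    then show ?thesis by simp
  qed
  have U: "(\<Sum>C\<in>rsets z R. ?g C * ppow i (?l C)) \<le> ?K ^ k * ppow (k + i) X" for i
    unfolding X_def using base R rdensity_pos[of z] by (intro rsets_upper) auto
  have "(\<Sum>C\<in>rsets z R. ?g C * (sweight R c C)\<^sup>2) =
     (\<Sum>C\<in>rsets z R. (ln R)\<^sup>2 * (?g C * ppow 0 (?l C)) + 2 * c * ln R * (?g C * ppow 1 (?l C)) + 2 * c\<^sup>2 * (?g C * ppow 2 (?l C)))"
  proof (rule sum.cong[OF refl])
    fix C assume C: "C \<in> rsets z R"
    have l: "0 \<le> ?l C" using ln_rsets(2)[OF C] by simp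
    have "(sweight R c C)\<^sup>2 = (ln R)\<^sup>2 * ppow 0 (?l C) + 2 * c * ln R * ppow 1 (?l C) + 2 * c\<^sup>2 * ppow 2 (?l C)"
      unfolding sweight_def using l by (rule linear_weight_square)
    then show "?g C * (sweight R c C)\<^sup>2 =
      (ln R)\<^sup>2 * (?g C * ppow 0 (?l C)) + 2 * c * ln R * (?g C * ppow 1 (?l C)) + 2 * c\<^sup>2 * (?g C * ppow 2 (?l C))"
      by (simp only: distrib_left mult_ac)
  qed
  also have "\<dots> = (ln R)\<^sup>2 * (\<Sum>C\<in>rsets z R. ?g C * ppow 0 (?l C)) +
      2 * c * ln R * (\<Sum>C\<in>rsets z R. ?g C * ppow 1 (?l C)) + 2 * c\<^sup>2 * (\<Sum>C\<in>rsets z R. ?g C * ppow 2 (?l C))"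
    by (simp only: sum.distrib sum_distrib_left)
  also have "\<dots> \<le> (ln R)\<^sup>2 * (?K ^ k * ppow (k + 0) X) + 2 * c * ln R * (?K ^ k * ppow (k + 1) X) + 2 * c\<^sup>2 * (?K ^ k * ppow (k + 2) X)"
    using c R by (intro add_mono mult_left_mono U) auto
  finally show ?thesis by (simp only: distrib_left mult_ac add_0_right)
qed

text \<open>The inner sum gives one factor \<open>rdensity z\<close> and, for disjointness from
  \<open>C\<close>, the product of 1 - 1/p, which exactly cancels the factors p/(p - 1) in front.
  Squaring gives \<open>rdensity z\<close> twice, and the outer sum of dimension k - 1 supplies the
  rest.\<close>

lemma form_primes_ge:
  assumes k: "2 \<le> k" "k \<le> z" and c: "0 \<le> c" and R: "1 \<le> R"
  shows "rdensity z ^ (k + 1) * (2 * (ln R)\<^sup>2 * ppow (k + 1) (ln R) + 6 * c * ln R * ppow (k + 2) (ln R) + 6 * c\<^sup>2 * ppow (k + 3) (ln R))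
    \<le> (\<Sum>C\<in>rsets z R. (\<Prod>p\<in>C. (real k - 1) / (real p - real k)) *
      ((\<Prod>p\<in>C. real p / (real p - 1)) *
        (\<Sum>D\<in>{D \<in> rsets z (R / real (\<Prod>C)). D \<inter> C = {}}. (\<Prod>p\<in>D. 1 / (real p - 1)) * sweight R c (C \<union> D)))\<^sup>2)"
proof -
  let ?G = "\<lambda>C. \<Prod>p\<in>C. (real k - 1) / (real p - real k)"
  let ?l = "\<lambda>C. ln R - ln (real (\<Prod>C))"
  have big: "real p - real k > 0" "real p - 1 > 0" if "p \<in> rough z" for p
    using rough_gt[OF that] k by linarith+
  \<comment> \<open>With j = k - 1 the denominators p - j - 1 are exactly p - k.\<close>
  have low: "rdensity z ^ (k - 1) * ppow (m + (k - 1)) (ln R) \<le> (\<Sum>C\<in>rsets z R. ?G C * ppow m (?l C))" for m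
    using rsets_power_sum_ge[of "k - 1" z R m] k R by simp
  have "rdensity z ^ (k + 1) * (2 * (ln R)\<^sup>2 * ppow (k + 1) (ln R) + 6 * c * ln R * ppow (k + 2) (ln R) + 6 * c\<^sup>2 * ppow (k + 3) (ln R)) =
    (rdensity z)\<^sup>2 * (2 * (ln R)\<^sup>2 * (rdensity z ^ (k - 1) * ppow (2 + (k - 1)) (ln R)) + 6 * c * ln R * (rdensity z ^ (k - 1) * ppow (3 + (k - 1)) (ln R)) +
      6 * c\<^sup>2 * (rdensity z ^ (k - 1) * ppow (4 + (k - 1)) (ln R)))"
  proof -
    have e: "2 + (k - 1) = k + 1" "3 + (k - 1) = k + 2" "4 + (k - 1) = k + 3" using k by auto
    have "rdensity z ^ (k + 1) = (rdensity z)\<^sup>2 * rdensity z ^ (k - 1)" using k by (simp add: power_add[symmetric])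
    then show ?thesis unfolding e by (simp only: distrib_left mult_ac)
  qed
  also have "\<dots> \<le> (rdensity z)\<^sup>2 * (2 * (ln R)\<^sup>2 * (\<Sum>C\<in>rsets z R. ?G C * ppow 2 (?l C)) +
      6 * c * ln R * (\<Sum>C\<in>rsets z R. ?G C * ppow 3 (?l C)) + 6 * c\<^sup>2 * (\<Sum>C\<in>rsets z R. ?G C * ppow 4 (?l C)))"
    using c R by (intro mult_left_mono add_mono low) auto
  also have "\<dots> = (\<Sum>C\<in>rsets z R. ?G C * ((rdensity z)\<^sup>2 *
      (2 * (ln R)\<^sup>2 * ppow 2 (?l C) + 6 * c * ln R * ppow 3 (?l C) + 6 * c\<^sup>2 * ppow 4 (?l C))))"
    by (simp only: sum_distrib_left sum.distrib[symmetric] distrib_left mult_ac)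
  also have "\<dots> \<le> (\<Sum>C\<in>rsets z R. ?G C * ((\<Prod>p\<in>C. real p / (real p - 1)) *
        (\<Sum>D\<in>{D \<in> rsets z (R / real (\<Prod>C)). D \<inter> C = {}}. (\<Prod>p\<in>D. 1 / (real p - 1)) * sweight R c (C \<union> D)))\<^sup>2)"
  proof (intro sum_mono mult_left_mono)
    fix C assume C: "C \<in> rsets z R"
    show "0 \<le> ?G C" using big rsetsD(2)[OF C] k by (intro prod_nonneg) (force simp: less_imp_le)
    have l: "0 \<le> ?l C" using ln_rsets(2)[OF C] by simp
    let ?D = "{D \<in> rsets z (R / real (\<Prod>C)). D \<inter> C = {}}"
    let ?f = "\<lambda>D. \<Prod>p\<in>D. 1 / (real p - 1)"
    let ?P = "\<Prod>p\<in>C. 1 - 1 / real p"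
    let ?r = "\<Prod>p\<in>C. real p / (real p - 1)"
    have "(\<Sum>D\<in>?D. ?f D * sweight R c (C \<union> D)) = (\<Sum>D\<in>?D. ln R * (?f D * ppow 0 (?l C - ln (real (\<Prod>D)))) + c * (?f D * ppow 1 (?l C - ln (real (\<Prod>D)))))"
    proof (rule sum.cong[OF refl])
      fix D assume D: "D \<in> ?D"
      then have D': "D \<in> rsets z (R / real (\<Prod>C))" "C \<inter> D = {}" by auto
      have "\<Prod>(C \<union> D) = \<Prod>C * \<Prod>D" by (rule rsets_disjoint_union(2)[OF D' C])
      then have ln: "ln (real (\<Prod>(C \<union> D))) = ln (real (\<Prod>C)) + ln (real (\<Prod>D))"
        using rsetsD(4)[OF C] rsetsD(4)[OF D'(1)] by (simp add: ln_mult)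
      have "0 \<le> ?l C - ln (real (\<Prod>D))" using ln_rsets(2)[OF D'(1)] ln_quotient_rsets(2)[OF C] by simp
      then show "?f D * sweight R c (C \<union> D) = ln R * (?f D * ppow 0 (?l C - ln (real (\<Prod>D)))) + c * (?f D * ppow 1 (?l C - ln (real (\<Prod>D))))"
        unfolding sweight_def ln by (simp add: ppow_def algebra_simps)
    qed
    also have "\<dots> = ln R * (\<Sum>D\<in>?D. ?f D * ppow 0 (?l C - ln (real (\<Prod>D)))) + c * (\<Sum>D\<in>?D. ?f D * ppow 1 (?l C - ln (real (\<Prod>D))))"
      by (simp only: sum.distrib sum_distrib_left)
    also have "\<dots> \<ge> ln R * (rdensity z * ?P * ppow (Suc 0) (?l C)) + c * (rdensity z * ?P * ppow (Suc 1) (?l C))"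
      using c R rough_sum_ppow_ge[OF rsetsD(1,2)[OF C] ln_quotient_rsets(1)[OF C]] ln_quotient_rsets(2)[OF C]
      by (intro add_mono mult_left_mono) auto
    finally have S: "ln R * (rdensity z * ?P * ppow (Suc 0) (?l C)) + c * (rdensity z * ?P * ppow (Suc 1) (?l C)) \<le> (\<Sum>D\<in>?D. ?f D * sweight R c (C \<union> D))" .
    have r0: "0 \<le> ?r" using big rsetsD(2)[OF C] by (intro prod_nonneg) (force simp: less_imp_le)
    have rP: "?r * ?P = 1"
      unfolding prod.distrib[symmetric]
    proof (intro prod.neutral ballI)
      fix p assume "p \<in> C"
      then have "real p - 1 > 0" using big rsetsD(2)[OF C] by auto
      then show "real p / (real p - 1) * (1 - 1 / real p) = 1" by (simp add: field_simps)
    qed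
    have "rdensity z * (ln R * ?l C + c * (?l C)\<^sup>2 / 2) = (?r * ?P) * (rdensity z * (ln R * ?l C + c * (?l C)\<^sup>2 / 2))"
      unfolding rP by simp
    also have "\<dots> = ?r * (ln R * (rdensity z * ?P * ppow (Suc 0) (?l C)) + c * (rdensity z * ?P * ppow (Suc 1) (?l C)))"
      using l by (simp add: ppow_def algebra_simps power2_eq_square)
    also have "\<dots> \<le> ?r * (\<Sum>D\<in>?D. ?f D * sweight R c (C \<union> D))" using S r0 by (intro mult_left_mono)
    finally have "rdensity z * (ln R * ?l C + c * (?l C)\<^sup>2 / 2) \<le> ?r * (\<Sum>D\<in>?D. ?f D * sweight R c (C \<union> D))" .
    then have "(rdensity z * (ln R * ?l C + c * (?l C)\<^sup>2 / 2))\<^sup>2 \<le> (?r * (\<Sum>D\<in>?D. ?f D * sweight R c (C \<union> D)))\<^sup>2"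
      using rdensity_pos[of z] l c R by (intro power_mono) auto
    moreover have "(rdensity z * (ln R * ?l C + c * (?l C)\<^sup>2 / 2))\<^sup>2 =
       (rdensity z)\<^sup>2 * (2 * (ln R)\<^sup>2 * ppow 2 (?l C) + 6 * c * ln R * ppow 3 (?l C) + 6 * c\<^sup>2 * ppow 4 (?l C))"
      using l by (rule integrated_weight_square)
    ultimately show "(rdensity z)\<^sup>2 * (2 * (ln R)\<^sup>2 * ppow 2 (?l C) + 6 * c * ln R * ppow 3 (?l C) + 6 * c\<^sup>2 * ppow 4 (?l C)) \<le>
       (?r * (\<Sum>D\<in>?D. ?f D * sweight R c (C \<union> D)))\<^sup>2" by simp
  qed
  finally show ?thesis .
qed

text \<open>The sum over supersets of \<open>A\<close> is at most g(A) times the full sum T of the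
  weights g(p) = k/(p - k). Moreover (p/k) g(p) = g(p) + 1, so the prefactor times g(A) is a sum
  over subsets of \<open>A\<close>, again at most T.\<close>

lemma scoeff_bound:
  assumes k: "1 \<le> k" "k \<le> z" and c: "0 \<le> c" and A: "A \<in> rsets z R"
  shows "\<bar>scoeff z k R (sweight R c) A\<bar> \<le> (1 + c) * ln R * (\<Sum>B\<in>rsets z R. \<Prod>p\<in>B. real k / (real p - real k))\<^sup>2"
proof -
  let ?g = "\<lambda>B. \<Prod>p\<in>B. real k / (real p - real k)"
  let ?T = "\<Sum>B\<in>rsets z R. ?g B"
  have big: "real p - real k > 0" if "p \<in> rough z" for p
    using rough_gt[OF that] k by linarith
  have g0: "0 \<le> ?g B" if "B \<subseteq> rough z" for B using big that by (intro prod_nonneg) (force simp: less_imp_le)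
  have R: "0 \<le> ln R" using rsetsD(5)[OF A] by simp
  have y: "\<bar>sweight R c B\<bar> \<le> (1 + c) * ln R" if "B \<in> rsets z R" for B
  proof -
    have "0 \<le> ln R - ln (real (\<Prod>B))" "ln R - ln (real (\<Prod>B)) \<le> ln R" using ln_rsets[OF that] by auto
    then have "0 \<le> c * (ln R - ln (real (\<Prod>B)))" "c * (ln R - ln (real (\<Prod>B))) \<le> c * ln R"
      using c by (auto intro: mult_left_mono)
    then show ?thesis using R unfolding sweight_def by (simp add: algebra_simps)
  qed
  have T0: "0 \<le> ?T" using g0 rsetsD(2) by (intro sum_nonneg) blast
  have "\<bar>\<Sum>B\<in>{B \<in> rsets z R. A \<subseteq> B}. ?g B * sweight R c B\<bar> \<le> (\<Sum>B\<in>{B \<in> rsets z R. A \<subseteq> B}. ?g B * ((1 + c) * ln R))"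
  proof (rule order_trans[OF sum_abs sum_mono])
    fix B assume "B \<in> {B \<in> rsets z R. A \<subseteq> B}"
    then show "\<bar>?g B * sweight R c B\<bar> \<le> ?g B * ((1 + c) * ln R)"
      using y[of B] g0[of B] rsetsD(2)[of B z R] by (simp add: abs_mult mult_left_mono)
  qed
  also have "\<dots> = (\<Sum>D\<in>{D \<in> rsets z (R / real (\<Prod>A)). D \<inter> A = {}}. ?g A * ?g D) * ((1 + c) * ln R)"
    unfolding sum_distrib_right[symmetric] rsets_superset_sum[OF A]
    using rsetsD(1)[OF A] by (intro arg_cong2[where f = "(*)"] sum.cong prod.union_disjoint refl) (auto dest: rsetsD)
  also have "(\<Sum>D\<in>{D \<in> rsets z (R / real (\<Prod>A)). D \<inter> A = {}}. ?g A * ?g D) \<le> ?g A * ?T"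
  proof -
    have "R / real (\<Prod>A) \<le> R / 1" using rsetsD(4,5)[OF A] by (intro divide_left_mono) auto
    then have "rsets z (R / real (\<Prod>A)) \<subseteq> rsets z R" by (intro rsets_mono) simp
    then have "(\<Sum>D\<in>{D \<in> rsets z (R / real (\<Prod>A)). D \<inter> A = {}}. ?g D) \<le> ?T"
      using g0 rsetsD(2) by (intro sum_mono2) auto
    then show ?thesis unfolding sum_distrib_left[symmetric] using g0 rsetsD(2)[OF A] by (intro mult_left_mono) auto
  qed
  finally have S: "\<bar>\<Sum>B\<in>{B \<in> rsets z R. A \<subseteq> B}. ?g B * sweight R c B\<bar> \<le> ?g A * ?T * ((1 + c) * ln R)"
    using c R by (simp add: mult_right_mono)
  have q0: "0 \<le> (\<Prod>p\<in>A. real p / real k)" by (intro prod_nonneg) auto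
  have "(\<Prod>p\<in>A. real p / real k) * ?g A = (\<Prod>p\<in>A. real k / (real p - real k) + 1)"
    unfolding prod.distrib[symmetric]
  proof (rule prod.cong[OF refl])
    fix p assume "p \<in> A"
    then have "real p - real k > 0" using big rsetsD(2)[OF A] by auto
    then show "real p / real k * (real k / (real p - real k)) = real k / (real p - real k) + 1"
      using k by (simp add: field_simps)
  qed
  also have "\<dots> = (\<Sum>B\<in>Pow A. ?g B)"
    using prod_add[OF rsetsD(1)[OF A], of "\<lambda>p. real k / (real p - real k)" "\<lambda>_. 1"] by simp
  also have "\<dots> \<le> ?T" using rsets_subset[OF A] g0 rsetsD(2) by (intro sum_mono2) auto
  finally have g: "(\<Prod>p\<in>A. real p / real k) * ?g A \<le> ?T" .
  have "\<bar>scoeff z k R (sweight R c) A\<bar> = (\<Prod>p\<in>A. real p / real k) * \<bar>\<Sum>B\<in>{B \<in> rsets z R. A \<subseteq> B}. ?g B * sweight R c B\<bar>"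
    unfolding scoeff_def using q0 by (simp add: abs_mult power_abs)
  also have "\<dots> \<le> (\<Prod>p\<in>A. real p / real k) * (?g A * ?T * ((1 + c) * ln R))"
    using S q0 by (rule mult_left_mono)
  also have "\<dots> = ((\<Prod>p\<in>A. real p / real k) * ?g A) * (?T * ((1 + c) * ln R))" by (simp only: mult_ac)
  also have "\<dots> \<le> ?T * (?T * ((1 + c) * ln R))" using g T0 c R by (intro mult_right_mono) auto
  finally show ?thesis by (simp add: power2_eq_square mult_ac)
qed

section \<open>Sieve sums and residue classes\<close>

text \<open>For a set \<open>A\<close> of primes this says that \<open>\<Prod>A\<close> divides the
  product of the \<open>n + h\<close>, in a form compatible with unions.\<close>

definition hits :: "nat set \<Rightarrow> nat \<Rightarrow> nat set \<Rightarrow> bool" where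
  "hits H n A \<longleftrightarrow> (\<forall>p\<in>A. \<exists>h\<in>H. p dvd n + h)"

lemma hits_Un: "hits H n (A \<union> B) \<longleftrightarrow> hits H n A \<and> hits H n B"
  by (auto simp: hits_def)

lemma rough_dvd_unique:
  assumes "p \<in> rough z" "p dvd n + h" "p dvd n + h'" "h \<le> z" "h' \<le> z"
  shows "h = h'"
proof -
  have *: "\<not> a < b" if "p dvd n + a" "p dvd n + b" "b \<le> z" for a b
  proof
    assume "a < b"
    moreover have "p dvd (n + b) - (n + a)" using that by (intro dvd_diff_nat)
    ultimately have "p \<le> b - a" by (intro dvd_imp_le) auto
    then show False using rough_gt[OF assms(1)] that(3) by linarith
  qed
  show ?thesis using *[of h h'] *[of h' h] assms by linarith
qed

text \<open>A prime beyond \<open>z\<close> divides at most one \<open>n + h\<close>, so each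
  \<open>n\<close> determines which shift every p in \<open>C\<close> divides. This splits the sum
  into \<open>card H ^ card C\<close> disjoint residue classes.\<close>

lemma hits_sum:
  fixes a :: "nat \<Rightarrow> real"
  assumes H: "finite H" "H \<subseteq> {..z}" and C: "C \<in> rsets z x" and I: "finite I"
  shows "(\<Sum>n\<in>{n \<in> I. hits H n C}. a n) =
    (\<Sum>\<sigma>\<in>PiE C (\<lambda>_. H). \<Sum>n\<in>{n \<in> I. \<forall>p\<in>C. p dvd n + \<sigma> p}. a n)"
proof -
  have "{n \<in> I. hits H n C} = (\<Union>\<sigma>\<in>PiE C (\<lambda>_. H). {n \<in> I. \<forall>p\<in>C. p dvd n + \<sigma> p})"
  proof (intro equalityI subsetI)
    fix n assume n: "n \<in> {n \<in> I. hits H n C}"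
    then have "\<forall>p\<in>C. \<exists>h. h \<in> H \<and> p dvd n + h" by (auto simp: hits_def)
    from bchoice[OF this] obtain f where f: "\<forall>p\<in>C. f p \<in> H \<and> p dvd n + f p" by blast
    then have "restrict f C \<in> PiE C (\<lambda>_. H)" by auto
    moreover have "n \<in> {n \<in> I. \<forall>p\<in>C. p dvd n + restrict f C p}" using n f by auto
    ultimately show "n \<in> (\<Union>\<sigma>\<in>PiE C (\<lambda>_. H). {n \<in> I. \<forall>p\<in>C. p dvd n + \<sigma> p})" by blast
  next
    fix n assume "n \<in> (\<Union>\<sigma>\<in>PiE C (\<lambda>_. H). {n \<in> I. \<forall>p\<in>C. p dvd n + \<sigma> p})"
    then obtain \<sigma> where "\<sigma> \<in> PiE C (\<lambda>_. H)" "n \<in> I" "\<forall>p\<in>C. p dvd n + \<sigma> p" by auto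
    then show "n \<in> {n \<in> I. hits H n C}" unfolding hits_def by (auto dest: PiE_mem)
  qed
  then show ?thesis
  proof (simp only:, intro sum.UNION_disjoint ballI impI)
    show "finite (PiE C (\<lambda>_. H))" using H rsetsD(1)[OF C] by (intro finite_PiE) auto
    fix \<sigma> \<tau> assume s: "\<sigma> \<in> PiE C (\<lambda>_. H)" "\<tau> \<in> PiE C (\<lambda>_. H)" "\<sigma> \<noteq> \<tau>"
    then obtain p where p: "p \<in> C" "\<sigma> p \<noteq> \<tau> p" by (meson PiE_ext)
    have "p \<in> rough z" "\<sigma> p \<le> z" "\<tau> p \<le> z"
      using p s rsetsD(2)[OF C] H PiE_mem[OF s(1) p(1)] PiE_mem[OF s(2) p(1)] by auto
    then have "\<not> (p dvd n + \<sigma> p \<and> p dvd n + \<tau> p)" for n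
      using rough_dvd_unique p(2) by blast
    then show "{n \<in> I. \<forall>p\<in>C. p dvd n + \<sigma> p} \<inter> {n \<in> I. \<forall>p\<in>C. p dvd n + \<tau> p} = {}"
      using p(1) by blast
  qed (use I in auto)
qed

text \<open>A pair with union \<open>C\<close> consists of two subsets of \<open>C\<close>, hence at
  most 4^|C| pairs.\<close>

lemma rsets_pair_sum_le:
  fixes F :: "nat set \<Rightarrow> real"
  assumes F: "\<And>C. C \<in> rsets z (R * R) \<Longrightarrow> 0 \<le> F C"
  shows "(\<Sum>A\<in>rsets z R. \<Sum>B\<in>rsets z R. F (A \<union> B)) \<le> (\<Sum>C\<in>rsets z (R * R). 4 ^ card C * F C)"
proof -
  have "(\<Sum>A\<in>rsets z R. \<Sum>B\<in>rsets z R. F (A \<union> B)) = (\<Sum>P\<in>rsets z R \<times> rsets z R. F (fst P \<union> snd P))"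
    by (simp add: sum.cartesian_product case_prod_beta)
  also have "\<dots> = (\<Sum>C\<in>rsets z (R * R). \<Sum>P\<in>{P \<in> rsets z R \<times> rsets z R. fst P \<union> snd P = C}. F (fst P \<union> snd P))"
    by (rule sum.group[symmetric]) (auto intro: rsets_union)
  also have "\<dots> \<le> (\<Sum>C\<in>rsets z (R * R). 4 ^ card C * F C)"
  proof (rule sum_mono)
    fix C assume C: "C \<in> rsets z (R * R)"
    have fin: "finite C" using rsetsD(1)[OF C] .
    have "card {P \<in> rsets z R \<times> rsets z R. fst P \<union> snd P = C} \<le> card (Pow C \<times> Pow C)"
      using fin by (intro card_mono) auto
    also have "\<dots> = 4 ^ card C" using fin by (simp add: card_cartesian_product card_Pow flip: power_mult_distrib)
    finally have "real (card {P \<in> rsets z R \<times> rsets z R. fst P \<union> snd P = C}) \<le> real (4 ^ card C)"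
      by (rule of_nat_mono)
    then have c: "real (card {P \<in> rsets z R \<times> rsets z R. fst P \<union> snd P = C}) \<le> 4 ^ card C"
      by simp
    have "(\<Sum>P\<in>{P \<in> rsets z R \<times> rsets z R. fst P \<union> snd P = C}. F (fst P \<union> snd P)) =
       real (card {P \<in> rsets z R \<times> rsets z R. fst P \<union> snd P = C}) * F C" by simp
    also have "\<dots> \<le> 4 ^ card C * F C" using c F[OF C] by (rule mult_right_mono)
    finally show "(\<Sum>P\<in>{P \<in> rsets z R \<times> rsets z R. fst P \<union> snd P = C}. F (fst P \<union> snd P)) \<le> 4 ^ card C * F C" .
  qed
  finally show ?thesis .
qed

text \<open>Serves all three averages: t = 1/p for counting, 1/(p - 1) for primes, and X = 0 for the
  Liouville sum. In the error, the base 4 \<open>card H\<close> combines the pairs with union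
  \<open>C\<close> and the choices of a shift per prime.\<close>

lemma sieve_expand:
  fixes a :: "nat \<Rightarrow> real" and l :: "nat set \<Rightarrow> real"
  assumes H: "finite H" "H \<subseteq> {..z}" and I: "finite I"
    and est: "\<And>C \<sigma>. C \<in> rsets z (R * R) \<Longrightarrow> \<sigma> \<in> PiE C (\<lambda>_. H) \<Longrightarrow>
      \<bar>(\<Sum>n\<in>{n \<in> I. \<forall>p\<in>C. p dvd n + \<sigma> p}. a n) - X * (\<Prod>p\<in>C. t p)\<bar> \<le> E C"
    and E: "\<And>C. C \<in> rsets z (R * R) \<Longrightarrow> 0 \<le> E C"
    and l: "\<And>A. A \<in> rsets z R \<Longrightarrow> \<bar>l A\<bar> \<le> \<Lambda>"
  shows "\<bar>(\<Sum>n\<in>I. a n * (\<Sum>A\<in>{A \<in> rsets z R. hits H n A}. l A)\<^sup>2) -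
      X * (\<Sum>A\<in>rsets z R. \<Sum>B\<in>rsets z R. l A * l B * (\<Prod>p\<in>A \<union> B. real (card H) * t p))\<bar>
    \<le> \<Lambda>\<^sup>2 * (\<Sum>C\<in>rsets z (R * R). real (4 * card H) ^ card C * E C)"
proof -
  let ?h = "real (card H)"
  let ?S = "\<lambda>C. \<Sum>n\<in>{n \<in> I. hits H n C}. a n"
  have one: "\<bar>?S C - X * (\<Prod>p\<in>C. ?h * t p)\<bar> \<le> ?h ^ card C * E C" if C: "C \<in> rsets z (R * R)" for C
  proof -
    have crd: "real (card (PiE C (\<lambda>_. H))) = ?h ^ card C" using rsetsD(1)[OF C] by (simp add: card_PiE)
    have "?S C - X * (\<Prod>p\<in>C. ?h * t p) =
       (\<Sum>\<sigma>\<in>PiE C (\<lambda>_. H). (\<Sum>n\<in>{n \<in> I. \<forall>p\<in>C. p dvd n + \<sigma> p}. a n) - X * (\<Prod>p\<in>C. t p))"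
      unfolding hits_sum[OF H C I] sum_subtractf sum_constant crd by (simp add: prod.distrib)
    also have "\<bar>\<dots>\<bar> \<le> (\<Sum>\<sigma>\<in>PiE C (\<lambda>_. H). E C)"
      by (rule order_trans[OF sum_abs sum_mono]) (rule est[OF C])
    finally show ?thesis by (simp only: sum_constant crd)
  qed
  have exp: "(\<Sum>n\<in>I. a n * (\<Sum>A\<in>{A \<in> rsets z R. hits H n A}. l A)\<^sup>2) =
     (\<Sum>A\<in>rsets z R. \<Sum>B\<in>rsets z R. l A * l B * ?S (A \<union> B))"
  proof -
    have "(\<Sum>n\<in>I. a n * (\<Sum>A\<in>{A \<in> rsets z R. hits H n A}. l A)\<^sup>2) =
      (\<Sum>n\<in>I. \<Sum>A\<in>rsets z R. \<Sum>B\<in>rsets z R. l A * l B * (if hits H n (A \<union> B) then a n else 0))"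
    proof (rule sum.cong[OF refl])
      fix n
      have "(\<Sum>A\<in>{A \<in> rsets z R. hits H n A}. l A) = (\<Sum>A\<in>rsets z R. if hits H n A then l A else 0)"
        by (rule sum.inter_filter) simp
      then have "a n * (\<Sum>A\<in>{A \<in> rsets z R. hits H n A}. l A)\<^sup>2 =
         (\<Sum>A\<in>rsets z R. \<Sum>B\<in>rsets z R. a n * ((if hits H n A then l A else 0) * (if hits H n B then l B else 0)))"
        unfolding power2_eq_square by (simp only: sum_product) (simp only: sum_distrib_left)
      also have "\<dots> = (\<Sum>A\<in>rsets z R. \<Sum>B\<in>rsets z R. l A * l B * (if hits H n (A \<union> B) then a n else 0))"
        by (intro sum.cong refl) (auto simp: hits_Un)
      finally show "a n * (\<Sum>A\<in>{A \<in> rsets z R. hits H n A}. l A)\<^sup>2 =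
        (\<Sum>A\<in>rsets z R. \<Sum>B\<in>rsets z R. l A * l B * (if hits H n (A \<union> B) then a n else 0))" .
    qed
    also have "\<dots> = (\<Sum>A\<in>rsets z R. \<Sum>n\<in>I. \<Sum>B\<in>rsets z R. l A * l B * (if hits H n (A \<union> B) then a n else 0))"
      by (rule sum.swap)
    also have "\<dots> = (\<Sum>A\<in>rsets z R. \<Sum>B\<in>rsets z R. \<Sum>n\<in>I. l A * l B * (if hits H n (A \<union> B) then a n else 0))"
      by (intro sum.cong refl sum.swap)
    also have "\<dots> = (\<Sum>A\<in>rsets z R. \<Sum>B\<in>rsets z R. l A * l B * ?S (A \<union> B))"
      using I by (simp add: sum_distrib_left[symmetric] sum.inter_filter)
    finally show ?thesis .
  qed
  have "(\<Sum>n\<in>I. a n * (\<Sum>A\<in>{A \<in> rsets z R. hits H n A}. l A)\<^sup>2) -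
      X * (\<Sum>A\<in>rsets z R. \<Sum>B\<in>rsets z R. l A * l B * (\<Prod>p\<in>A \<union> B. ?h * t p)) =
    (\<Sum>A\<in>rsets z R. \<Sum>B\<in>rsets z R. l A * l B * (?S (A \<union> B) - X * (\<Prod>p\<in>A \<union> B. ?h * t p)))"
    unfolding exp by (simp only: sum_distrib_left sum_subtractf[symmetric] right_diff_distrib mult_ac)
  also have "\<bar>\<dots>\<bar> \<le> (\<Sum>A\<in>rsets z R. \<Sum>B\<in>rsets z R. \<bar>l A * l B * (?S (A \<union> B) - X * (\<Prod>p\<in>A \<union> B. ?h * t p))\<bar>)"
    by (rule order_trans[OF sum_abs sum_mono]) (rule sum_abs)
  also have "\<dots> \<le> (\<Sum>A\<in>rsets z R. \<Sum>B\<in>rsets z R. \<Lambda>\<^sup>2 * (?h ^ card (A \<union> B) * E (A \<union> B)))"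
  proof (intro sum_mono)
    fix A B assume AB: "A \<in> rsets z R" "B \<in> rsets z R"
    have "\<bar>l A\<bar> * \<bar>l B\<bar> \<le> \<Lambda> * \<Lambda>"
      using l[OF AB(1)] l[OF AB(2)] by (intro mult_mono) linarith+
    then have "(\<bar>l A\<bar> * \<bar>l B\<bar>) * \<bar>?S (A \<union> B) - X * (\<Prod>p\<in>A \<union> B. ?h * t p)\<bar> \<le> (\<Lambda> * \<Lambda>) * (?h ^ card (A \<union> B) * E (A \<union> B))"
      by (rule mult_mono[OF _ one[OF rsets_union[OF AB]]]) auto
    then show "\<bar>l A * l B * (?S (A \<union> B) - X * (\<Prod>p\<in>A \<union> B. ?h * t p))\<bar> \<le> \<Lambda>\<^sup>2 * (?h ^ card (A \<union> B) * E (A \<union> B))"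
      by (simp add: abs_mult power2_eq_square)
  qed
  also have "\<dots> = \<Lambda>\<^sup>2 * (\<Sum>A\<in>rsets z R. \<Sum>B\<in>rsets z R. ?h ^ card (A \<union> B) * E (A \<union> B))"
    by (simp only: sum_distrib_left)
  also have "\<dots> \<le> \<Lambda>\<^sup>2 * (\<Sum>C\<in>rsets z (R * R). 4 ^ card C * (?h ^ card C * E C))"
    using E by (intro mult_left_mono rsets_pair_sum_le) auto
  finally show ?thesis by (simp add: power_mult_distrib mult.assoc)
qed

section \<open>Residue classes given by the Chinese remainder theorem\<close>

lemma rough_residue_class:
  fixes \<sigma> :: "nat \<Rightarrow> nat"
  assumes C: "finite C" "C \<subseteq> rough z"
  shows "\<exists>a < fact z * \<Prod>C. \<forall>n. ([n = b] (mod fact z) \<and> (\<forall>p\<in>C. p dvd n + \<sigma> p)) \<longleftrightarrow> [n = a] (mod fact z * \<Prod>C)"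
proof -
  have cop: "coprime p q" if "p \<in> C" "q \<in> C" "p \<noteq> q" for p q
    using that C rough_prime primes_coprime by blast
  have copW: "coprime (fact z) (\<Prod>C)" using coprime_prod_rough_fact[OF C] by (simp add: coprime_commute)
  \<comment> \<open>\<open>\<sigma> p * (p - 1)\<close> is a natural number congruent to
    -\<open>\<sigma> p\<close> modulo p.\<close>
  obtain x where x: "\<forall>p\<in>C. [x = \<sigma> p * (p - 1)] (mod p)"
    using chinese_remainder_nat[OF C(1), of "\<lambda>p. p" "\<lambda>p. \<sigma> p * (p - 1)"] cop by auto
  obtain y where y: "[y = b] (mod fact z)" "[y = x] (mod \<Prod>C)"
    using binary_chinese_remainder_nat[OF copW] by blast
  have py: "p dvd y + \<sigma> p" if p: "p \<in> C" for p
  proof -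
    have "p dvd \<Prod>C" using p C(1) by auto
    then have "[y = x] (mod p)" using y(2) cong_dvd_modulus_nat by blast
    then have "[y = \<sigma> p * (p - 1)] (mod p)" using x p cong_trans by blast
    then have "[y + \<sigma> p = \<sigma> p * (p - 1) + \<sigma> p] (mod p)" by (intro cong_add) auto
    moreover have "\<sigma> p * (p - 1) + \<sigma> p = \<sigma> p * p"
      using rough_prime[of p z] p C(2) prime_gt_0_nat[of p] by (cases p) auto
    ultimately show ?thesis by (simp add: unique_euclidean_semiring_class.cong_def dvd_eq_mod_eq_0)
  qed
  define a where "a = y mod (fact z * \<Prod>C)"
  have pos: "0 < fact z * \<Prod>C" using prod_rough_pos[OF C(2)] by simp
  have ay: "[a = y] (mod fact z * \<Prod>C)" by (simp add: a_def)
  show ?thesis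
  proof (intro exI[of _ a] conjI allI)
    show "a < fact z * \<Prod>C" using pos by (simp add: a_def)
    fix n
    have "[n = a] (mod fact z * \<Prod>C) \<longleftrightarrow> [n = y] (mod fact z * \<Prod>C)"
      using ay cong_trans cong_sym by blast
    also have "\<dots> \<longleftrightarrow> [n = y] (mod fact z) \<and> [n = y] (mod \<Prod>C)"
      using copW by (auto intro: coprime_cong_mult_nat cong_modulus_mult_nat simp: mult.commute)
    also have "[n = y] (mod fact z) \<longleftrightarrow> [n = b] (mod fact z)"
      using y(1) cong_trans cong_sym by blast
    also have "[n = y] (mod \<Prod>C) \<longleftrightarrow> (\<forall>p\<in>C. [n = y] (mod p))"
    proof
      assume *: "[n = y] (mod \<Prod>C)"
      show "\<forall>p\<in>C. [n = y] (mod p)"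
      proof
        fix p assume "p \<in> C"
        then have "p dvd \<Prod>C" using C(1) by auto
        with * show "[n = y] (mod p)" by (rule cong_dvd_modulus_nat)
      qed
    next
      assume "\<forall>p\<in>C. [n = y] (mod p)"
      then show "[n = y] (mod \<Prod>C)"
        using coprime_cong_prod_nat[of C "\<lambda>p. p" n y] cop by simp
    qed
    also have "(\<forall>p\<in>C. [n = y] (mod p)) \<longleftrightarrow> (\<forall>p\<in>C. p dvd n + \<sigma> p)"
    proof (rule ball_cong[OF refl])
      fix p assume "p \<in> C"
      then have "p dvd y + \<sigma> p" by (rule py)
      then have "[y + \<sigma> p = 0] (mod p)" by (simp add: cong_0_iff)
      moreover have "p dvd n + \<sigma> p \<longleftrightarrow> [n + \<sigma> p = 0] (mod p)" by (simp add: cong_0_iff)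
      moreover have "[n = y] (mod p) \<longleftrightarrow> [n + \<sigma> p = y + \<sigma> p] (mod p)" by (simp add: cong_add_rcancel_nat)
      ultimately show "[n = y] (mod p) \<longleftrightarrow> p dvd n + \<sigma> p" using cong_trans cong_sym by metis
    qed
    finally show "([n = b] (mod fact z) \<and> (\<forall>p\<in>C. p dvd n + \<sigma> p)) \<longleftrightarrow> [n = a] (mod fact z * \<Prod>C)" by blast
  qed
qed

text \<open>Both bounds keep M - a rather than M. Subtracting them for two values of M then gives
  the count in an interval with total error at most 1.\<close>

lemma card_residue_class_le:
  assumes "a < Q"
  shows "real (card {n::nat. n \<le> M \<and> [n = a] (mod Q)}) \<le> (real M - real a) / real Q + 1"
    and "(real M - real a) / real Q \<le> real (card {n::nat. n \<le> M \<and> [n = a] (mod Q)})"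
proof -
  have Q: "real Q > 0" using assms by simp
  let ?S = "{n::nat. n \<le> M \<and> [n = a] (mod Q)}"
  have "real (card ?S) \<le> (real M - real a) / real Q + 1 \<and> (real M - real a) / real Q \<le> real (card ?S)"
  proof (cases "a \<le> M")
    case True
    have "bij_betw (\<lambda>i. a + Q * i) {..(M - a) div Q} ?S"
    proof (rule bij_betwI[where g = "\<lambda>n. (n - a) div Q"])
      show "(\<lambda>i. a + Q * i) \<in> {..(M - a) div Q} \<rightarrow> ?S"
      proof
        fix i assume "i \<in> {..(M - a) div Q}"
        then have "Q * i \<le> M - a" using assms by (metis atMost_iff mult.commute less_eq_div_iff_mult_less_eq gr0I not_less0)
        then show "a + Q * i \<in> ?S" using True by (auto simp: unique_euclidean_semiring_class.cong_def)
      qed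
      show "(\<lambda>n. (n - a) div Q) \<in> ?S \<rightarrow> {..(M - a) div Q}" by (auto intro!: div_le_mono)
      show "(a + Q * i - a) div Q = i" for i using assms by simp
      fix n assume n: "n \<in> ?S"
      then have "n mod Q = a" using assms by (simp add: unique_euclidean_semiring_class.cong_def)
      then have "n = a + Q * (n div Q)" by (metis add.commute mult_div_mod_eq)
      then show "a + Q * ((n - a) div Q) = n" by (metis add_diff_cancel_left' assms gr_implies_not_zero nonzero_mult_div_cancel_left)
    qed
    then have c: "card ?S = (M - a) div Q + 1" using bij_betw_same_card by fastforce
    define q where "q = (M - a) div Q"
    have "M - a = Q * q + (M - a) mod Q" unfolding q_def by simp
    moreover have "(M - a) mod Q < Q" using assms by simp
    ultimately have "Q * q \<le> M - a" "M - a < Q * q + Q" by linarith+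
    then have "real (Q * q) \<le> real (M - a)" "real (M - a) < real (Q * q + Q)" by linarith+
    then have "real Q * real q \<le> real M - real a" "real M - real a < real Q * real q + real Q"
      using True by simp_all
    then show ?thesis unfolding c q_def[symmetric] using Q by (auto simp: field_simps)
  next
    case False
    then have "?S = {}" using assms by (auto simp: unique_euclidean_semiring_class.cong_def)
    then have c: "card ?S = 0" by simp
    \<comment> \<open>Here (M - a)/Q lies between -1 and 0, so the bounds still enclose the count
      0.\<close>
    show ?thesis unfolding c using False assms Q by (auto simp: field_simps)
  qed
  then show "real (card ?S) \<le> (real M - real a) / real Q + 1" "(real M - real a) / real Q \<le> real (card ?S)" by auto
qed

section \<open>Errors in arithmetic progressions\<close>

text \<open>Repeats the inner term of \<open>condA\<close> literally, so that the condition is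
  transferred by folding this definition; likewise \<open>liouville_err\<close> and
  \<open>condB\<close>.\<close>

definition prime_err :: "nat \<Rightarrow> nat \<Rightarrow> real" where
  "prime_err M q = Max {\<bar>(\<Sum>p\<in>{p::nat. prime p \<and> p \<le> M \<and> [p = a] (mod q)}. ln (real p))
                - real M / real (totient q)\<bar> | a. a < q \<and> coprime a q}"

definition liouville_err :: "nat \<Rightarrow> nat \<Rightarrow> real" where
  "liouville_err M q = Max {\<bar>real_of_int (\<Sum>n\<in>{n::nat. 1 \<le> n \<and> n \<le> y \<and> [n = a] (mod q)}. liouville n)\<bar>
              | y a. y \<le> M \<and> a < q}"

lemma prime_err_ge:
  assumes "a < q" "coprime a q"
  shows "\<bar>(\<Sum>p\<in>{p::nat. prime p \<and> p \<le> M \<and> [p = a] (mod q)}. ln (real p)) - real M / real (totient q)\<bar> \<le> prime_err M q"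
  unfolding prime_err_def
proof (rule Max_ge)
  show "finite {\<bar>(\<Sum>p\<in>{p::nat. prime p \<and> p \<le> M \<and> [p = a] (mod q)}. ln (real p))
                - real M / real (totient q)\<bar> | a. a < q \<and> coprime a q}"
    by (rule finite_image_set) simp
qed (use assms in blast)

lemma liouville_err_ge:
  assumes "a < q" "y \<le> M"
  shows "\<bar>real_of_int (\<Sum>n\<in>{n::nat. 1 \<le> n \<and> n \<le> y \<and> [n = a] (mod q)}. liouville n)\<bar> \<le> liouville_err M q"
  unfolding liouville_err_def
proof (rule Max_ge)
  have "finite ((\<lambda>(y, a). \<bar>real_of_int (\<Sum>n\<in>{n::nat. 1 \<le> n \<and> n \<le> y \<and> [n = a] (mod q)}. liouville n)\<bar>) ` ({..M} \<times> {..<q}))"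
    by simp
  then show "finite {\<bar>real_of_int (\<Sum>n\<in>{n::nat. 1 \<le> n \<and> n \<le> y \<and> [n = a] (mod q)}. liouville n)\<bar>
              | y a. y \<le> M \<and> a < q}"
    by (rule rev_finite_subset) auto
qed (use assms in blast)

lemma prime_err_nonneg: "0 < q \<Longrightarrow> 0 \<le> prime_err M q"
proof -
  assume q: "0 < q"
  \<comment> \<open>Reduction modulo \<open>q\<close> covers q = 1, where 0 is the only admissible
    residue.\<close>
  have "coprime (1 mod q) q" using q by (metis coprime_1_left coprime_mod_left_iff neq0_conv)
  from prime_err_ge[OF _ this, of M] show ?thesis
    using q by (meson abs_ge_zero mod_less_divisor order_trans)
qed

lemma liouville_err_nonneg: "0 < q \<Longrightarrow> 0 \<le> liouville_err M q"
  using liouville_err_ge[of 0 q 0 M] by simp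

lemma liouville_cases: "liouville n = 1 \<or> liouville n = -1"
  unfolding liouville_def by (cases "even (bigOmega n)") auto

lemma liouville_err_le:
  assumes q: "0 < q"
  shows "liouville_err M q \<le> real M / real q + 1"
  unfolding liouville_err_def
proof (rule Max.boundedI)
  have "finite ((\<lambda>(y, a). \<bar>real_of_int (\<Sum>n\<in>{n::nat. 1 \<le> n \<and> n \<le> y \<and> [n = a] (mod q)}. liouville n)\<bar>) ` ({..M} \<times> {..<q}))"
    by simp
  then show "finite {\<bar>real_of_int (\<Sum>n\<in>{n::nat. 1 \<le> n \<and> n \<le> y \<and> [n = a] (mod q)}. liouville n)\<bar>
              | y a. y \<le> M \<and> a < q}"
    by (rule rev_finite_subset) auto
  show "{\<bar>real_of_int (\<Sum>n\<in>{n::nat. 1 \<le> n \<and> n \<le> y \<and> [n = a] (mod q)}. liouville n)\<bar>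
              | y a. y \<le> M \<and> a < q} \<noteq> {}"
    using q by blast
  fix e assume "e \<in> {\<bar>real_of_int (\<Sum>n\<in>{n::nat. 1 \<le> n \<and> n \<le> y \<and> [n = a] (mod q)}. liouville n)\<bar>
              | y a. y \<le> M \<and> a < q}"
  then obtain y a where e: "e = \<bar>real_of_int (\<Sum>n\<in>{n::nat. 1 \<le> n \<and> n \<le> y \<and> [n = a] (mod q)}. liouville n)\<bar>"
    and ya: "y \<le> M" "a < q" by blast
  have "e \<le> (\<Sum>n\<in>{n::nat. 1 \<le> n \<and> n \<le> y \<and> [n = a] (mod q)}. \<bar>real_of_int (liouville n)\<bar>)"
    unfolding e of_int_sum by (rule sum_abs)
  also have "\<dots> = (\<Sum>n\<in>{n::nat. 1 \<le> n \<and> n \<le> y \<and> [n = a] (mod q)}. 1)"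
  proof (rule sum.cong[OF refl])
    fix n show "\<bar>real_of_int (liouville n)\<bar> = 1" using liouville_cases[of n] by auto
  qed
  also have "\<dots> \<le> (\<Sum>n\<in>{n::nat. n \<le> M \<and> [n = a] (mod q)}. 1)"
    using ya by (intro sum_mono2) auto
  also have "\<dots> \<le> (real M - real a) / real q + 1"
    using card_residue_class_le(1)[OF ya(2), of M] by simp
  also have "\<dots> \<le> real M / real q + 1" using q by (simp add: divide_right_mono)
  finally show "e \<le> real M / real q + 1" .
qed

lemma prime_err_le:
  assumes q: "0 < q" and M: "1 \<le> M"
  shows "prime_err M q \<le> (real M / real q + 1) * ln (real M) + real M / real (totient q)"
  unfolding prime_err_def
proof (rule Max.boundedI)
  show "finite {\<bar>(\<Sum>p\<in>{p::nat. prime p \<and> p \<le> M \<and> [p = a] (mod q)}. ln (real p))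
                - real M / real (totient q)\<bar> | a. a < q \<and> coprime a q}"
    by (rule finite_image_set) simp
  have "coprime (1 mod q) q" using q by (metis coprime_1_left coprime_mod_left_iff neq0_conv)
  moreover have "1 mod q < q" using q by simp
  ultimately show "{\<bar>(\<Sum>p\<in>{p::nat. prime p \<and> p \<le> M \<and> [p = a] (mod q)}. ln (real p))
                - real M / real (totient q)\<bar> | a. a < q \<and> coprime a q} \<noteq> {}"
    by blast
  fix e assume "e \<in> {\<bar>(\<Sum>p\<in>{p::nat. prime p \<and> p \<le> M \<and> [p = a] (mod q)}. ln (real p))
                - real M / real (totient q)\<bar> | a. a < q \<and> coprime a q}"
  then obtain a where e: "e = \<bar>(\<Sum>p\<in>{p::nat. prime p \<and> p \<le> M \<and> [p = a] (mod q)}. ln (real p)) - real M / real (totient q)\<bar>"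
    and a: "a < q" by blast
  let ?S = "\<Sum>p\<in>{p::nat. prime p \<and> p \<le> M \<and> [p = a] (mod q)}. ln (real p)"
  have ln0: "0 \<le> ln (real p)" if "prime p" for p :: nat using prime_gt_0_nat[OF that] by simp
  have S0: "0 \<le> ?S" using ln0 by (intro sum_nonneg) auto
  have "?S \<le> (\<Sum>p\<in>{p::nat. prime p \<and> p \<le> M \<and> [p = a] (mod q)}. ln (real M))"
    by (intro sum_mono ln_mono) (auto simp: prime_gt_0_nat)
  also have "\<dots> \<le> (\<Sum>p\<in>{n::nat. n \<le> M \<and> [n = a] (mod q)}. ln (real M))"
    using M by (intro sum_mono2) auto
  also have "\<dots> = real (card {n::nat. n \<le> M \<and> [n = a] (mod q)}) * ln (real M)" by simp
  also have "\<dots> \<le> (real M / real q + 1) * ln (real M)"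
  proof (rule mult_right_mono)
    have "real (card {n::nat. n \<le> M \<and> [n = a] (mod q)}) \<le> (real M - real a) / real q + 1"
      by (rule card_residue_class_le(1)[OF a])
    also have "\<dots> \<le> real M / real q + 1" using q by (simp add: divide_right_mono)
    finally show "real (card {n::nat. n \<le> M \<and> [n = a] (mod q)}) \<le> real M / real q + 1" .
  qed (use M in auto)
  finally have "?S \<le> (real M / real q + 1) * ln (real M)" .
  moreover have "0 \<le> real M / real (totient q)" by simp
  ultimately show "e \<le> (real M / real q + 1) * ln (real M) + real M / real (totient q)"
    unfolding e using S0 by linarith
qed

lemma totient_prod_rough:
  assumes "finite C" "C \<subseteq> rough z"
  shows "real (totient (fact z * \<Prod>C)) = real (totient (fact z)) * (\<Prod>p\<in>C. real p - 1)"
proof -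
  have "totient (\<Prod>C) = (\<Prod>p\<in>C. totient p)"
    using assms rough_prime primes_coprime
    by (intro totient_prod_coprime) (auto simp: pairwise_def, blast)
  then have "real (totient (\<Prod>C)) = (\<Prod>p\<in>C. real (totient p))" by (simp add: of_nat_prod)
  also have "\<dots> = (\<Prod>p\<in>C. real p - 1)"
  proof (rule prod.cong[OF refl])
    fix p assume "p \<in> C"
    then have "prime p" using assms rough_prime by blast
    then show "real (totient p) = real p - 1"
      using prime_gt_0_nat[of p] by (simp add: totient_prime)
  qed
  finally show ?thesis
    using coprime_prod_rough_fact[OF assms] by (simp add: totient_mult_coprime coprime_commute)
qed

lemma ln_ge_1: "3 \<le> N \<Longrightarrow> 1 \<le> ln (real N)"
proof -
  assume N: "3 \<le> N"
  have "exp 1 \<le> real N" using N exp_le by linarith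
  then show ?thesis using N by (metis ln_ge_iff of_nat_0_less_iff less_le_trans zero_less_numeral)
qed

text \<open>Both trivial bounds in one shape. The factor 2^|C| comes from p \<le> 2 (p - 1) in the
  totient, and since the modulus is at most M the additive 1 is absorbed.\<close>

lemma rough_class_err_le:
  assumes C: "finite C" "C \<subseteq> rough z" and M: "3 \<le> M" "fact z * \<Prod>C \<le> M"
  shows "prime_err M (fact z * \<Prod>C) \<le> 4 * real M * ln (real M) * (2 ^ card C / real (\<Prod>C))"
    and "liouville_err M (fact z * \<Prod>C) \<le> 4 * real M * ln (real M) * (2 ^ card C / real (\<Prod>C))"
proof -
  let ?Q = "fact z * \<Prod>C"
  have P: "0 < \<Prod>C" using prod_rough_pos[OF C(2)] .
  have Q: "0 < ?Q" using P by simp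
  have lnM: "1 \<le> ln (real M)" by (rule ln_ge_1[OF M(1)])
  have MQ: "1 \<le> real M / real ?Q" using M Q by (subst le_divide_eq_1_pos) linarith+
  have "\<Prod>C \<le> ?Q" using fact_ge_1[of z] by simp
  then have "real (\<Prod>C) \<le> real ?Q" by (rule of_nat_mono)
  then have a: "real M / real ?Q \<le> real M / real (\<Prod>C)" using P by (intro divide_left_mono) auto
  have b: "real M / real (\<Prod>C) \<le> real M * (2 ^ card C / real (\<Prod>C))"
  proof -
    have "real M / real (\<Prod>C) * 1 \<le> real M / real (\<Prod>C) * 2 ^ card C" by (rule mult_left_mono) auto
    then show ?thesis by simp
  qed
  have "real (\<Prod>C) \<le> 2 ^ card C * (\<Prod>p\<in>C. real p - 1)"
  proof -
    have "real (\<Prod>C) = (\<Prod>p\<in>C. real p)" by (simp add: of_nat_prod)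
    also have "\<dots> \<le> (\<Prod>p\<in>C. 2 * (real p - 1))"
    proof (rule prod_mono)
      fix p assume "p \<in> C"
      then have "2 \<le> p" using C(2) rough_prime prime_ge_2_nat by blast
      then show "0 \<le> real p \<and> real p \<le> 2 * (real p - 1)" by simp
    qed
    finally show ?thesis by (simp only: prod.distrib prod_constant)
  qed
  moreover have "(\<Prod>p\<in>C. real p - 1) > 0"
  proof (rule prod_pos)
    fix p assume "p \<in> C"
    then have "2 \<le> p" using C(2) rough_prime prime_ge_2_nat by blast
    then show "0 < real p - 1" by simp
  qed
  ultimately have "1 / (\<Prod>p\<in>C. real p - 1) \<le> 2 ^ card C / real (\<Prod>C)"
    using P by (simp add: field_simps)
  moreover have "1 / real (totient ?Q) \<le> 1 / (\<Prod>p\<in>C. real p - 1)"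
  proof -
    have "1 \<le> real (totient (fact z))" using totient_gt_0_iff[of "fact z"] by (simp add: Suc_leI)
    then have "(\<Prod>p\<in>C. real p - 1) \<le> real (totient ?Q)"
      unfolding totient_prod_rough[OF C] using \<open>(\<Prod>p\<in>C. real p - 1) > 0\<close> by simp
    then show ?thesis using \<open>(\<Prod>p\<in>C. real p - 1) > 0\<close> by (intro frac_le) auto
  qed
  ultimately have "real M * (1 / real (totient ?Q)) \<le> real M * (2 ^ card C / real (\<Prod>C))"
    by (intro mult_left_mono) auto
  then have c: "real M / real (totient ?Q) \<le> real M * (2 ^ card C / real (\<Prod>C))" by simp
  define Y where "Y = real M * (2 ^ card C / real (\<Prod>C))"
  have Y: "real M / real ?Q \<le> Y" "real M / real (totient ?Q) \<le> Y" "1 \<le> Y"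
    using a b c MQ unfolding Y_def by linarith+
  have YL: "Y \<le> Y * ln (real M)" using Y(3) lnM mult_left_mono[of 1 "ln (real M)" Y] by simp
  have "prime_err M ?Q \<le> (real M / real ?Q + 1) * ln (real M) + real M / real (totient ?Q)"
    using Q M by (intro prime_err_le) auto
  also have "\<dots> \<le> (Y + Y) * ln (real M) + Y"
    using Y lnM by (intro add_mono mult_right_mono) auto
  also have "\<dots> \<le> 4 * (Y * ln (real M))" using YL Y(3) by (simp add: algebra_simps)
  finally show "prime_err M ?Q \<le> 4 * real M * ln (real M) * (2 ^ card C / real (\<Prod>C))"
    by (simp add: Y_def mult_ac)
  have "liouville_err M ?Q \<le> real M / real ?Q + 1" by (rule liouville_err_le[OF Q])
  also have "\<dots> \<le> 4 * (Y * ln (real M))" using Y YL by linarith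
  finally show "liouville_err M ?Q \<le> 4 * real M * ln (real M) * (2 ^ card C / real (\<Prod>C))"
    by (simp add: Y_def mult_ac)
qed

section \<open>Removing divisor weights from the error sums\<close>

lemma rsets_weighted_reciprocal_le:
  assumes y: "1 \<le> y"
  shows "(\<Sum>C\<in>rsets z y. real j ^ card C / real (\<Prod>C)) \<le> (ln y + real j * (fact z + 1)) ^ j"
proof -
  have "(\<Sum>C\<in>rsets z y. real j ^ card C / real (\<Prod>C)) = (\<Sum>C\<in>rsets z y. \<Prod>p\<in>C. real j * (1 / real p))"
    by (simp add: prod.distrib prod_dividef of_nat_prod)
  also have "\<dots> \<le> rdensity z ^ j * ppow j (ln y + real j * (fact z + 1))"
  proof (rule rsets_power_sum_le)
    show "(\<Sum>A\<in>rsets z x. \<Prod>p\<in>A. 1 / real p) \<le> rdensity z * (ln x + (fact z + 1))" if "1 \<le> x" for x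
      using rsets_reciprocal_sum_le[OF that, of z] by (simp add: prod_dividef of_nat_prod add.assoc)
  qed (use y rdensity_pos[of z] in auto)
  also have "\<dots> \<le> 1 * ppow j (ln y + real j * (fact z + 1))"
    using rdensity_pos[of z] rdensity_le_1[of z] by (intro mult_right_mono power_le_one) auto
  also have "\<dots> \<le> (ln y + real j * (fact z + 1)) ^ j"
  proof -
    have "0 \<le> ln y + real j * (fact z + 1)" using y by (intro add_nonneg_nonneg) auto
    moreover have "t / fact j \<le> t" if "0 \<le> t" for t :: real
      using that fact_ge_1[of j, where 'a = real] by (simp add: divide_le_eq mult_left_le mult_le_cancel_left1)
    ultimately show ?thesis by (simp add: ppow_def)
  qed
  finally show ?thesis .
qed

text \<open>The divisor weights \<open>m\<^sup>c\<close> are removed by AM-GM, \<open>2 m\<^sup>c \<le> m\<^sup>2\<^sup>c / T + T\<close> with \<open>T\<close> a power of the logarithm: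
  the first part is estimated trivially, the second by the level of distribution.\<close>

lemma weighted_error:
  fixes E :: "nat \<Rightarrow> nat \<Rightarrow> real"
  assumes lev: "\<And>A. 0 < A \<Longrightarrow> \<exists>C. \<forall>M::nat. M \<ge> 2 \<longrightarrow>
      (\<Sum>q\<in>{q::nat. 1 \<le> q \<and> real q \<le> real M powr \<theta>'}. E M q) \<le> C * real M / ln (real M) powr A"
    and nonneg: "\<And>M q. 0 < q \<Longrightarrow> 0 \<le> E M q"
    and triv: "\<And>M C. finite C \<Longrightarrow> C \<subseteq> rough z \<Longrightarrow> 3 \<le> M \<Longrightarrow> fact z * \<Prod>C \<le> M \<Longrightarrow>
      E M (fact z * \<Prod>C) \<le> 4 * real M * ln (real M) * (2 ^ card C / real (\<Prod>C))"
  shows "\<exists>K. \<forall>M y. 3 \<le> M \<longrightarrow> 1 \<le> y \<longrightarrow> fact z * y \<le> real M powr \<theta>' \<longrightarrow> fact z * y \<le> real M \<longrightarrow>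
     (\<Sum>C\<in>rsets z y. real m ^ card C * E M (fact z * \<Prod>C)) \<le> K * real M / ln (real M) ^ B"
proof -
  define j where "j = 2 * m\<^sup>2"
  define A where "A = 1 + j + 2 * B"
  obtain C0 where C0: "\<And>M::nat. M \<ge> 2 \<Longrightarrow>
      (\<Sum>q\<in>{q::nat. 1 \<le> q \<and> real q \<le> real M powr \<theta>'}. E M q) \<le> C0 * real M / ln (real M) powr real A"
    using lev[of "real A"] unfolding A_def by auto
  define K1 where "K1 = 4 * (1 + real j * (fact z + 1)) ^ j"
  have K1: "0 \<le> K1" by (simp add: K1_def)
  show ?thesis
  proof (intro exI[of _ "(K1 + C0) / 2"] allI impI)
    fix M :: nat and y :: real
    assume M: "3 \<le> M" and y: "1 \<le> y" and yM: "fact z * y \<le> real M powr \<theta>'" "fact z * y \<le> real M"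
    define L where "L = ln (real M)"
    have L: "1 \<le> L" unfolding L_def by (rule ln_ge_1[OF M])
    define T where "T = L ^ (1 + j + B)"
    have T: "0 < T" using L by (simp add: T_def)
    let ?E = "\<lambda>C. E M (fact z * \<Prod>C)"
    have Cpos: "0 < fact z * \<Prod>C" if "C \<in> rsets z y" for C using rsetsD(4)[OF that] by simp
    have Cle: "real (fact z * \<Prod>C) \<le> fact z * y" if "C \<in> rsets z y" for C
      using rsetsD(3)[OF that] by simp
    have E0: "0 \<le> ?E C" if "C \<in> rsets z y" for C using nonneg Cpos[OF that] by blast
    have "(\<Sum>C\<in>rsets z y. real (m\<^sup>2) ^ card C * ?E C) \<le> (\<Sum>C\<in>rsets z y. 4 * real M * L * (real j ^ card C / real (\<Prod>C)))"
    proof (rule sum_mono)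
      fix C assume C: "C \<in> rsets z y"
      have "real (fact z * \<Prod>C) \<le> real M" using Cle[OF C] yM by linarith
      then have "fact z * \<Prod>C \<le> M" by linarith
      then have "?E C \<le> 4 * real M * L * (2 ^ card C / real (\<Prod>C))"
        unfolding L_def using rsetsD(1,2)[OF C] M by (intro triv) auto
      then have "real (m\<^sup>2) ^ card C * ?E C \<le> real (m\<^sup>2) ^ card C * (4 * real M * L * (2 ^ card C / real (\<Prod>C)))"
        by (rule mult_left_mono) simp
      also have "\<dots> = 4 * real M * L * (real j ^ card C / real (\<Prod>C))"
        unfolding j_def by (simp add: power_mult_distrib)
      finally show "real (m\<^sup>2) ^ card C * ?E C \<le> 4 * real M * L * (real j ^ card C / real (\<Prod>C))" .
    qed
    also have "\<dots> = 4 * real M * L * (\<Sum>C\<in>rsets z y. real j ^ card C / real (\<Prod>C))"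
      by (rule sum_distrib_left[symmetric])
    also have "\<dots> \<le> 4 * real M * L * ((1 + real j * (fact z + 1)) ^ j * L ^ j)"
    proof (rule mult_left_mono)
      have "1 * y \<le> fact z * y" using y fact_ge_1[of z, where 'a = real] by (intro mult_right_mono) auto
      then have "y \<le> real M" using yM(2) by linarith
      then have "ln y \<le> L" unfolding L_def using y by (intro ln_mono) auto
      moreover have "real j * (fact z + 1) * 1 \<le> real j * (fact z + 1) * L"
        using L by (intro mult_left_mono) auto
      ultimately have "ln y + real j * (fact z + 1) \<le> (1 + real j * (fact z + 1)) * L"
        by (simp add: algebra_simps)
      then have "(ln y + real j * (fact z + 1)) ^ j \<le> ((1 + real j * (fact z + 1)) * L) ^ j"
        using y by (intro power_mono add_nonneg_nonneg) auto
      then show "(\<Sum>C\<in>rsets z y. real j ^ card C / real (\<Prod>C)) \<le> (1 + real j * (fact z + 1)) ^ j * L ^ j"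
        using rsets_weighted_reciprocal_le[OF y, where z = z and j = j] by (simp add: power_mult_distrib)
    qed (use L in auto)
    also have "\<dots> = K1 * real M * L ^ (1 + j)" by (simp add: K1_def)
    finally have S1: "(\<Sum>C\<in>rsets z y. real (m\<^sup>2) ^ card C * ?E C) \<le> K1 * real M * L ^ (1 + j)" .
    \<comment> \<open>Distinct \<open>C\<close> give distinct moduli, so the sum is part of the one
      over all \<open>q\<close> in the level condition.\<close>
    have "(\<Sum>C\<in>rsets z y. ?E C) = (\<Sum>q\<in>(\<lambda>C. fact z * \<Prod>C) ` rsets z y. E M q)"
    proof (subst sum.reindex)
      have "inj_on Prod (rsets z y)"
        by (rule inj_on_subset[OF inj_on_prod_rough[of z]]) (auto simp: rsets_def)
      then show "inj_on (\<lambda>C. fact z * \<Prod>C) (rsets z y)" by (auto simp: inj_on_def)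
    qed simp
    also have "\<dots> \<le> (\<Sum>q\<in>{q::nat. 1 \<le> q \<and> real q \<le> real M powr \<theta>'}. E M q)"
    proof (rule sum_mono2)
      show "finite {q::nat. 1 \<le> q \<and> real q \<le> real M powr \<theta>'}"
        by (rule finite_subset[OF _ finite_nat_real_le[of "real M powr \<theta>'"]]) auto
      show "(\<lambda>C. fact z * \<Prod>C) ` rsets z y \<subseteq> {q::nat. 1 \<le> q \<and> real q \<le> real M powr \<theta>'}"
      proof (rule image_subsetI)
        fix C assume C: "C \<in> rsets z y"
        show "fact z * \<Prod>C \<in> {q::nat. 1 \<le> q \<and> real q \<le> real M powr \<theta>'}"
        proof (intro CollectI conjI)
          show "1 \<le> fact z * \<Prod>C" using Cpos[OF C] by linarith
          show "real (fact z * \<Prod>C) \<le> real M powr \<theta>'" by (rule order_trans[OF Cle[OF C] yM(1)])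
        qed
      qed
    qed (use nonneg in auto)
    also have "\<dots> \<le> C0 * real M / L ^ A"
      using C0[of M] M L unfolding L_def by (simp add: powr_realpow)
    finally have S2: "(\<Sum>C\<in>rsets z y. ?E C) \<le> C0 * real M / L ^ A" .
    have "(\<Sum>C\<in>rsets z y. real m ^ card C * ?E C) \<le> (\<Sum>C\<in>rsets z y. (real (m\<^sup>2) ^ card C * ?E C / T + T * ?E C) / 2)"
    proof (rule sum_mono)
      fix C assume C: "C \<in> rsets z y"
      define x where "x = real m ^ card C"
      have x2: "real (m\<^sup>2) ^ card C = x\<^sup>2" by (simp add: x_def power_mult[symmetric] mult.commute)
      have "0 \<le> (x - T)\<^sup>2" by simp
      then have "2 * x * T \<le> x\<^sup>2 + T * T" by (simp add: power2_eq_square algebra_simps)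
      then have "x \<le> (x\<^sup>2 / T + T) / 2" using T by (simp add: field_simps)
      then have "x * ?E C \<le> (x\<^sup>2 / T + T) / 2 * ?E C" using E0[OF C] by (rule mult_right_mono)
      then show "real m ^ card C * ?E C \<le> (real (m\<^sup>2) ^ card C * ?E C / T + T * ?E C) / 2"
        unfolding x2 x_def[symmetric] by (simp add: algebra_simps)
    qed
    also have "\<dots> = ((\<Sum>C\<in>rsets z y. real (m\<^sup>2) ^ card C * ?E C) / T + T * (\<Sum>C\<in>rsets z y. ?E C)) / 2"
      by (simp only: sum_divide_distrib[symmetric] sum.distrib sum_distrib_left[symmetric])
    also have "\<dots> \<le> (K1 * real M * L ^ (1 + j) / T + T * (C0 * real M / L ^ A)) / 2"
      using S1 S2 T by (intro divide_right_mono add_mono mult_left_mono) auto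
    also have "K1 * real M * L ^ (1 + j) / T = K1 * real M / L ^ B"
      unfolding T_def using L by (simp add: power_add)
    also have "T * (C0 * real M / L ^ A) = C0 * real M / L ^ B"
    proof -
      have "A = (1 + j + B) + B" by (simp add: A_def)
      then have "L ^ A = T * L ^ B" unfolding T_def by (simp only: power_add)
      then show ?thesis using T by simp
    qed
    finally show "(\<Sum>C\<in>rsets z y. real m ^ card C * ?E C) \<le> (K1 + C0) / 2 * real M / ln (real M) ^ B"
      unfolding L_def[symmetric] by (simp add: add_divide_distrib[symmetric] algebra_simps)
  qed
qed

section \<open>Sieve sums in a fixed class modulo \<open>fact z\<close>\<close>

definition sieve_range :: "nat \<Rightarrow> nat \<Rightarrow> nat \<Rightarrow> nat set" where
  "sieve_range z b N = {n \<in> {N<..2 * N}. [n = b] (mod fact z)}"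

lemma finite_sieve_range [simp]: "finite (sieve_range z b N)"
  by (simp add: sieve_range_def)

lemma sieve_class:
  fixes \<sigma> :: "nat \<Rightarrow> nat"
  assumes C: "finite C" "C \<subseteq> rough z"
  shows "\<exists>a < fact z * \<Prod>C. [a = b] (mod fact z) \<and> (\<forall>p\<in>C. p dvd a + \<sigma> p) \<and>
    {n \<in> sieve_range z b N. \<forall>p\<in>C. p dvd n + \<sigma> p} = {n \<in> {N<..2 * N}. [n = a] (mod fact z * \<Prod>C)}"
proof -
  obtain a where a: "a < fact z * \<Prod>C"
    "\<And>n. ([n = b] (mod fact z) \<and> (\<forall>p\<in>C. p dvd n + \<sigma> p)) \<longleftrightarrow> [n = a] (mod fact z * \<Prod>C)"
    using rough_residue_class[OF C, of b \<sigma>] by blast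
  have "[a = b] (mod fact z) \<and> (\<forall>p\<in>C. p dvd a + \<sigma> p)" using a(2)[of a] by simp
  moreover have "{n \<in> sieve_range z b N. \<forall>p\<in>C. p dvd n + \<sigma> p} = {n \<in> {N<..2 * N}. [n = a] (mod fact z * \<Prod>C)}"
    unfolding sieve_range_def using a(2) by blast
  ultimately show ?thesis using a(1) by (intro exI[of _ a]) simp
qed

lemma sum_interval_diff:
  fixes f :: "nat \<Rightarrow> real"
  shows "(\<Sum>n\<in>{n. A < n \<and> n \<le> A + L \<and> P n}. f n) = (\<Sum>n\<in>{n. n \<le> A + L \<and> P n}. f n) - (\<Sum>n\<in>{n. n \<le> A \<and> P n}. f n)"
proof -
  have "{n. n \<le> A + L \<and> P n} = {n. A < n \<and> n \<le> A + L \<and> P n} \<union> {n. n \<le> A \<and> P n}" by auto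
  moreover have "(\<Sum>n\<in>{n. A < n \<and> n \<le> A + L \<and> P n} \<union> {n. n \<le> A \<and> P n}. f n) =
     (\<Sum>n\<in>{n. A < n \<and> n \<le> A + L \<and> P n}. f n) + (\<Sum>n\<in>{n. n \<le> A \<and> P n}. f n)"
    by (rule sum.union_disjoint) auto
  ultimately show ?thesis by simp
qed

text \<open>The conditions form one class modulo \<open>fact z * \<Prod>C\<close>, and an interval
  of length N meets it N / Q times up to 1.\<close>

lemma sieve_count_estimate:
  fixes \<sigma> :: "nat \<Rightarrow> nat"
  assumes C: "finite C" "C \<subseteq> rough z"
  shows "\<bar>(\<Sum>n\<in>{n \<in> sieve_range z b N. \<forall>p\<in>C. p dvd n + \<sigma> p}. 1) - real N / fact z * (\<Prod>p\<in>C. 1 / real p)\<bar> \<le> 1"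
proof -
  obtain a where a: "a < fact z * \<Prod>C" "[a = b] (mod fact z)" "\<And>p. p \<in> C \<Longrightarrow> p dvd a + \<sigma> p"
    "{n \<in> sieve_range z b N. \<forall>p\<in>C. p dvd n + \<sigma> p} = {n \<in> {N<..2 * N}. [n = a] (mod fact z * \<Prod>C)}"
    using sieve_class[OF C, of b \<sigma> N] by blast
  define Q where "Q = fact z * \<Prod>C"
  have "(\<Sum>n\<in>{n \<in> sieve_range z b N. \<forall>p\<in>C. p dvd n + \<sigma> p}. 1) = (\<Sum>n\<in>{n. N < n \<and> n \<le> N + N \<and> [n = a] (mod Q)}. 1::real)"
    unfolding a(4) Q_def by (rule sum.cong) auto
  also have "\<dots> = (\<Sum>n\<in>{n. n \<le> N + N \<and> [n = a] (mod Q)}. 1) - (\<Sum>n\<in>{n. n \<le> N \<and> [n = a] (mod Q)}. 1)"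
    by (rule sum_interval_diff)
  also have "\<dots> = real (card {n. n \<le> N + N \<and> [n = a] (mod Q)}) - real (card {n. n \<le> N \<and> [n = a] (mod Q)})"
    by simp
  finally have e: "(\<Sum>n\<in>{n \<in> sieve_range z b N. \<forall>p\<in>C. p dvd n + \<sigma> p}. 1) = \<dots>" .
  have aQ: "a < Q" using a(1) by (simp add: Q_def)
  have "real N / fact z * (\<Prod>p\<in>C. 1 / real p) = real N / real Q"
    by (simp add: Q_def prod_dividef of_nat_prod)
  moreover have "(real (N + N) - real a) / real Q - (real N - real a) / real Q = real N / real Q"
    by (simp add: diff_divide_distrib[symmetric])
  ultimately show ?thesis
    unfolding e using card_residue_class_le[OF aQ, of "N + N"] card_residue_class_le[OF aQ, of N] by linarith
qed

text \<open>The class of \<open>n + h\<close> is reduced: modulo \<open>fact z\<close> by the choice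
  of \<open>b\<close>, and modulo p in \<open>C\<close> because p already divides the shift by
  \<open>\<sigma> p \<noteq> h\<close>. There is no maximum over y in (A), so each endpoint has its
  own error.\<close>

lemma sieve_prime_estimate:
  fixes \<sigma> :: "nat \<Rightarrow> nat"
  assumes C: "finite C" "C \<subseteq> rough z" and h: "h \<le> z" "coprime (b + h) (fact z)"
    and \<sigma>: "\<And>p. p \<in> C \<Longrightarrow> \<sigma> p \<le> z \<and> \<sigma> p \<noteq> h"
  shows "\<bar>(\<Sum>n\<in>{n \<in> sieve_range z b N. \<forall>p\<in>C. p dvd n + \<sigma> p}. if prime (n + h) then ln (real (n + h)) else 0) -
      real N / real (totient (fact z)) * (\<Prod>p\<in>C. 1 / (real p - 1))\<bar>
    \<le> prime_err (2 * N + h) (fact z * \<Prod>C) + prime_err (N + h) (fact z * \<Prod>C)"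
proof -
  obtain a where a: "a < fact z * \<Prod>C" "[a = b] (mod fact z)" "\<And>p. p \<in> C \<Longrightarrow> p dvd a + \<sigma> p"
    "{n \<in> sieve_range z b N. \<forall>p\<in>C. p dvd n + \<sigma> p} = {n \<in> {N<..2 * N}. [n = a] (mod fact z * \<Prod>C)}"
    using sieve_class[OF C, of b \<sigma> N] by blast
  define Q where "Q = fact z * \<Prod>C"
  have Q: "0 < Q" using a(1) unfolding Q_def by linarith
  define a' where "a' = (a + h) mod Q"
  have a'Q: "a' < Q" using Q by (simp add: a'_def)
  have "coprime (a + h) (fact z)"
  proof -
    have "[a + h = b + h] (mod fact z)" using a(2) by (intro cong_add) auto
    then show ?thesis using h(2) cong_imp_coprime cong_sym by blast
  qed
  moreover have "coprime (a + h) (\<Prod>C)"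
  proof (rule prod_coprime_right)
    fix p assume p: "p \<in> C"
    have "\<not> p dvd a + h"
      using rough_dvd_unique[of p z a h "\<sigma> p"] p C(2) a(3)[OF p] \<sigma>[OF p] h(1) by blast
    then show "coprime (a + h) p" using p C(2) rough_prime prime_imp_coprime coprime_commute by blast
  qed
  ultimately have "coprime (a + h) Q" by (simp add: Q_def)
  then have cop: "coprime a' Q" using Q by (simp add: a'_def)
  define S where "S = (\<lambda>M. \<Sum>p\<in>{p::nat. prime p \<and> p \<le> M \<and> [p = a'] (mod Q)}. ln (real p))"
  have "(\<Sum>n\<in>{n \<in> sieve_range z b N. \<forall>p\<in>C. p dvd n + \<sigma> p}. if prime (n + h) then ln (real (n + h)) else 0) =
    (\<Sum>n\<in>{n \<in> {n \<in> {N<..2 * N}. [n = a] (mod Q)}. prime (n + h)}. ln (real (n + h)))"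
    unfolding a(4) Q_def[symmetric] by (rule sum.inter_filter[symmetric]) simp
  also have "\<dots> = (\<Sum>p\<in>{p. N + h < p \<and> p \<le> (N + h) + N \<and> (prime p \<and> [p = a'] (mod Q))}. ln (real p))"
  proof (rule sum.reindex_bij_witness[where i = "\<lambda>p. p - h" and j = "\<lambda>n. n + h"], goal_cases)
    case (2 n)
    then have "[n + h = a + h] (mod Q)" by (intro cong_add) auto
    then have "[n + h = a'] (mod Q)" unfolding a'_def by simp
    then show ?case using 2 by auto
  next
    case (4 p)
    then have "[(p - h) + h = a + h] (mod Q)" unfolding a'_def by simp
    then have "[p - h = a] (mod Q)" by (simp only: cong_add_rcancel_nat)
    then show ?case using 4 by auto
  qed auto
  also have "\<dots> = S (2 * N + h) - S (N + h)"
  proof -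
    have e: "(N + h) + N = 2 * N + h" by simp
    show ?thesis unfolding sum_interval_diff unfolding S_def e by (intro arg_cong2[where f = "(-)"] sum.cong) auto
  qed
  finally have *: "(\<Sum>n\<in>{n \<in> sieve_range z b N. \<forall>p\<in>C. p dvd n + \<sigma> p}. if prime (n + h) then ln (real (n + h)) else 0) = S (2 * N + h) - S (N + h)" .
  have "real N / real (totient (fact z)) * (\<Prod>p\<in>C. 1 / (real p - 1)) = real N / real (totient Q)"
    unfolding Q_def totient_prod_rough[OF C] by (simp add: prod_dividef)
  moreover have "real (2 * N + h) / real (totient Q) - real (N + h) / real (totient Q) = real N / real (totient Q)"
    by (simp add: diff_divide_distrib[symmetric])
  ultimately show ?thesis
    unfolding * Q_def[symmetric]
    using prime_err_ge[OF a'Q cop, of "2 * N + h"] prime_err_ge[OF a'Q cop, of "N + h"]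
    unfolding S_def by linarith
qed

text \<open>The maxima over all residues and all y in (B) make any class admissible and let one
  error term serve both endpoints.\<close>

lemma sieve_liouville_estimate:
  fixes \<sigma> :: "nat \<Rightarrow> nat"
  assumes C: "finite C" "C \<subseteq> rough z"
  shows "\<bar>(\<Sum>n\<in>{n \<in> sieve_range z b N. \<forall>p\<in>C. p dvd n + \<sigma> p}. real_of_int (liouville (n + 1)))\<bar>
    \<le> 2 * liouville_err (2 * N + 1) (fact z * \<Prod>C)"
proof -
  obtain a where a: "a < fact z * \<Prod>C" "[a = b] (mod fact z)" "\<And>p. p \<in> C \<Longrightarrow> p dvd a + \<sigma> p"
    "{n \<in> sieve_range z b N. \<forall>p\<in>C. p dvd n + \<sigma> p} = {n \<in> {N<..2 * N}. [n = a] (mod fact z * \<Prod>C)}"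
    using sieve_class[OF C, of b \<sigma> N] by blast
  define Q where "Q = fact z * \<Prod>C"
  have Q: "0 < Q" using a(1) unfolding Q_def by linarith
  define a' where "a' = (a + 1) mod Q"
  have a'Q: "a' < Q" using Q by (simp add: a'_def)
  define S where "S = (\<lambda>y. real_of_int (\<Sum>n\<in>{n::nat. 1 \<le> n \<and> n \<le> y \<and> [n = a'] (mod Q)}. liouville n))"
  have "(\<Sum>n\<in>{n \<in> sieve_range z b N. \<forall>p\<in>C. p dvd n + \<sigma> p}. real_of_int (liouville (n + 1))) =
    (\<Sum>m\<in>{m. N + 1 < m \<and> m \<le> (N + 1) + N \<and> (1 \<le> m \<and> [m = a'] (mod Q))}. real_of_int (liouville m))"
    unfolding a(4) Q_def[symmetric]
  proof (rule sum.reindex_bij_witness[where i = "\<lambda>p. p - 1" and j = "\<lambda>n. n + 1"], goal_cases)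
    case (2 n)
    then have "[n + 1 = a + 1] (mod Q)" by (intro cong_add) auto
    then have "[n + 1 = a'] (mod Q)" unfolding a'_def by simp
    then show ?case using 2 by auto
  next
    case (4 p)
    then have "[(p - 1) + 1 = a + 1] (mod Q)" unfolding a'_def by simp
    then have "[p - 1 = a] (mod Q)" by (simp only: cong_add_rcancel_nat)
    then show ?case using 4 by auto
  qed auto
  also have "\<dots> = S (2 * N + 1) - S (N + 1)"
  proof -
    have e: "(N + 1) + N = 2 * N + 1" by simp
    show ?thesis unfolding sum_interval_diff unfolding S_def e of_int_sum by (intro arg_cong2[where f = "(-)"] sum.cong) auto
  qed
  finally have *: "(\<Sum>n\<in>{n \<in> sieve_range z b N. \<forall>p\<in>C. p dvd n + \<sigma> p}. real_of_int (liouville (n + 1))) = S (2 * N + 1) - S (N + 1)" .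
  show ?thesis
    unfolding * Q_def[symmetric]
    using liouville_err_ge[OF a'Q, of "2 * N + 1" "2 * N + 1"] liouville_err_ge[OF a'Q, of "N + 1" "2 * N + 1"]
    unfolding S_def by linarith
qed

section \<open>Primes against the Liouville function\<close>

text \<open>All averages use the same nonnegative weight \<open>w\<close>. Each prime sum loses 2
  \<open>\<delta>\<close>, one per endpoint; on the right, counting costs \<open>\<delta>\<close>
  and the Liouville sum 2 \<open>\<delta>\<close>. Weighting primes by logarithms costs the factor
  ln(2N + z).\<close>

lemma sieve_inequality:
  fixes H :: "nat set" and c R \<Lambda> \<delta> :: real
  assumes H: "finite H" "H \<subseteq> {..z}" "card H = k" and k: "2 \<le> k" "2 * k \<le> z" and c: "0 \<le> c"
    and R: "1 \<le> R" "R \<le> real N"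
    and b: "\<And>h. h \<in> H \<Longrightarrow> coprime (b + h) (fact z)"
    and hyp: "\<And>n. n \<in> {N<..2 * N} \<Longrightarrow> (\<Sum>h\<in>H. of_bool (prime (n + h))) \<le> (1 + real_of_int (liouville (n + 1))) / 2"
    and \<Lambda>: "\<And>A. A \<in> rsets z R \<Longrightarrow> \<bar>scoeff z k R (sweight R c) A\<bar> \<le> \<Lambda>"
    and e1: "\<Lambda>\<^sup>2 * (\<Sum>C\<in>rsets z (R * R). real (4 * k) ^ card C * 1) \<le> \<delta>"
    and e2: "\<And>h. h \<in> H \<Longrightarrow> \<Lambda>\<^sup>2 * (\<Sum>C\<in>rsets z (R * R). real (4 * k) ^ card C * prime_err (2 * N + h) (fact z * \<Prod>C)) \<le> \<delta>"
      "\<And>h. h \<in> H \<Longrightarrow> \<Lambda>\<^sup>2 * (\<Sum>C\<in>rsets z (R * R). real (4 * k) ^ card C * prime_err (N + h) (fact z * \<Prod>C)) \<le> \<delta>"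
    and e3: "\<Lambda>\<^sup>2 * (\<Sum>C\<in>rsets z (R * R). real (4 * k) ^ card C * liouville_err (2 * N + 1) (fact z * \<Prod>C)) \<le> \<delta>"
  defines "X \<equiv> ln R + real k * (fact z + 1)"
  shows "real k * (real N / real (totient (fact z)) * (rdensity z ^ (k + 1) *
        (2 * (ln R)\<^sup>2 * ppow (k + 1) (ln R) + 6 * c * ln R * ppow (k + 2) (ln R) + 6 * c\<^sup>2 * ppow (k + 3) (ln R))) - 2 * \<delta>)
    \<le> ln (real (2 * N + z)) / 2 * (real N / fact z * ((exp (2 * real k / real z) * rdensity z) ^ k *
      ((ln R)\<^sup>2 * ppow k X + 2 * c * ln R * ppow (k + 1) X + 2 * c\<^sup>2 * ppow (k + 2) X)) + 3 * \<delta>)"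
proof -
  let ?l = "scoeff z k R (sweight R c)"
  let ?I = "sieve_range z b N"
  define w where "w = (\<lambda>n. (\<Sum>A\<in>{A \<in> rsets z R. hits H n A}. ?l A)\<^sup>2)"
  have w0: "0 \<le> w n" for n by (simp add: w_def)
  have Cpos: "0 < fact z * \<Prod>C" if "C \<in> rsets z y" for C y using rsetsD(4)[OF that] by simp
  define Q1 where "Q1 = (\<Sum>A\<in>rsets z R. \<Sum>B\<in>rsets z R. ?l A * ?l B * (\<Prod>p\<in>A \<union> B. real k / real p))"
  define Q2 where "Q2 = (\<Sum>A\<in>rsets z R. \<Sum>B\<in>rsets z R. ?l A * ?l B * (\<Prod>p\<in>A \<union> B. real (k - 1) / (real p - 1)))"

  have "\<bar>(\<Sum>n\<in>?I. 1 * (\<Sum>A\<in>{A \<in> rsets z R. hits H n A}. ?l A)\<^sup>2) -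
      real N / fact z * (\<Sum>A\<in>rsets z R. \<Sum>B\<in>rsets z R. ?l A * ?l B * (\<Prod>p\<in>A \<union> B. real (card H) * (1 / real p)))\<bar>
    \<le> \<Lambda>\<^sup>2 * (\<Sum>C\<in>rsets z (R * R). real (4 * card H) ^ card C * 1)"
  proof (rule sieve_expand[OF H(1,2)])
    fix C \<sigma> assume "C \<in> rsets z (R * R)" "\<sigma> \<in> PiE C (\<lambda>_. H)"
    then show "\<bar>(\<Sum>n\<in>{n \<in> ?I. \<forall>p\<in>C. p dvd n + \<sigma> p}. 1) - real N / fact z * (\<Prod>p\<in>C. 1 / real p)\<bar> \<le> 1"
      by (intro sieve_count_estimate rsetsD)
  qed (use \<Lambda> in auto)
  then have S1: "(\<Sum>n\<in>?I. w n) \<le> real N / fact z * Q1 + \<delta>"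
    using e1 unfolding w_def Q1_def H(3) by simp

  have "\<bar>(\<Sum>n\<in>?I. real_of_int (liouville (n + 1)) * (\<Sum>A\<in>{A \<in> rsets z R. hits H n A}. ?l A)\<^sup>2) -
      0 * (\<Sum>A\<in>rsets z R. \<Sum>B\<in>rsets z R. ?l A * ?l B * (\<Prod>p\<in>A \<union> B. real (card H) * 0))\<bar>
    \<le> \<Lambda>\<^sup>2 * (\<Sum>C\<in>rsets z (R * R). real (4 * card H) ^ card C * (2 * liouville_err (2 * N + 1) (fact z * \<Prod>C)))"
  proof (rule sieve_expand[OF H(1,2)])
    fix C \<sigma> assume "C \<in> rsets z (R * R)" "\<sigma> \<in> PiE C (\<lambda>_. H)"
    then show "\<bar>(\<Sum>n\<in>{n \<in> ?I. \<forall>p\<in>C. p dvd n + \<sigma> p}. real_of_int (liouville (n + 1))) - 0 * (\<Prod>p\<in>C. 0)\<bar>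
       \<le> 2 * liouville_err (2 * N + 1) (fact z * \<Prod>C)"
      using sieve_liouville_estimate[of C z b N \<sigma>] rsetsD(1,2)[of C z "R * R"] by simp
  next
    fix C assume "C \<in> rsets z (R * R)"
    then show "0 \<le> 2 * liouville_err (2 * N + 1) (fact z * \<Prod>C)"
      using liouville_err_nonneg[OF Cpos] by simp
  qed (use \<Lambda> in auto)
  also have "\<Lambda>\<^sup>2 * (\<Sum>C\<in>rsets z (R * R). real (4 * card H) ^ card C * (2 * liouville_err (2 * N + 1) (fact z * \<Prod>C))) =
    2 * (\<Lambda>\<^sup>2 * (\<Sum>C\<in>rsets z (R * R). real (4 * k) ^ card C * liouville_err (2 * N + 1) (fact z * \<Prod>C)))"
    unfolding H(3) by (simp only: sum_distrib_left mult_ac)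
  finally have SB: "(\<Sum>n\<in>?I. real_of_int (liouville (n + 1)) * w n) \<le> 2 * \<delta>"
    using e3 unfolding w_def by simp

  have S2: "real N / real (totient (fact z)) * Q2 - 2 * \<delta> \<le> (\<Sum>n\<in>?I. (if prime (n + h) then ln (real (n + h)) else 0) * w n)"
    if h: "h \<in> H" for h
  proof -
    have H': "finite (H - {h})" "H - {h} \<subseteq> {..z}" "card (H - {h}) = k - 1" using H h by auto
    have "\<bar>(\<Sum>n\<in>?I. (if prime (n + h) then ln (real (n + h)) else 0) * (\<Sum>A\<in>{A \<in> rsets z R. hits (H - {h}) n A}. ?l A)\<^sup>2) -
      real N / real (totient (fact z)) * (\<Sum>A\<in>rsets z R. \<Sum>B\<in>rsets z R. ?l A * ?l B * (\<Prod>p\<in>A \<union> B. real (card (H - {h})) * (1 / (real p - 1))))\<bar>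
    \<le> \<Lambda>\<^sup>2 * (\<Sum>C\<in>rsets z (R * R). real (4 * card (H - {h})) ^ card C *
        (prime_err (2 * N + h) (fact z * \<Prod>C) + prime_err (N + h) (fact z * \<Prod>C)))"
    proof (rule sieve_expand[OF H'(1,2)])
      fix C \<sigma> assume C: "C \<in> rsets z (R * R)" and \<sigma>: "\<sigma> \<in> PiE C (\<lambda>_. H - {h})"
      show "\<bar>(\<Sum>n\<in>{n \<in> ?I. \<forall>p\<in>C. p dvd n + \<sigma> p}. if prime (n + h) then ln (real (n + h)) else 0) -
          real N / real (totient (fact z)) * (\<Prod>p\<in>C. 1 / (real p - 1))\<bar>
        \<le> prime_err (2 * N + h) (fact z * \<Prod>C) + prime_err (N + h) (fact z * \<Prod>C)"
      proof (rule sieve_prime_estimate[OF rsetsD(1,2)[OF C] _ b[OF h]])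
        show "h \<le> z" using H(2) h by auto
        fix p assume "p \<in> C"
        then show "\<sigma> p \<le> z \<and> \<sigma> p \<noteq> h" using PiE_mem[OF \<sigma>, of p] H'(2) by auto
      qed
    next
      fix C assume "C \<in> rsets z (R * R)"
      then show "0 \<le> prime_err (2 * N + h) (fact z * \<Prod>C) + prime_err (N + h) (fact z * \<Prod>C)"
        using prime_err_nonneg[OF Cpos] by simp
    qed (use \<Lambda> in auto)
    also have "\<Lambda>\<^sup>2 * (\<Sum>C\<in>rsets z (R * R). real (4 * card (H - {h})) ^ card C *
        (prime_err (2 * N + h) (fact z * \<Prod>C) + prime_err (N + h) (fact z * \<Prod>C))) \<le>
       \<Lambda>\<^sup>2 * (\<Sum>C\<in>rsets z (R * R). real (4 * k) ^ card C *
        (prime_err (2 * N + h) (fact z * \<Prod>C) + prime_err (N + h) (fact z * \<Prod>C)))"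
      unfolding H'(3) using prime_err_nonneg[OF Cpos]
      by (intro mult_left_mono sum_mono mult_right_mono power_mono add_nonneg_nonneg) auto
    also have "\<dots> = \<Lambda>\<^sup>2 * (\<Sum>C\<in>rsets z (R * R). real (4 * k) ^ card C * prime_err (2 * N + h) (fact z * \<Prod>C)) +
       \<Lambda>\<^sup>2 * (\<Sum>C\<in>rsets z (R * R). real (4 * k) ^ card C * prime_err (N + h) (fact z * \<Prod>C))"
      by (simp only: distrib_left sum.distrib)
    also have "\<dots> \<le> \<delta> + \<delta>" using e2[OF h] by (rule add_mono)
    finally have "real N / real (totient (fact z)) * (\<Sum>A\<in>rsets z R. \<Sum>B\<in>rsets z R. ?l A * ?l B * (\<Prod>p\<in>A \<union> B. real (card (H - {h})) * (1 / (real p - 1)))) - 2 * \<delta>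
      \<le> (\<Sum>n\<in>?I. (if prime (n + h) then ln (real (n + h)) else 0) * (\<Sum>A\<in>{A \<in> rsets z R. hits (H - {h}) n A}. ?l A)\<^sup>2)"
      by linarith
    also have "\<dots> = (\<Sum>n\<in>?I. (if prime (n + h) then ln (real (n + h)) else 0) * w n)"
    proof (rule sum.cong[OF refl])
      fix n assume n: "n \<in> ?I"
      have "hits (H - {h}) n A \<longleftrightarrow> hits H n A" if A: "A \<in> rsets z R" and pr: "prime (n + h)" for A
      proof -
        have "\<not> p dvd n + h" if p: "p \<in> A" for p
        proof
          assume "p dvd n + h"
          moreover have "prime p" using p rsetsD(2)[OF A] rough_prime by blast
          ultimately have "p = n + h" using pr primes_dvd_imp_eq by blast
          moreover have "real p \<le> R" using rsets_member_le[OF A p] .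
          ultimately show False using n R(2) by (simp add: sieve_range_def)
        qed
        then show ?thesis unfolding hits_def by (metis Diff_iff singletonD)
      qed
      then have "prime (n + h) \<Longrightarrow> {A \<in> rsets z R. hits (H - {h}) n A} = {A \<in> rsets z R. hits H n A}" by blast
      then show "(if prime (n + h) then ln (real (n + h)) else 0) * (\<Sum>A\<in>{A \<in> rsets z R. hits (H - {h}) n A}. ?l A)\<^sup>2 =
         (if prime (n + h) then ln (real (n + h)) else 0) * w n"
        unfolding w_def by simp
    qed
    finally show ?thesis unfolding Q2_def H'(3) by simp
  qed

  define LN where "LN = ln (real (2 * N + z))"
  have N1: "1 \<le> N" using R by linarith
  have LN0: "0 \<le> LN" unfolding LN_def using N1 by simp
  have "real k * (real N / real (totient (fact z)) * Q2 - 2 * \<delta>) =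
     (\<Sum>h\<in>H. real N / real (totient (fact z)) * Q2 - 2 * \<delta>)" using H(3) by simp
  also have "\<dots> \<le> (\<Sum>h\<in>H. \<Sum>n\<in>?I. (if prime (n + h) then ln (real (n + h)) else 0) * w n)"
    by (rule sum_mono) (rule S2)
  also have "\<dots> = (\<Sum>n\<in>?I. \<Sum>h\<in>H. (if prime (n + h) then ln (real (n + h)) else 0) * w n)"
    by (rule sum.swap)
  also have "\<dots> \<le> (\<Sum>n\<in>?I. LN * ((1 + real_of_int (liouville (n + 1))) / 2) * w n)"
  proof (rule sum_mono)
    fix n assume n: "n \<in> ?I"
    then have n': "n \<in> {N<..2 * N}" by (simp add: sieve_range_def)
    have "(\<Sum>h\<in>H. (if prime (n + h) then ln (real (n + h)) else 0) * w n) \<le> (\<Sum>h\<in>H. LN * of_bool (prime (n + h)) * w n)"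
    proof (intro sum_mono mult_right_mono w0)
      fix h assume "h \<in> H"
      then have "n + h \<le> 2 * N + z" using H(2) n' by (intro add_mono) auto
      then have "ln (real (n + h)) \<le> LN" unfolding LN_def using n' by (intro ln_mono) auto
      then show "(if prime (n + h) then ln (real (n + h)) else 0) \<le> LN * of_bool (prime (n + h))" by simp
    qed
    also have "\<dots> = LN * (\<Sum>h\<in>H. of_bool (prime (n + h))) * w n"
      by (simp only: sum_distrib_left sum_distrib_right)
    also have "\<dots> \<le> LN * ((1 + real_of_int (liouville (n + 1))) / 2) * w n"
      using hyp[OF n'] LN0 w0 by (intro mult_right_mono mult_left_mono) auto
    finally show "(\<Sum>h\<in>H. (if prime (n + h) then ln (real (n + h)) else 0) * w n) \<le> \<dots>" .
  qed
  also have "\<dots> = LN / 2 * ((\<Sum>n\<in>?I. w n) + (\<Sum>n\<in>?I. real_of_int (liouville (n + 1)) * w n))"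
    unfolding sum.distrib[symmetric] sum_distrib_left by (intro sum.cong refl) (simp add: algebra_simps add_divide_distrib)
  also have "\<dots> \<le> LN / 2 * (real N / fact z * Q1 + 3 * \<delta>)"
    using S1 SB LN0 by (intro mult_left_mono) auto
  finally have main: "real k * (real N / real (totient (fact z)) * Q2 - 2 * \<delta>) \<le> LN / 2 * (real N / fact z * Q1 + 3 * \<delta>)" .

  have "Q1 \<le> (exp (2 * real k / real z) * rdensity z) ^ k *
      ((ln R)\<^sup>2 * ppow k X + 2 * c * ln R * ppow (k + 1) X + 2 * c\<^sup>2 * ppow (k + 2) X)"
  proof -
    have e: "Q1 = (\<Sum>C\<in>rsets z R. (\<Prod>p\<in>C. real k / (real p - real k)) * (sweight R c C)\<^sup>2)"
      unfolding Q1_def by (rule scoeff_form_integers) (use k in auto)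
    show ?thesis unfolding e X_def by (rule form_integers_le) (use k c R in auto)
  qed
  then have "LN / 2 * (real N / fact z * Q1 + 3 * \<delta>) \<le> LN / 2 * (real N / fact z * ((exp (2 * real k / real z) * rdensity z) ^ k *
      ((ln R)\<^sup>2 * ppow k X + 2 * c * ln R * ppow (k + 1) X + 2 * c\<^sup>2 * ppow (k + 2) X)) + 3 * \<delta>)"
    using LN0 by (intro mult_left_mono add_right_mono) auto
  moreover have "rdensity z ^ (k + 1) *
        (2 * (ln R)\<^sup>2 * ppow (k + 1) (ln R) + 6 * c * ln R * ppow (k + 2) (ln R) + 6 * c\<^sup>2 * ppow (k + 3) (ln R)) \<le> Q2"
  proof -
    have kz: "k \<le> z" using k by simp
    show ?thesis unfolding Q2_def scoeff_form_primes[OF k(1) kz]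
      by (rule form_primes_ge[OF k(1) kz c R(1)])
  qed
  then have "real k * (real N / real (totient (fact z)) * (rdensity z ^ (k + 1) *
        (2 * (ln R)\<^sup>2 * ppow (k + 1) (ln R) + 6 * c * ln R * ppow (k + 2) (ln R) + 6 * c\<^sup>2 * ppow (k + 3) (ln R))) - 2 * \<delta>)
     \<le> real k * (real N / real (totient (fact z)) * Q2 - 2 * \<delta>)"
    by (intro mult_left_mono diff_right_mono) auto
  ultimately show ?thesis using main unfolding LN_def by linarith
qed

section \<open>Asymptotics\<close>

lemma ln_power_le_powr:
  assumes "0 < a"
  shows "\<forall>\<^sub>F N::nat in sequentially. K * ln (real N) ^ p \<le> real N powr a"
proof -
  \<comment> \<open>The factor and the exponent are enlarged so that both are positive whatever K
    and p are.\<close>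
  have "((\<lambda>x::real. (\<bar>K\<bar> + 1) * ln x powr (real p + 1) / x powr a) \<longlongrightarrow> 0) at_top"
    using assms by real_asymp
  then have "\<forall>\<^sub>F x::real in at_top. (\<bar>K\<bar> + 1) * ln x powr (real p + 1) / x powr a < 1"
    by (rule order_tendstoD) simp
  then have "\<forall>\<^sub>F N::nat in sequentially. (\<bar>K\<bar> + 1) * ln (real N) powr (real p + 1) / real N powr a < 1"
    using filterlim_real_sequentially by (rule eventually_compose_filterlim)
  then show ?thesis
    using eventually_ge_at_top[of 3]
  proof eventually_elim
    case (elim N)
    have L: "1 \<le> ln (real N)" using elim(2) by (rule ln_ge_1)
    have "K * ln (real N) ^ p \<le> (\<bar>K\<bar> + 1) * ln (real N) ^ (p + 1)"
      using L by (intro mult_mono power_increasing) auto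
    also have "ln (real N) ^ (p + 1) = ln (real N) powr (real p + 1)"
      using L powr_realpow[of "ln (real N)" "p + 1"] by (simp add: add.commute)
    also have "(\<bar>K\<bar> + 1) * ln (real N) powr (real p + 1) \<le> real N powr a"
      using elim by (simp add: divide_less_eq split: if_splits)
    finally show ?case .
  qed
qed

text \<open>\<open>scoeff_bound\<close> involves the square of a k-dimensional sum, of order L^k,
  and one more logarithm: in total the exponent 2k + 1.\<close>

lemma scoeff_bound_log:
  assumes k: "1 \<le> k" "2 * k \<le> z" and c: "0 \<le> c" and \<eta>: "0 < \<eta>" "\<eta> \<le> 2"
  shows "\<exists>K\<ge>0. \<forall>N\<ge>3. \<forall>A\<in>rsets z (real N powr (\<eta> / 2)).
    \<bar>scoeff z k (real N powr (\<eta> / 2)) (sweight (real N powr (\<eta> / 2)) c) A\<bar> \<le> K * ln (real N) ^ (2 * k + 1)"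
proof -
  define D where "D = exp (2 * real k / real z) * rdensity z"
  define K1 where "K1 = D ^ k * (1 + real k * (fact z + 1)) ^ k"
  have D: "0 \<le> D" using rdensity_pos[of z] by (simp add: D_def)
  have K1: "0 \<le> K1" using D by (simp add: K1_def)
  show ?thesis
  proof (intro exI[of _ "(1 + c) * K1\<^sup>2"] conjI allI impI ballI)
    show "0 \<le> (1 + c) * K1\<^sup>2" using c by simp
    fix N A assume N: "3 \<le> (N::nat)" and A: "A \<in> rsets z (real N powr (\<eta> / 2))"
    define R where "R = real N powr (\<eta> / 2)"
    define L where "L = ln (real N)"
    have L: "1 \<le> L" using ln_ge_1[OF N] by (simp add: L_def)
    have lnR: "ln R = \<eta> / 2 * L" using N by (simp add: R_def L_def)
    have "\<eta> / 2 * L \<le> 1 * L" using \<eta> L by (intro mult_right_mono) auto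
    then have lnR': "0 \<le> ln R" "ln R \<le> L" unfolding lnR using \<eta> L by simp_all
    have R: "1 \<le> R" using N \<eta> unfolding R_def by (intro ge_one_powr_ge_zero) auto
    have "(\<Sum>B\<in>rsets z R. \<Prod>p\<in>B. real k / (real p - real k)) = (\<Sum>B\<in>rsets z R. \<Prod>p\<in>B. real k * (1 / (real p - real k)))"
      by simp
    also have "\<dots> \<le> D ^ k * ppow k (ln R + real k * (fact z + 1))"
    proof (rule rsets_power_sum_le)
      show "0 \<le> 1 / (real p - real k)" if "p \<in> rough z" for p
        using rough_gt[OF that] k by simp
      show "(\<Sum>A\<in>rsets z x. \<Prod>p\<in>A. 1 / (real p - real k)) \<le> D * (ln x + (fact z + 1))" if "1 \<le> x" for x
        using rsets_shifted_sum_le[of k z x] k that by (simp add: D_def mult.assoc)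
    qed (use D R in auto)
    also have "\<dots> \<le> D ^ k * ((1 + real k * (fact z + 1)) ^ k * L ^ k)"
    proof (rule mult_left_mono)
      let ?Y = "ln R + real k * (fact z + 1)"
      have Y0: "0 \<le> ?Y" using lnR' by (intro add_nonneg_nonneg) auto
      have "real k * (fact z + 1) * 1 \<le> real k * (fact z + 1) * L"
        using L by (intro mult_left_mono) auto
      then have Y: "?Y \<le> (1 + real k * (fact z + 1)) * L" using lnR' by (simp add: algebra_simps)
      have "ppow k ?Y = ?Y ^ k / fact k" using Y0 by (simp add: ppow_def)
      also have "\<dots> \<le> ?Y ^ k / 1" using Y0 fact_ge_1[of k, where 'a = real] by (intro divide_left_mono) auto
      also have "\<dots> \<le> ((1 + real k * (fact z + 1)) * L) ^ k" using Y Y0 by (simp add: power_mono)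
      finally show "ppow k ?Y \<le> (1 + real k * (fact z + 1)) ^ k * L ^ k" by (simp add: power_mult_distrib)
    qed (use D in auto)
    finally have T: "(\<Sum>B\<in>rsets z R. \<Prod>p\<in>B. real k / (real p - real k)) \<le> K1 * L ^ k"
      by (simp add: K1_def mult.assoc)
    have T0: "0 \<le> (\<Sum>B\<in>rsets z R. \<Prod>p\<in>B. real k / (real p - real k))"
    proof (intro sum_nonneg prod_nonneg)
      fix B p assume "B \<in> rsets z R" "p \<in> B"
      then have "z < p" using rsetsD(2) rough_gt by blast
      then show "0 \<le> real k / (real p - real k)" using k by simp
    qed
    have "\<bar>scoeff z k R (sweight R c) A\<bar> \<le> (1 + c) * ln R * (\<Sum>B\<in>rsets z R. \<Prod>p\<in>B. real k / (real p - real k))\<^sup>2"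
      using A k c unfolding R_def by (intro scoeff_bound) auto
    also have "\<dots> \<le> (1 + c) * L * (K1 * L ^ k)\<^sup>2"
      using lnR' c T T0 L by (intro mult_mono power_mono) auto
    also have "\<dots> = (1 + c) * K1\<^sup>2 * L ^ (2 * k + 1)"
      by (simp add: power_mult_distrib power_mult[symmetric] power_add mult_ac)
    finally show "\<bar>scoeff z k (real N powr (\<eta> / 2)) (sweight (real N powr (\<eta> / 2)) c) A\<bar> \<le> (1 + c) * K1\<^sup>2 * ln (real N) ^ (2 * k + 1)"
      unfolding R_def L_def .
  qed
qed

section \<open>Negligibility of the error terms\<close>

lemma level_eventually:
  assumes "0 < \<eta>" "\<eta> < \<theta>'"
  shows "\<forall>\<^sub>F N::nat in sequentially. K * real N powr \<eta> \<le> real N powr \<theta>'"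
proof -
  have "\<forall>\<^sub>F N::nat in sequentially. K * ln (real N) ^ 0 \<le> real N powr (\<theta>' - \<eta>)"
    using assms by (intro ln_power_le_powr) auto
  then show ?thesis
  proof eventually_elim
    case (elim N)
    then have "K * real N powr \<eta> \<le> real N powr (\<theta>' - \<eta>) * real N powr \<eta>" by (intro mult_right_mono) auto
    then show ?case by (simp add: powr_add[symmetric])
  qed
qed

text \<open>A saving of 2s logarithms pays for the squared coefficient bound. The range N \<le> M
  \<le> 3N covers all endpoints N + h, 2N + h and 2N + 1, and the gap between \<open>\<eta>\<close>
  and \<open>\<theta>'\<close> absorbs the factor \<open>fact z\<close> in the moduli.\<close>

lemma error_bounded:
  fixes E :: "nat \<Rightarrow> nat \<Rightarrow> real"
  assumes lev: "\<And>A. 0 < A \<Longrightarrow> \<exists>C. \<forall>M::nat. M \<ge> 2 \<longrightarrow>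
      (\<Sum>q\<in>{q::nat. 1 \<le> q \<and> real q \<le> real M powr \<theta>'}. E M q) \<le> C * real M / ln (real M) powr A"
    and nonneg: "\<And>M q. 0 < q \<Longrightarrow> 0 \<le> E M q"
    and triv: "\<And>M C. finite C \<Longrightarrow> C \<subseteq> rough z \<Longrightarrow> 3 \<le> M \<Longrightarrow> fact z * \<Prod>C \<le> M \<Longrightarrow>
      E M (fact z * \<Prod>C) \<le> 4 * real M * ln (real M) * (2 ^ card C / real (\<Prod>C))"
    and \<eta>: "0 < \<eta>" "\<eta> < \<theta>'" "\<eta> < 1"
  shows "\<exists>K. \<forall>\<^sub>F N in sequentially. \<forall>M. N \<le> M \<longrightarrow> M \<le> 3 * N \<longrightarrow>
    (K2 * ln (real N) ^ s)\<^sup>2 * (\<Sum>C\<in>rsets z (real N powr (\<eta> / 2) * real N powr (\<eta> / 2)). real m ^ card C * E M (fact z * \<Prod>C)) \<le> K * real N"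
proof -
  obtain K0 where K0: "\<And>M y. 3 \<le> M \<Longrightarrow> 1 \<le> y \<Longrightarrow> fact z * y \<le> real M powr \<theta>' \<Longrightarrow> fact z * y \<le> real M \<Longrightarrow>
     (\<Sum>C\<in>rsets z y. real m ^ card C * E M (fact z * \<Prod>C)) \<le> K0 * real M / ln (real M) ^ (2 * s)"
    using weighted_error[OF lev nonneg triv, of m "2 * s"] by blast
  have \<theta>': "0 < \<theta>'" using \<eta> by linarith
  show ?thesis
  proof (intro exI[of _ "K2\<^sup>2 * (\<bar>K0\<bar> * 3)"])
    show "\<forall>\<^sub>F N in sequentially. \<forall>M. N \<le> M \<longrightarrow> M \<le> 3 * N \<longrightarrow>
      (K2 * ln (real N) ^ s)\<^sup>2 * (\<Sum>C\<in>rsets z (real N powr (\<eta> / 2) * real N powr (\<eta> / 2)). real m ^ card C * E M (fact z * \<Prod>C)) \<le> K2\<^sup>2 * (\<bar>K0\<bar> * 3) * real N"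
      using level_eventually[OF \<eta>(1,2), of "fact z"] level_eventually[OF \<eta>(1,3), of "fact z"] eventually_ge_at_top[of 3]
    proof eventually_elim
      case (elim N)
      show ?case
      proof (intro allI impI)
        fix M assume M: "N \<le> M" "M \<le> 3 * N"
        let ?y = "real N powr (\<eta> / 2) * real N powr (\<eta> / 2)"
        have y: "?y = real N powr \<eta>" by (simp add: powr_add[symmetric])
        have L: "1 \<le> ln (real N)" using ln_ge_1 elim(3) by blast
        have LM: "ln (real N) \<le> ln (real M)" using M elim(3) by (intro ln_mono) auto
        have "(\<Sum>C\<in>rsets z ?y. real m ^ card C * E M (fact z * \<Prod>C)) \<le> K0 * real M / ln (real M) ^ (2 * s)"
        proof (rule K0)
          show "3 \<le> M" using M elim(3) by linarith
          show "1 \<le> ?y" unfolding y using \<eta> elim(3) by (intro ge_one_powr_ge_zero) auto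
          have "real N powr \<theta>' \<le> real M powr \<theta>'" using M \<theta>' by (intro powr_mono2) auto
          then show "fact z * ?y \<le> real M powr \<theta>'" unfolding y using elim(1) by linarith
          show "fact z * ?y \<le> real M" unfolding y using elim(2,3) M by simp
        qed
        also have "\<dots> \<le> \<bar>K0\<bar> * (3 * real N) / ln (real N) ^ (2 * s)"
        proof (rule frac_le)
          have "K0 * real M \<le> \<bar>K0\<bar> * real M" by (intro mult_right_mono) auto
          also have "\<dots> \<le> \<bar>K0\<bar> * (3 * real N)" using M by (intro mult_left_mono) auto
          finally show "K0 * real M \<le> \<bar>K0\<bar> * (3 * real N)" .
          show "ln (real N) ^ (2 * s) \<le> ln (real M) ^ (2 * s)" using L LM by (intro power_mono) auto
        qed (use L in auto)
        finally have "(\<Sum>C\<in>rsets z ?y. real m ^ card C * E M (fact z * \<Prod>C)) \<le> \<bar>K0\<bar> * (3 * real N) / ln (real N) ^ (2 * s)" .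
        then have "(K2 * ln (real N) ^ s)\<^sup>2 * (\<Sum>C\<in>rsets z ?y. real m ^ card C * E M (fact z * \<Prod>C)) \<le>
          (K2 * ln (real N) ^ s)\<^sup>2 * (\<bar>K0\<bar> * (3 * real N) / ln (real N) ^ (2 * s))"
          by (rule mult_left_mono) simp
        also have "\<dots> = K2\<^sup>2 * (\<bar>K0\<bar> * 3) * real N"
          using L by (simp add: power_mult_distrib power_mult[symmetric] mult.commute[of s 2])
        finally show "(K2 * ln (real N) ^ s)\<^sup>2 * (\<Sum>C\<in>rsets z ?y. real m ^ card C * E M (fact z * \<Prod>C)) \<le> K2\<^sup>2 * (\<bar>K0\<bar> * 3) * real N" .
      qed
    qed
  qed
qed

text \<open>Each modulus has error 1. Replacing 1 by y / \<open>\<Prod>C\<close> gives y =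
  N^\<open>\<eta>\<close> times a power of the logarithm, which is below N because
  \<open>\<eta>\<close> < 1.\<close>

lemma count_error_bounded:
  assumes \<eta>: "0 < \<eta>" "\<eta> < 1"
  shows "\<forall>\<^sub>F N in sequentially.
    (K2 * ln (real N) ^ s)\<^sup>2 * (\<Sum>C\<in>rsets z (real N powr (\<eta> / 2) * real N powr (\<eta> / 2)). real m ^ card C * 1) \<le> real N"
proof -
  let ?D = "real m * (fact z + 1)"
  have "\<forall>\<^sub>F N in sequentially. K2\<^sup>2 * (1 + ?D) ^ m * ln (real N) ^ (2 * s + m) \<le> real N powr (1 - \<eta>)"
    using \<eta> by (intro ln_power_le_powr) auto
  then show ?thesis
    using eventually_ge_at_top[of 3]
  proof eventually_elim
    case (elim N)
    let ?y = "real N powr (\<eta> / 2) * real N powr (\<eta> / 2)"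
    let ?L = "ln (real N)"
    have y: "?y = real N powr \<eta>" by (simp add: powr_add[symmetric])
    have L: "1 \<le> ?L" using ln_ge_1 elim(2) by blast
    have y1: "1 \<le> ?y" unfolding y using \<eta> elim(2) by (intro ge_one_powr_ge_zero) auto
    have "(\<Sum>C\<in>rsets z ?y. real m ^ card C * 1) \<le> (\<Sum>C\<in>rsets z ?y. ?y * (real m ^ card C / real (\<Prod>C)))"
    proof (rule sum_mono)
      fix C assume C: "C \<in> rsets z ?y"
      have "real m ^ card C * 1 \<le> real m ^ card C * (?y / real (\<Prod>C))"
        using rsetsD(3,4)[OF C] by (intro mult_left_mono) auto
      then show "real m ^ card C * 1 \<le> ?y * (real m ^ card C / real (\<Prod>C))" by (simp add: mult_ac)
    qed
    also have "\<dots> = ?y * (\<Sum>C\<in>rsets z ?y. real m ^ card C / real (\<Prod>C))" by (rule sum_distrib_left[symmetric])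
    also have "\<dots> \<le> ?y * ((1 + ?D) ^ m * ?L ^ m)"
    proof (rule mult_left_mono)
      have "ln ?y = \<eta> * ?L" unfolding y using elim(2) by simp
      moreover have "\<eta> * ?L \<le> 1 * ?L" using \<eta> L by (intro mult_right_mono) auto
      ultimately have "ln ?y \<le> ?L" by simp
      moreover have "?D * 1 \<le> ?D * ?L" using L by (intro mult_left_mono) auto
      ultimately have "ln ?y + ?D \<le> (1 + ?D) * ?L" by (simp add: algebra_simps)
      then have "(ln ?y + ?D) ^ m \<le> ((1 + ?D) * ?L) ^ m"
        using y1 by (intro power_mono add_nonneg_nonneg) auto
      then show "(\<Sum>C\<in>rsets z ?y. real m ^ card C / real (\<Prod>C)) \<le> (1 + ?D) ^ m * ?L ^ m"
        using rsets_weighted_reciprocal_le[OF y1, where z = z and j = m] by (simp add: power_mult_distrib)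
    qed (use y1 in auto)
    finally have "(\<Sum>C\<in>rsets z ?y. real m ^ card C * 1) \<le> real N powr \<eta> * ((1 + ?D) ^ m * ?L ^ m)"
      unfolding y .
    then have "(K2 * ?L ^ s)\<^sup>2 * (\<Sum>C\<in>rsets z ?y. real m ^ card C * 1) \<le> (K2 * ?L ^ s)\<^sup>2 * (real N powr \<eta> * ((1 + ?D) ^ m * ?L ^ m))"
      by (rule mult_left_mono) simp
    also have "\<dots> = real N powr \<eta> * (K2\<^sup>2 * (1 + ?D) ^ m * ?L ^ (2 * s + m))"
    proof -
      have "(K2 * ?L ^ s)\<^sup>2 = K2\<^sup>2 * ?L ^ (2 * s)"
        by (simp add: power_mult_distrib power_mult[symmetric] mult.commute[of s 2])
      then show ?thesis by (simp only: power_add mult_ac)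
    qed
    also have "\<dots> \<le> real N powr \<eta> * real N powr (1 - \<eta>)" using elim(1) by (rule mult_left_mono) simp
    also have "\<dots> = real N" using elim(2) by (simp add: powr_add[symmetric])
    finally show ?case .
  qed
qed

lemma condA_prime_err:
  assumes "condA \<theta>" "\<theta>' < \<theta>" "0 < A"
  shows "\<exists>C. \<forall>M::nat. M \<ge> 2 \<longrightarrow>
      (\<Sum>q\<in>{q::nat. 1 \<le> q \<and> real q \<le> real M powr \<theta>'}. prime_err M q) \<le> C * real M / ln (real M) powr A"
proof -
  have e: "\<theta> - (\<theta> - \<theta>') = \<theta>'" by simp
  have "0 < \<theta> - \<theta>'" using assms by simp
  from assms(1)[unfolded condA_def prime_err_def[symmetric], rule_format, OF this assms(3)]
  show ?thesis unfolding e by blast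
qed

lemma condB_liouville_err:
  assumes "condB \<theta>" "\<theta>' < \<theta>" "0 < A"
  shows "\<exists>C. \<forall>M::nat. M \<ge> 2 \<longrightarrow>
      (\<Sum>q\<in>{q::nat. 1 \<le> q \<and> real q \<le> real M powr \<theta>'}. liouville_err M q) \<le> C * real M / ln (real M) powr A"
proof -
  have e: "\<theta> - (\<theta> - \<theta>') = \<theta>'" by simp
  have "0 < \<theta> - \<theta>'" using assms by simp
  from assms(1)[unfolded condB_def liouville_err_def[symmetric], rule_format, OF this assms(3)]
  show ?thesis unfolding e by blast
qed

section \<open>Passage to the limit\<close>

text \<open>With f1, f2, f3 the factorials, the expression is homogeneous of degree k + 3 in
  \<open>L\<close> and its coefficient is \<open>J\<close>. In the companion lemma \<open>x\<close>
  is the ratio of the shifted logarithm to \<open>L\<close>; at x = 1 the coefficient is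
  \<open>I\<close>.\<close>

lemma prime_weight_polynomial:
  fixes L c f1 f2 f3 :: real
  shows "2 * L\<^sup>2 * (L ^ (k + 1) / f1) + 6 * c * L * (L ^ (k + 2) / f2) + 6 * c\<^sup>2 * (L ^ (k + 3) / f3) =
    L ^ (k + 3) * (2 / f1 + 6 * c / f2 + 6 * c\<^sup>2 / f3)"
proof -
  have "L ^ (k + 3) = L\<^sup>2 * L ^ (k + 1)" "L ^ (k + 3) = L * L ^ (k + 2)"
    by (simp_all add: power_add power2_eq_square power3_eq_cube)
  then have "2 * L\<^sup>2 * (L ^ (k + 1) / f1) = L ^ (k + 3) * (2 / f1)"
    "6 * c * L * (L ^ (k + 2) / f2) = L ^ (k + 3) * (6 * c / f2)" by (simp_all add: power2_eq_square)
  moreover have "6 * c\<^sup>2 * (L ^ (k + 3) / f3) = L ^ (k + 3) * (6 * c\<^sup>2 / f3)" by simp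
  ultimately show ?thesis by (simp only: distrib_left)
qed

lemma integer_weight_polynomial:
  fixes L x c f1 f2 f3 :: real
  shows "L\<^sup>2 * ((x * L) ^ k / f1) + 2 * c * L * ((x * L) ^ (k + 1) / f2) + 2 * c\<^sup>2 * ((x * L) ^ (k + 2) / f3) =
    L ^ (k + 2) * (x ^ k / f1 + 2 * c * x ^ (k + 1) / f2 + 2 * c\<^sup>2 * x ^ (k + 2) / f3)"
proof -
  have "L ^ (k + 2) = L\<^sup>2 * L ^ k" "L ^ (k + 2) = L * L ^ (k + 1)"
    by (simp_all add: power_add power2_eq_square)
  then have "L\<^sup>2 * ((x * L) ^ k / f1) = L ^ (k + 2) * (x ^ k / f1)"
    "2 * c * L * ((x * L) ^ (k + 1) / f2) = L ^ (k + 2) * (2 * c * x ^ (k + 1) / f2)"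
    unfolding power_mult_distrib by (simp_all add: power2_eq_square)
  moreover have "2 * c\<^sup>2 * ((x * L) ^ (k + 2) / f3) = L ^ (k + 2) * (2 * c\<^sup>2 * x ^ (k + 2) / f3)"
    unfolding power_mult_distrib by simp
  ultimately show ?thesis by (simp only: distrib_left)
qed

text \<open>Were the inequality to fail beyond \<open>n0\<close>, dividing
  \<open>sieve_inequality\<close> by its order of magnitude and letting N grow would give
  \<open>\<eta>\<close> k J \<le> exp(2k/z)^k I, against the choice of \<open>z\<close>.\<close>

lemma prime_tuple_beats_liouville:
  fixes H :: "nat set" and c \<eta> \<theta> :: real
  assumes H: "finite H" "card H = k" "2 \<le> k"
    and adm: "\<And>z. \<exists>b. \<forall>h\<in>H. coprime (b + h) (fact z :: nat)"
    and AB: "condA \<theta>" "condB \<theta>" and \<eta>: "0 < \<eta>" "\<eta> < \<theta>" "\<eta> < 1" and c: "0 \<le> c"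
    and num: "1 / fact k + 2 * c / fact (k + 1) + 2 * c\<^sup>2 / fact (k + 2) <
       \<eta> * real k * (2 / fact (k + 1) + 6 * c / fact (k + 2) + 6 * c\<^sup>2 / fact (k + 3))"
  shows "\<exists>n>n0. (1 + real_of_int (liouville (n + 1))) / 2 < (\<Sum>h\<in>H. of_bool (prime (n + h)))"
proof (rule ccontr)
  assume "\<not> (\<exists>n>n0. (1 + real_of_int (liouville (n + 1))) / 2 < (\<Sum>h\<in>H. of_bool (prime (n + h))))"
  then have hyp: "(\<Sum>h\<in>H. of_bool (prime (n + h))) \<le> (1 + real_of_int (liouville (n + 1))) / 2" if "n0 < n" for n
    using that by (meson not_less)
  define I J where "I = 1 / fact k + 2 * c / fact (k + 1) + 2 * c\<^sup>2 / fact (k + 2)"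
    and "J = 2 / fact (k + 1) + 6 * c / fact (k + 2) + 6 * c\<^sup>2 / fact (k + 3)"
  have "(\<lambda>z::nat. exp (2 * real k / real z) ^ k * I) \<longlonglongrightarrow> exp 0 ^ k * I"
    by (intro tendsto_intros tendsto_divide_0[OF tendsto_const] filterlim_at_top_imp_at_infinity filterlim_real_sequentially)
  then have "\<forall>\<^sub>F z in sequentially. exp (2 * real k / real z) ^ k * I < \<eta> * real k * J"
    using num by (intro order_tendstoD(2)) (auto simp: I_def J_def)
  moreover have "\<forall>\<^sub>F z in sequentially. \<forall>h\<in>H. h \<le> z"
    using H(1) by (simp add: eventually_ball_finite_distrib)
  ultimately have "\<forall>\<^sub>F z in sequentially. exp (2 * real k / real z) ^ k * I < \<eta> * real k * J \<and> (\<forall>h\<in>H. h \<le> z) \<and> 2 * k \<le> z"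
    using eventually_ge_at_top[of "2 * k"] by eventually_elim auto
  from eventually_happens'[OF sequentially_bot this]
  obtain z where z: "exp (2 * real k / real z) ^ k * I < \<eta> * real k * J" "\<forall>h\<in>H. h \<le> z" "2 * k \<le> z"
    by blast
  obtain b where b: "\<forall>h\<in>H. coprime (b + h) (fact z :: nat)" using adm by blast
  \<comment> \<open>Room on both sides: above \<open>\<eta>\<close> for the factor
    \<open>fact z\<close>, below \<open>\<theta>\<close> for the epsilon in (A) and (B).\<close>
  define \<theta>' where "\<theta>' = (\<eta> + \<theta>) / 2"
  have \<theta>': "\<eta> < \<theta>'" "\<theta>' < \<theta>" using \<eta> by (auto simp: \<theta>'_def)
  define R where "R = (\<lambda>N::nat. real N powr (\<eta> / 2))"
  obtain K2 where K2: "0 \<le> K2" "\<And>N A. 3 \<le> N \<Longrightarrow> A \<in> rsets z (R N) \<Longrightarrow>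
     \<bar>scoeff z k (R N) (sweight (R N) c) A\<bar> \<le> K2 * ln (real N) ^ (2 * k + 1)"
    using scoeff_bound_log[of k z c \<eta>] H(3) z(3) c \<eta> unfolding R_def by auto
  obtain KA where KA: "\<forall>\<^sub>F N in sequentially. \<forall>M. N \<le> M \<longrightarrow> M \<le> 3 * N \<longrightarrow>
    (K2 * ln (real N) ^ (2 * k + 1))\<^sup>2 * (\<Sum>C\<in>rsets z (R N * R N). real (4 * k) ^ card C * prime_err M (fact z * \<Prod>C)) \<le> KA * real N"
    using error_bounded[OF condA_prime_err[OF AB(1) \<theta>'(2)] prime_err_nonneg rough_class_err_le(1) \<eta>(1) \<theta>'(1) \<eta>(3)]
    unfolding R_def by blast
  obtain KB where KB: "\<forall>\<^sub>F N in sequentially. \<forall>M. N \<le> M \<longrightarrow> M \<le> 3 * N \<longrightarrow>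
    (K2 * ln (real N) ^ (2 * k + 1))\<^sup>2 * (\<Sum>C\<in>rsets z (R N * R N). real (4 * k) ^ card C * liouville_err M (fact z * \<Prod>C)) \<le> KB * real N"
    using error_bounded[OF condB_liouville_err[OF AB(2) \<theta>'(2)] liouville_err_nonneg rough_class_err_le(2) \<eta>(1) \<theta>'(1) \<eta>(3)]
    unfolding R_def by blast
  have KC: "\<forall>\<^sub>F N in sequentially.
    (K2 * ln (real N) ^ (2 * k + 1))\<^sup>2 * (\<Sum>C\<in>rsets z (R N * R N). real (4 * k) ^ card C * 1) \<le> real N"
    unfolding R_def by (rule count_error_bounded[OF \<eta>(1,3)])
  define K where "K = max 1 (max KA KB)"
  define L where "L = (\<lambda>N::nat. \<eta> / 2 * ln (real N))"
  define x where "x = (\<lambda>N. 1 + real k * (fact z + 1) / L N)"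
  define K' where "K' = K * fact z / rdensity z ^ k"
  define P where "P = (\<lambda>x. x ^ k / fact k + 2 * c * x ^ (k + 1) / fact (k + 1) + 2 * c\<^sup>2 * x ^ (k + 2) / fact (k + 2))"
  have L_top: "filterlim L at_top sequentially"
    unfolding L_def using \<eta>(1) by real_asymp
  have "\<forall>\<^sub>F N in sequentially. real k * (J - 2 * K' * (1 / L N) ^ (k + 3)) \<le>
     ln (real (2 * N + z)) / (2 * L N) * (exp (2 * real k / real z) ^ k * P (x N) + 3 * K' * (1 / L N) ^ (k + 2))"
    using KA KB KC eventually_ge_at_top[of "n0 + z + 3"]
  proof eventually_elim
    case (elim N)
    have N: "3 \<le> N" "n0 \<le> N" "z \<le> N" using elim(4) by auto
    have L0: "0 < L N" using ln_ge_1[OF N(1)] \<eta>(1) by (auto simp: L_def)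
    have lnR: "ln (R N) = L N" using N by (simp add: R_def L_def)
    have R: "1 \<le> R N" "R N \<le> real N"
    proof -
      show "1 \<le> R N" unfolding R_def using N \<eta> by (intro ge_one_powr_ge_zero) auto
      have "real N powr (\<eta> / 2) \<le> real N powr 1" using N \<eta> by (intro powr_mono) auto
      then show "R N \<le> real N" unfolding R_def using N by simp
    qed
    have KN: "KA * real N \<le> K * real N" "KB * real N \<le> K * real N" "real N \<le> K * real N"
    proof -
      show "KA * real N \<le> K * real N" "KB * real N \<le> K * real N" by (intro mult_right_mono; simp add: K_def)+
      have "1 * real N \<le> K * real N" by (intro mult_right_mono) (simp_all add: K_def)
      then show "real N \<le> K * real N" by simp
    qed
    have X: "ln (R N) + real k * (fact z + 1) = x N * L N"
      unfolding lnR x_def using L0 by (simp add: field_simps)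
    have x0: "0 \<le> x N * L N" using L0 by (simp add: x_def)
    have pL: "ppow i (L N) = L N ^ i / fact i" for i using L0 by (simp add: ppow_def)
    have pX: "ppow i (x N * L N) = (x N * L N) ^ i / fact i" for i using x0 by (simp add: ppow_def)
    have "real k * (real N / real (totient (fact z)) * (rdensity z ^ (k + 1) *
        (2 * (ln (R N))\<^sup>2 * ppow (k + 1) (ln (R N)) + 6 * c * ln (R N) * ppow (k + 2) (ln (R N)) + 6 * c\<^sup>2 * ppow (k + 3) (ln (R N)))) - 2 * (K * real N))
      \<le> ln (real (2 * N + z)) / 2 * (real N / fact z * ((exp (2 * real k / real z) * rdensity z) ^ k *
      ((ln (R N))\<^sup>2 * ppow k (ln (R N) + real k * (fact z + 1)) + 2 * c * ln (R N) * ppow (k + 1) (ln (R N) + real k * (fact z + 1)) +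
        2 * c\<^sup>2 * ppow (k + 2) (ln (R N) + real k * (fact z + 1)))) + 3 * (K * real N))"
    proof (rule sieve_inequality[OF H(1) _ H(2,3) z(3) c R, where \<Lambda> = "K2 * ln (real N) ^ (2 * k + 1)" and b = b])
      show "H \<subseteq> {..z}" using z(2) by auto
      show "coprime (b + h) (fact z)" if "h \<in> H" for h using b that by blast
      show "(\<Sum>h\<in>H. of_bool (prime (n + h))) \<le> (1 + real_of_int (liouville (n + 1))) / 2" if "n \<in> {N<..2 * N}" for n
        using hyp[of n] that N by auto
      show "\<bar>scoeff z k (R N) (sweight (R N) c) A\<bar> \<le> K2 * ln (real N) ^ (2 * k + 1)" if "A \<in> rsets z (R N)" for A
        using K2(2)[OF N(1) that] .
      show "(K2 * ln (real N) ^ (2 * k + 1))\<^sup>2 * (\<Sum>C\<in>rsets z (R N * R N). real (4 * k) ^ card C * 1) \<le> K * real N"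
        using elim(3) KN(3) by linarith
      fix h assume h: "h \<in> H"
      have "2 * N + h \<le> 3 * N" "N + h \<le> 3 * N" using z(2) h N by force+
      then show "(K2 * ln (real N) ^ (2 * k + 1))\<^sup>2 * (\<Sum>C\<in>rsets z (R N * R N). real (4 * k) ^ card C * prime_err (2 * N + h) (fact z * \<Prod>C)) \<le> K * real N"
        "(K2 * ln (real N) ^ (2 * k + 1))\<^sup>2 * (\<Sum>C\<in>rsets z (R N * R N). real (4 * k) ^ card C * prime_err (N + h) (fact z * \<Prod>C)) \<le> K * real N"
        using elim(1)[rule_format, of "2 * N + h"] elim(1)[rule_format, of "N + h"] KN(1) by linarith+
    next
      show "(K2 * ln (real N) ^ (2 * k + 1))\<^sup>2 * (\<Sum>C\<in>rsets z (R N * R N). real (4 * k) ^ card C * liouville_err (2 * N + 1) (fact z * \<Prod>C)) \<le> K * real N"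
        using elim(2)[rule_format, of "2 * N + 1"] KN(2) N by linarith
    qed
    then have m0: "real k * (real N / real (totient (fact z)) * (rdensity z ^ (k + 1) * (L N ^ (k + 3) * J)) - 2 * (K * real N))
      \<le> ln (real (2 * N + z)) / 2 * (real N / fact z * ((exp (2 * real k / real z) * rdensity z) ^ k * (L N ^ (k + 2) * P (x N))) + 3 * (K * real N))"
      unfolding J_def P_def X unfolding lnR pL pX prime_weight_polynomial integer_weight_polynomial .
    define S where "S = real N * rdensity z ^ k / fact z"
    have S: "0 < S" using N rdensity_pos[of z] by (simp add: S_def)
    \<comment> \<open>One of the k + 1 factors \<open>rdensity z\<close> turns the totient of
      \<open>fact z\<close> into \<open>fact z\<close> itself, so both sides share the scale
      \<open>S\<close>.\<close>
    have r1: "real N / real (totient (fact z)) * (rdensity z ^ (k + 1) * (L N ^ (k + 3) * J)) = S * L N ^ (k + 3) * J"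
      unfolding S_def rdensity_def by simp
    have r2: "real N / fact z * ((exp (2 * real k / real z) * rdensity z) ^ k * (L N ^ (k + 2) * P (x N))) =
       S * L N ^ (k + 2) * (exp (2 * real k / real z) ^ k * P (x N))"
      unfolding S_def power_mult_distrib by simp
    have r3: "K * real N = S * K'" unfolding S_def K'_def using rdensity_pos[of z] by simp
    from m0 have "real k * (S * L N ^ (k + 3) * J - 2 * (S * K')) \<le>
       ln (real (2 * N + z)) / 2 * (S * L N ^ (k + 2) * (exp (2 * real k / real z) ^ k * P (x N)) + 3 * (S * K'))"
      unfolding r1 r2 r3 .
    also have "S * L N ^ (k + 3) * J - 2 * (S * K') = S * L N ^ (k + 3) * (J - 2 * K' * (1 / L N) ^ (k + 3))"
      using L0 by (simp add: right_diff_distrib power_one_over)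
    also have "ln (real (2 * N + z)) / 2 * (S * L N ^ (k + 2) * (exp (2 * real k / real z) ^ k * P (x N)) + 3 * (S * K')) =
      S * L N ^ (k + 3) * (ln (real (2 * N + z)) / (2 * L N) * (exp (2 * real k / real z) ^ k * P (x N) + 3 * K' * (1 / L N) ^ (k + 2)))"
    proof -
      define P2 where "P2 = L N ^ (k + 2)"
      have P2: "L N ^ (k + 3) = P2 * L N" "(1 / L N) ^ (k + 2) = 1 / P2" "0 < P2"
        using L0 by (simp_all add: P2_def power_add power2_eq_square power3_eq_cube power_one_over)
      show ?thesis unfolding P2_def[symmetric] P2(1,2) using L0 P2(3) by (simp add: field_simps)
    qed
    finally have "S * L N ^ (k + 3) * (real k * (J - 2 * K' * (1 / L N) ^ (k + 3))) \<le>
      S * L N ^ (k + 3) * (ln (real (2 * N + z)) / (2 * L N) * (exp (2 * real k / real z) ^ k * P (x N) + 3 * K' * (1 / L N) ^ (k + 2)))"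
      by (simp only: mult_ac)
    then show ?case using S L0 by (simp only: mult_le_cancel_left_pos mult_pos_pos zero_less_power)
  qed
  moreover have inv: "(\<lambda>N. 1 / L N) \<longlonglongrightarrow> 0"
    by (intro tendsto_divide_0[OF tendsto_const] filterlim_at_top_imp_at_infinity L_top)
  then have "(\<lambda>N. real k * (J - 2 * K' * (1 / L N) ^ (k + 3))) \<longlonglongrightarrow> real k * (J - 2 * K' * 0 ^ (k + 3))"
    by (intro tendsto_intros)
  moreover have "(\<lambda>N. ln (real (2 * N + z)) / (2 * L N) * (exp (2 * real k / real z) ^ k * P (x N) + 3 * K' * (1 / L N) ^ (k + 2))) \<longlonglongrightarrow>
     1 / \<eta> * (exp (2 * real k / real z) ^ k * P 1 + 3 * K' * 0 ^ (k + 2))"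
  proof -
    \<comment> \<open>L is \<open>\<eta>\<close> / 2 times ln N, so the halves cancel: the factor
      1/2 of the Liouville bound offsets R being only the square root of the level.\<close>
    have "(\<lambda>N. ln (real (2 * N + z)) / (2 * L N)) \<longlonglongrightarrow> inverse \<eta>"
      unfolding L_def using \<eta>(1) by real_asymp
    then have "(\<lambda>N. ln (real (2 * N + z)) / (2 * L N)) \<longlonglongrightarrow> 1 / \<eta>"
      by (simp add: inverse_eq_divide)
    moreover have "(\<lambda>N. 1 + real k * (fact z + 1) / L N) \<longlonglongrightarrow> 1 + 0"
      by (intro tendsto_intros tendsto_divide_0[OF tendsto_const] filterlim_at_top_imp_at_infinity L_top)
    then have "x \<longlonglongrightarrow> 1" unfolding x_def by simp
    then have "(\<lambda>N. P (x N)) \<longlonglongrightarrow> P 1" unfolding P_def by (intro tendsto_intros) auto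
    ultimately show ?thesis using inv by (intro tendsto_mult tendsto_add tendsto_power tendsto_const)
  qed
  ultimately have "real k * (J - 2 * K' * 0 ^ (k + 3)) \<le> 1 / \<eta> * (exp (2 * real k / real z) ^ k * P 1 + 3 * K' * 0 ^ (k + 2))"
    by (intro tendsto_le[OF trivial_limit_sequentially])
  then have "real k * J \<le> 1 / \<eta> * (exp (2 * real k / real z) ^ k * I)"
    by (simp add: P_def I_def power_add)
  then have "\<eta> * real k * J \<le> exp (2 * real k / real z) ^ k * I" using \<eta>(1) by (simp add: field_simps)
  then show False using z(1) by linarith
qed

section \<open>Shifts of primes\<close>

text \<open>Both \<open>11, 13, 17, 19, 23\<close> and \<open>101, 103, 107, 109, 113\<close> consist of primes.\<close>

lemma prime_quintuple_admissible:
  "\<exists>b. \<forall>h\<in>{0, 2, 6, 8, 12}. coprime (b + h) (fact z :: nat)"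
proof -
  \<comment> \<open>A prime outside the first quintuple divides none of its members; a prime inside
    it divides no member of the second, all of which are larger primes. The Chinese remainder
    theorem joins the two choices.\<close>
  define u :: "nat \<Rightarrow> nat" where "u = (\<lambda>p. if p \<in> {11, 13, 17, 19, 23} then 101 else 11)"
  have "\<exists>b. \<forall>p\<in>{p. prime p \<and> p \<le> z}. [b = u p] (mod p)"
    by (intro chinese_remainder_nat) (auto intro: primes_coprime)
  then obtain b where b: "\<And>p. prime p \<Longrightarrow> p \<le> z \<Longrightarrow> [b = u p] (mod p)" by blast
  have u: "\<not> p dvd u p + h" if p: "prime p" and h: "h \<in> {0, 2, 6, 8, 12}" for p h
  proof (cases "p \<in> {11, 13, 17, 19, 23}")
    case True
    then show ?thesis using h by (auto simp: u_def)
  next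
    case False
    have "prime (11 + h)" using h by auto
    moreover have "p \<noteq> 11 + h" using False h by auto
    ultimately show ?thesis using False p primes_dvd_imp_eq by (auto simp: u_def)
  qed
  have "coprime (b + h) (fact z :: nat)" if h: "h \<in> {0, 2, 6, 8, 12}" for h
  proof (rule ccontr)
    assume "\<not> coprime (b + h) (fact z :: nat)"
    then have "gcd (b + h) (fact z) \<noteq> 1" using coprime_iff_gcd_eq_1[of "b + h" "fact z"] by blast
    from prime_factor_nat[OF this] obtain p where p: "prime p" "p dvd gcd (b + h) (fact z)" by blast
    have d: "p dvd b + h" and "p dvd (fact z :: nat)" using p(2) by simp_all
    then have "p \<le> z" using p(1) prime_dvd_fact_iff[of p z] by simp
    then have "[b + h = u p + h] (mod p)" using b[OF p(1)] by (intro cong_add) auto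
    then have "p dvd u p + h" using d cong_dvd_iff[of "b + h" "u p + h" p] by simp
    then show False using u[OF p(1) h] by simp
  qed
  then show ?thesis by blast
qed

lemma liouville_prime: "prime p \<Longrightarrow> liouville p = -1"
  by (simp add: liouville_def bigOmega_def prime_factorization_prime)

text \<open>If every shift d failed, some \<open>n\<close> beyond all finite exceptions would
  satisfy the tuple inequality. For \<open>\<lambda>(n + 1) = -1\<close> one prime n + h suffices,
  with d = 1 - h; for \<open>\<lambda>(n + 1) = 1\<close> there are two, and their difference is the
  shift.\<close>

lemma exists_shift:
  fixes H :: "nat set" and c \<theta> \<theta>0 :: real
  assumes H: "H \<subseteq> {0, 2, 6, 8, 12}" "card H = k" "2 \<le> k" "\<And>h. h \<in> H \<Longrightarrow> h \<le> D" "2 \<le> D"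
    and AB: "condA \<theta>" "condB \<theta>" and \<theta>: "0 < \<theta>0" "\<theta>0 < 1" "\<theta>0 < \<theta>" and c: "0 \<le> c"
    and num: "1 / fact k + 2 * c / fact (k + 1) + 2 * c\<^sup>2 / fact (k + 2) \<le>
       \<theta>0 * real k * (2 / fact (k + 1) + 6 * c / fact (k + 2) + 6 * c\<^sup>2 / fact (k + 3))"
  shows "\<exists>d::int. d \<noteq> 0 \<and> \<bar>d\<bar> \<le> int D \<and>
           infinite {p::nat. prime p \<and> int p + d > 0 \<and> liouville (nat (int p + d)) = -1}"
proof (rule ccontr)
  let ?S = "\<lambda>d::int. {p::nat. prime p \<and> int p + d > 0 \<and> liouville (nat (int p + d)) = -1}"
  assume "\<not> (\<exists>d::int. d \<noteq> 0 \<and> \<bar>d\<bar> \<le> int D \<and> infinite (?S d))"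
  then have fin: "finite (?S d)" if "d \<noteq> 0" "\<bar>d\<bar> \<le> int D" for d using that by blast
  have "finite (\<Union>d\<in>{-int D..int D} - {0}. ?S d)" using fin by (intro finite_UN_I) auto
  then obtain n0 where n0: "\<And>p. p \<in> (\<Union>d\<in>{-int D..int D} - {0}. ?S d) \<Longrightarrow> p \<le> n0"
    using finite_nat_set_iff_bounded_le by meson
  have no: "liouville (nat (int p + d)) \<noteq> -1" if "prime p" "n0 < p" "d \<noteq> 0" "\<bar>d\<bar> \<le> int D" "int p + d > 0" for p d
  proof
    assume "liouville (nat (int p + d)) = -1"
    then have "p \<in> (\<Union>d\<in>{-int D..int D} - {0}. ?S d)" using that by (intro UN_I[of d]) auto
    from n0[OF this] show False using that(2) by simp
  qed
  \<comment> \<open>Strictly above \<open>\<theta>0\<close>, so that the weak inequality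
    \<open>num\<close> becomes strict, yet below \<open>\<theta>\<close> and 1.\<close>
  define \<eta> where "\<eta> = (\<theta>0 + min \<theta> 1) / 2"
  have \<eta>: "0 < \<eta>" "\<eta> < \<theta>" "\<eta> < 1" "\<theta>0 < \<eta>" using \<theta> by (auto simp: \<eta>_def min_def)
  have finH: "finite H" using H(1) finite_subset by blast
  let ?J = "2 / fact (k + 1) + 6 * c / fact (k + 2) + 6 * c\<^sup>2 / fact (k + 3)"
  have "0 < ?J" using c by (intro add_pos_nonneg) auto
  then have "\<theta>0 * (real k * ?J) < \<eta> * (real k * ?J)"
    using \<eta>(4) H(3) by (intro mult_strict_right_mono mult_pos_pos) auto
  then have num': "1 / fact k + 2 * c / fact (k + 1) + 2 * c\<^sup>2 / fact (k + 2) < \<eta> * real k * ?J"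
    using num by (simp only: mult.assoc)
  obtain n where n: "n0 < n" "(1 + real_of_int (liouville (n + 1))) / 2 < (\<Sum>h\<in>H. of_bool (prime (n + h)))"
    using prime_tuple_beats_liouville[OF finH H(2,3) _ AB \<eta>(1-3) c num', of n0] prime_quintuple_admissible H(1) by blast
  define P where "P = {h \<in> H. prime (n + h)}"
  have "(\<Sum>h\<in>H. of_bool (prime (n + h))) = real (card P)"
    using finH by (simp add: P_def of_bool_def sum.If_cases Int_def)
  then have card: "(1 + real_of_int (liouville (n + 1))) / 2 < real (card P)" using n(2) by simp
  have finP: "finite P" using finH by (simp add: P_def)
  from liouville_cases[of "n + 1"] show False
  proof
    assume "liouville (n + 1) = -1"
    moreover have "0 < card P" using card calculation by simp
    then obtain h where h: "h \<in> P" using finP by (metis card_gt_0_iff ex_in_conv)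
    \<comment> \<open>All elements of \<open>H\<close> are even, so d = 1 - h is never 0, and |1 -
      h| \<le> D also holds for h = 0.\<close>
    have h': "h \<in> H" "prime (n + h)" "h \<noteq> 1" "h \<le> D" using h H(1,4) by (auto simp: P_def)
    have "liouville (nat (int (n + h) + (1 - int h))) \<noteq> -1"
      using h' n(1) H(5) by (intro no) auto
    moreover have "nat (int (n + h) + (1 - int h)) = n + 1" by simp
    ultimately show False by simp
  next
    assume "liouville (n + 1) = 1"
    then have "1 < card P" using card by simp
    then obtain h g where hg: "h \<in> P" "g \<in> P" "h \<noteq> g"
      using finP by (metis One_nat_def card_le_Suc0_iff_eq not_less)
    then have hg': "prime (n + h)" "prime (n + g)" "h \<le> D" "g \<le> D" using H(4) by (auto simp: P_def)
    have "liouville (nat (int (n + h) + (int g - int h))) \<noteq> -1"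
      using hg hg' n(1) by (intro no) auto
    moreover have "nat (int (n + h) + (int g - int h)) = n + g" by simp
    ultimately show False using liouville_prime[OF hg'(2)] by simp
  qed
qed

theorem theorem7:
  fixes \<theta>0 \<theta> :: real and D :: nat
  assumes "(\<theta>0, D) \<in> {(0.729, 2), (0.616, 6), (0.554, 8), (0.515, 12)}"
    and "\<theta> > \<theta>0" and "condA \<theta>" and "condB \<theta>"
  shows "\<exists>d::int. d \<noteq> 0 \<and> \<bar>d\<bar> \<le> int D \<and>
           infinite {p::nat. prime p \<and> int p + d > 0 \<and> liouville (nat (int p + d)) = -1}"
proof -
  \<comment> \<open>The integers c = 1, 3, 6, 12 bring I / (k J) within 0.001 of its minimum over c:
    about 0.7237, 0.6126, 0.5516 and 0.5134 for k = 2, 3, 4, 5, each below the corresponding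
    \<open>\<theta>0\<close>.\<close>
  have "\<exists>k c H. H \<subseteq> {0, 2, 6, 8, 12} \<and> card H = k \<and> 2 \<le> k \<and> (\<forall>h\<in>H. h \<le> D) \<and> 2 \<le> D \<and> 0 < \<theta>0 \<and> \<theta>0 < 1 \<and> (0::real) \<le> c \<and>
     1 / fact k + 2 * c / fact (k + 1) + 2 * c\<^sup>2 / fact (k + 2) \<le>
       \<theta>0 * real k * (2 / fact (k + 1) + 6 * c / fact (k + 2) + 6 * c\<^sup>2 / fact (k + 3))"
    (is "\<exists>k c H. ?Q k c H")
    using assms(1) unfolding insert_iff empty_iff prod.inject
  proof (elim disjE conjE FalseE)
    assume "\<theta>0 = 0.729" "D = 2"
    then have "?Q 2 1 {0, 2}" by (simp add: fact_numeral)
    then show ?thesis by blast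
  next
    assume "\<theta>0 = 0.616" "D = 6"
    then have "?Q 3 3 {0, 2, 6}" by (simp add: fact_numeral)
    then show ?thesis by blast
  next
    assume "\<theta>0 = 0.554" "D = 8"
    then have "?Q 4 6 {0, 2, 6, 8}" by (simp add: fact_numeral)
    then show ?thesis by blast
  next
    assume "\<theta>0 = 0.515" "D = 12"
    then have "?Q 5 12 {0, 2, 6, 8, 12}" by (simp add: fact_numeral)
    then show ?thesis by blast
  qed
  then obtain k c H where q: "H \<subseteq> {0, 2, 6, 8, 12}" "card H = k" "2 \<le> k" "\<forall>h\<in>H. h \<le> D" "2 \<le> D"
      "0 < \<theta>0" "\<theta>0 < 1" "(0::real) \<le> c"
      "1 / fact k + 2 * c / fact (k + 1) + 2 * c\<^sup>2 / fact (k + 2) \<le>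
        \<theta>0 * real k * (2 / fact (k + 1) + 6 * c / fact (k + 2) + 6 * c\<^sup>2 / fact (k + 3))"
    by (elim exE conjE)
  show ?thesis
    by (rule exists_shift[OF q(1-3) _ q(5) assms(3,4) q(6,7) assms(2) q(8,9)]) (simp add: q(4))
qed

end
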